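(* Let $\rho_0\in\mathcal P_2^{ac}(\mathbb R^d)$ and let $\Theta\subset\mathbb R^m$. Let $\Theta\ni\theta\mapsto T_\theta\in K_{\rho_0}$ be differentiable and such that $d_\theta T_\theta$ is injective for all $\theta\in\Theta$, and let $D:\mathcal P_2(\mathbb R^d)\to\mathbb R$ be (Wasserstein) differentiable. Then the flow $$\partial_t\theta_t\in\operatorname*{arg\,min}_{\delta\theta\in \mathrm{Tan}_{\theta_t}\Theta}\int_{\mathbb R^d}\big\|-\nabla_WD(T_{\theta_t*}\rho_0)\circ T_{\theta_t}-\nabla_\theta T_{\theta_t}.\delta\theta\big\|^2\,d\rho_0$$ is the $L^2_{\rho_0}$-natural gradient flow of $F:T\mapsto D(T_*\rho_0)$ on $\Theta$.
   Context: $\mathcal P_2(\mathbb R^d)$ is the set of Borel probability measures on $\mathbb R^d$ ($d\ge1$) with finite second moment, with the $2$-Wasserstein distance $W_2$ ($\rightharpoonup$ denotes $W_2$-convergence), and $\mathcal P_2^{ac}(\mathbb R^d)$ is the subset of measures absolutely continuous w.r.t. Lebesgue measure. $T_*\rho$ is the pushforward. $L^2_{\rho}(\mathbb R^d,\mathbb R^d)$ is the Hilbert space of $\rho$-square-integrable maps. $K_{\rho_0}\subset L^2_{\rho_0}(\mathbb R^d,\mathbb R^d)$ is the set of all $\nabla\phi\in L^2_{\rho_0}(\mathbb R^d,\mathbb R^d)$ with $\phi$ convex (possibly $+\infty$ off a set of full $\rho_0$-measure), i.e. the optimal transport maps from $\rho_0$. Differentiability of $\theta\mapsto T_\theta$ is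 as a map into the Hilbert space $L^2_{\rho_0}(\mathbb R^d,\mathbb R^d)$, and $\nabla_\theta T_\theta.\delta\theta=d_\theta T_\theta[\delta\theta]$. Wasserstein differentiability: let $\Pi_o(\rho,\gamma)$ be the set of optimal plans between $\rho$ and $\gamma$. $\partial^-D(\rho)$ is the set of $\xi\in L^2_\rho(\mathbb R^d,\mathbb R^d)$ with $D(\gamma)-D(\rho)\ge\inf_{\pi\in\Pi_o(\rho,\gamma)}\iint\langle\xi(x),y-x\rangle\,d\pi(x,y)+o(W_2(\rho,\gamma))$ as $\gamma\rightharpoonup\rho$; $\partial^+D(\rho)=-\partial^-(-D)(\rho)$. $D$ is differentiable if $\partial^-D(\rho)\cap\partial^+D(\rho)\neq\emptyset$ for every $\rho$, and $\nabla_WD(\rho)$ is then the element of minimal norm of this set. $L^2_{\rho_0}$-natural gradient flow: $\Theta$ is viewed as a finite-dimensional manifold, with tangent space $T_\theta\Theta=\mathrm{Tan}_\theta\Theta$. Given $F:L^2_{\rho_0}(\mathbb R^d,\mathbb R^d)\to\mathbb R$ differentiable, the $L^2_{\rho_0}$-natural gradient flow of $F$ on $\Theta$ is the gradient flow $\partial_t\theta_t=-\mathrm{grad}^h_\Theta L(\theta_t)$ of $L:\theta\mapsto F(T_\theta)$ with respect to the Riemannian metric $$h_\theta(\delta\theta,\delta\theta)=\int_{\mathbb R^d}\|d_\theta T_\theta[\delta\theta]\|^2\,d\rho_0,\qquad \theta\in\Theta,\ \delta\theta\in T_\theta\Theta,$$ i.e. the pullback by $\theta\mapsto T_\theta$ of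 the flat $L^2_{\rho_0}$-metric; here $\mathrm{grad}^h_\Theta L(\theta)$ is defined by $h_\theta(\mathrm{grad}^h_\Theta L(\theta),\cdot)=d_\theta L[\cdot]$. *)

theory Defs
  imports "HOL-Probability.Probability"
begin

section \<open>Square-integrable maps\<close>

text \<open>
  The Hilbert space \<open>L\<^sup>2\<^sub>\<rho>\<close> is handled through representatives: its elements are the functions in
  \<open>L2 \<rho>\<close>, and equality in the Hilbert space is equality \<open>\<rho>\<close>-almost everywhere.
\<close>

definition L2 :: "'a measure \<Rightarrow> ('a \<Rightarrow> 'b::euclidean_space) set" where
  "L2 \<rho> = {f. f \<in> borel_measurable \<rho> \<and> integrable \<rho> (\<lambda>x. (norm (f x))\<^sup>2)}"

definition L2_inner :: "'a measure \<Rightarrow> ('a \<Rightarrow> 'b::euclidean_space) \<Rightarrow> ('a \<Rightarrow> 'b) \<Rightarrow> real" where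
  "L2_inner \<rho> f g = (LINT x|\<rho>. f x \<bullet> g x)"

definition L2_norm :: "'a measure \<Rightarrow> ('a \<Rightarrow> 'b::euclidean_space) \<Rightarrow> real" where
  "L2_norm \<rho> f = sqrt (LINT x|\<rho>. (norm (f x))\<^sup>2)"

text \<open>
  The bound on \<open>l\<close> makes it respect equality almost everywhere, and the last clause does the same
  for \<open>F\<close>, so both are defined on the Hilbert space.
\<close>

definition has_L2_frechet_derivative ::
    "(('a \<Rightarrow> 'b::euclidean_space) \<Rightarrow> real) \<Rightarrow> (('a \<Rightarrow> 'b) \<Rightarrow> real) \<Rightarrow> 'a measure \<Rightarrow> ('a \<Rightarrow> 'b) \<Rightarrow> bool" where
  "has_L2_frechet_derivative F l \<rho> f \<longleftrightarrow>
     (\<forall>g\<in>L2 \<rho>. \<forall>h\<in>L2 \<rho>. \<forall>a b. l (\<lambda>x. a *\<^sub>R g x + b *\<^sub>R h x) = a * l g + b * l h) \<and>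
     (\<exists>C. \<forall>g\<in>L2 \<rho>. \<bar>l g\<bar> \<le> C * L2_norm \<rho> g) \<and>
     (\<forall>\<epsilon>>0. \<exists>\<delta>>0. \<forall>g\<in>L2 \<rho>. L2_norm \<rho> (\<lambda>x. g x - f x) < \<delta> \<longrightarrow>
        \<bar>F g - F f - l (\<lambda>x. g x - f x)\<bar> \<le> \<epsilon> * L2_norm \<rho> (\<lambda>x. g x - f x))"

definition L2_differentiable :: "'a measure \<Rightarrow> (('a \<Rightarrow> 'b::euclidean_space) \<Rightarrow> real) \<Rightarrow> bool" where
  "L2_differentiable \<rho> F \<longleftrightarrow> (\<forall>f\<in>L2 \<rho>. \<exists>l. has_L2_frechet_derivative F l \<rho> f)"

text \<open>
  Differentiability at \<open>\<theta>\<close>, relative to \<open>S\<close>, of a map \<open>T\<close> with values in \<open>L\<^sup>2\<^sub>\<rho>\<close>; this is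
  \<^const>\<open>has_derivative\<close> with linearity and the norm read in \<open>L\<^sup>2\<^sub>\<rho>\<close>.  (A linear map from a
  Euclidean space is bounded.)  When \<open>S\<close> is a submanifold, only the restriction of \<open>A\<close> to the
  tangent space is determined; that restriction is the differential.
\<close>

definition L2_has_derivative_within ::
    "('p::euclidean_space \<Rightarrow> 'a \<Rightarrow> 'b::euclidean_space) \<Rightarrow> ('p \<Rightarrow> 'a \<Rightarrow> 'b) \<Rightarrow> 'a measure \<Rightarrow> 'p \<Rightarrow> 'p set \<Rightarrow> bool" where
  "L2_has_derivative_within T A \<rho> \<theta> S \<longleftrightarrow>
     (\<forall>v. A v \<in> L2 \<rho>) \<and>
     (\<forall>v w a b. AE x in \<rho>. A (a *\<^sub>R v + b *\<^sub>R w) x = a *\<^sub>R A v x + b *\<^sub>R A w x) \<and>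
     ((\<lambda>\<theta>'. L2_norm \<rho> (\<lambda>x. T \<theta>' x - T \<theta> x - A (\<theta>' - \<theta>) x) / norm (\<theta>' - \<theta>)) \<longlongrightarrow> 0) (at \<theta> within S)"


section \<open>Wasserstein space\<close>

definition P2 :: "'a::euclidean_space measure set" where
  "P2 = {\<rho>. sets \<rho> = sets borel \<and> prob_space \<rho> \<and> integrable \<rho> (\<lambda>x. (norm x)\<^sup>2)}"

definition P2_ac :: "'a::euclidean_space measure set" where
  "P2_ac = {\<rho>\<in>P2. absolutely_continuous lborel \<rho>}"

definition couplings :: "'a::euclidean_space measure \<Rightarrow> 'a measure \<Rightarrow> ('a \<times> 'a) measure set" where
  "couplings \<rho> \<gamma> = {\<pi>. sets \<pi> = sets borel \<and> distr \<pi> borel fst = \<rho> \<and> distr \<pi> borel snd = \<gamma>}"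

definition transport_cost :: "('a::euclidean_space \<times> 'a) measure \<Rightarrow> real" where
  "transport_cost \<pi> = (LINT (x, y)|\<pi>. (norm (x - y))\<^sup>2)"

definition W2 :: "'a::euclidean_space measure \<Rightarrow> 'a measure \<Rightarrow> real" where
  "W2 \<rho> \<gamma> = sqrt (INF \<pi>\<in>couplings \<rho> \<gamma>. transport_cost \<pi>)"

definition optimal_plans :: "'a::euclidean_space measure \<Rightarrow> 'a measure \<Rightarrow> ('a \<times> 'a) measure set" where
  "optimal_plans \<rho> \<gamma> = {\<pi>\<in>couplings \<rho> \<gamma>. \<forall>\<pi>'\<in>couplings \<rho> \<gamma>. transport_cost \<pi> \<le> transport_cost \<pi>'}"

text \<open>
  The infimum is taken in \<open>ereal\<close>, where the infimum over the empty set is \<open>\<infinity>\<close> and not an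
  unspecified number; between measures in \<^const>\<open>P2\<close> optimal plans exist and it is finite.
\<close>

definition wasserstein_subdifferential ::
    "('a::euclidean_space measure \<Rightarrow> real) \<Rightarrow> 'a measure \<Rightarrow> ('a \<Rightarrow> 'a) set" where
  "wasserstein_subdifferential D \<rho> =
     {\<xi>\<in>L2 \<rho>. \<forall>\<epsilon>>0. \<exists>\<delta>>0. \<forall>\<gamma>\<in>P2. W2 \<rho> \<gamma> < \<delta> \<longrightarrow>
        ereal (D \<gamma> - D \<rho>) \<ge>
          (INF \<pi>\<in>optimal_plans \<rho> \<gamma>. ereal (LINT (x, y)|\<pi>. \<xi> x \<bullet> (y - x))) - ereal (\<epsilon> * W2 \<rho> \<gamma>)}"

definition wasserstein_superdifferential ::
    "('a::euclidean_space measure \<Rightarrow> real) \<Rightarrow> 'a measure \<Rightarrow> ('a \<Rightarrow> 'a) set" where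
  "wasserstein_superdifferential D \<rho> =
     (\<lambda>\<xi> x. - \<xi> x) ` wasserstein_subdifferential (\<lambda>\<gamma>. - D \<gamma>) \<rho>"

definition wasserstein_differential ::
    "('a::euclidean_space measure \<Rightarrow> real) \<Rightarrow> 'a measure \<Rightarrow> ('a \<Rightarrow> 'a) set" where
  "wasserstein_differential D \<rho> = wasserstein_subdifferential D \<rho> \<inter> wasserstein_superdifferential D \<rho>"

definition wasserstein_differentiable :: "('a::euclidean_space measure \<Rightarrow> real) \<Rightarrow> bool" where
  "wasserstein_differentiable D \<longleftrightarrow> (\<forall>\<rho>\<in>P2. wasserstein_differential D \<rho> \<noteq> {})"

text \<open>The element of minimal norm; the choice operator only selects a representative of its class.\<close>

definition wasserstein_gradient ::
    "('a::euclidean_space measure \<Rightarrow> real) \<Rightarrow> 'a measure \<Rightarrow> 'a \<Rightarrow> 'a" where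
  "wasserstein_gradient D \<rho> =
     (SOME \<xi>. is_arg_min (L2_norm \<rho>) (\<lambda>\<xi>. \<xi> \<in> wasserstein_differential D \<rho>) \<xi>)"

text \<open>
  The set \<open>K\<^sub>\<rho>\<close> of optimal transport maps from \<open>\<rho>\<close>.  A convex function with values in
  \<open>(-\<infinity>, \<infinity>]\<close> is represented by its effective domain \<open>C\<close> and its real values \<open>\<phi>\<close> on \<open>C\<close>; it can
  only be differentiable at interior points of \<open>C\<close>.
\<close>

definition convex_gradients :: "'a::euclidean_space measure \<Rightarrow> ('a \<Rightarrow> 'a) set" where
  "convex_gradients \<rho> =
     {T\<in>L2 \<rho>. \<exists>C \<phi>. convex C \<and> convex_on C \<phi> \<and> (AE x in \<rho>. x \<in> interior C \<and> GDERIV \<phi> x :> T x)}"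


section \<open>Submanifolds and gradient flows\<close>

definition C1_on :: "'p::euclidean_space set \<Rightarrow> ('p \<Rightarrow> 'p) \<Rightarrow> bool" where
  "C1_on U f \<longleftrightarrow> (\<exists>f' :: 'p \<Rightarrow> ('p \<Rightarrow>\<^sub>L 'p).
     continuous_on U f' \<and> (\<forall>x\<in>U. (f has_derivative blinfun_apply (f' x)) (at x)))"

definition submanifold :: "nat \<Rightarrow> 'p::euclidean_space set \<Rightarrow> bool" where
  "submanifold k S \<longleftrightarrow> (\<forall>p\<in>S. \<exists>U V \<Phi> \<Psi> E.
     open U \<and> p \<in> U \<and> open V \<and> homeomorphism U V \<Phi> \<Psi> \<and> C1_on U \<Phi> \<and> C1_on V \<Psi> \<and>
     subspace E \<and> dim E = k \<and> \<Phi> ` (S \<inter> U) = E \<inter> V)"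

text \<open>
  For a submanifold it makes no difference whether the curves are required to be differentiable only
  at \<open>0\<close> or continuously differentiable.
\<close>

definition Tan :: "'p::euclidean_space set \<Rightarrow> 'p \<Rightarrow> 'p set" where
  "Tan S p = {v. \<exists>c. c 0 = p \<and> (\<forall>\<^sub>F t in nhds 0. c t \<in> S) \<and> (c has_vector_derivative v) (at (0::real))}"

text \<open>
  The derivative \<open>L'\<close> within \<open>S\<close> is determined on \<open>Tan S p\<close>, where it is the differential of the
  restriction of \<open>L\<close> to the submanifold \<open>S\<close>.
\<close>

definition is_riemannian_gradient ::
    "('p \<Rightarrow> 'p \<Rightarrow> 'p \<Rightarrow> real) \<Rightarrow> 'p::euclidean_space set \<Rightarrow> ('p \<Rightarrow> real) \<Rightarrow> 'p \<Rightarrow> 'p \<Rightarrow> bool" where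
  "is_riemannian_gradient h S L p g \<longleftrightarrow>
     g \<in> Tan S p \<and> (\<exists>L'. (L has_derivative L') (at p within S) \<and> (\<forall>v\<in>Tan S p. h p g v = L' v))"

text \<open>
  The pullback by \<open>\<theta> \<mapsto> T\<^sub>\<theta>\<close>, with differential \<open>dT\<close>, of the flat \<open>L\<^sup>2\<close>-metric, as a bilinear form.
\<close>

definition pullback_metric ::
    "'a measure \<Rightarrow> ('p \<Rightarrow> 'p \<Rightarrow> 'a \<Rightarrow> 'b::euclidean_space) \<Rightarrow> 'p \<Rightarrow> 'p \<Rightarrow> 'p \<Rightarrow> real" where
  "pullback_metric \<rho> dT \<theta> v w = L2_inner \<rho> (dT \<theta> v) (dT \<theta> w)"

definition is_natural_gradient ::
    "'a measure \<Rightarrow> 'p::euclidean_space set \<Rightarrow> ('p \<Rightarrow> 'a \<Rightarrow> 'b::euclidean_space) \<Rightarrow> ('p \<Rightarrow> 'p \<Rightarrow> 'a \<Rightarrow> 'b) \<Rightarrow>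
      (('a \<Rightarrow> 'b) \<Rightarrow> real) \<Rightarrow> 'p \<Rightarrow> 'p \<Rightarrow> bool" where
  "is_natural_gradient \<rho> S T dT F = is_riemannian_gradient (pullback_metric \<rho> dT) S (\<lambda>\<theta>. F (T \<theta>))"

definition solves_inclusion ::
    "('p::euclidean_space \<Rightarrow> 'p set) \<Rightarrow> 'p set \<Rightarrow> real set \<Rightarrow> (real \<Rightarrow> 'p) \<Rightarrow> bool" where
  "solves_inclusion V S I \<theta> \<longleftrightarrow>
     (\<forall>t\<in>I. \<theta> t \<in> S \<and> (\<exists>v\<in>V (\<theta> t). (\<theta> has_vector_derivative v) (at t within I)))"

definition natural_gradient_flow ::
    "'a measure \<Rightarrow> 'p::euclidean_space set \<Rightarrow> ('p \<Rightarrow> 'a \<Rightarrow> 'b::euclidean_space) \<Rightarrow> ('p \<Rightarrow> 'p \<Rightarrow> 'a \<Rightarrow> 'b) \<Rightarrow>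
      (('a \<Rightarrow> 'b) \<Rightarrow> real) \<Rightarrow> real set \<Rightarrow> (real \<Rightarrow> 'p) \<Rightarrow> bool" where
  "natural_gradient_flow \<rho> S T dT F =
     solves_inclusion (\<lambda>\<theta>. {- g |g. is_natural_gradient \<rho> S T dT F \<theta> g}) S"

definition projected_velocities ::
    "('a::euclidean_space measure \<Rightarrow> real) \<Rightarrow> 'a measure \<Rightarrow> 'p::euclidean_space set \<Rightarrow> ('p \<Rightarrow> 'a \<Rightarrow> 'a) \<Rightarrow>
      ('p \<Rightarrow> 'p \<Rightarrow> 'a \<Rightarrow> 'a) \<Rightarrow> 'p \<Rightarrow> 'p set" where
  "projected_velocities D \<rho> S T dT \<theta> =
     {v. is_arg_min
           (\<lambda>v. LINT x|\<rho>. (norm (- wasserstein_gradient D (distr \<rho> borel (T \<theta>)) (T \<theta> x) - dT \<theta> v x))\<^sup>2)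
           (\<lambda>v. v \<in> Tan S \<theta>) v}"

end

theory Submission
  imports Defs
begin

text \<open>
  The lift \<open>f \<mapsto> D (f\<^sub>*\<rho>\<^sub>0)\<close> is Frechet differentiable at \<open>f\<close> with gradient \<open>\<nabla>\<^sub>W D (f\<^sub>*\<rho>\<^sub>0) \<circ> f\<close>; given this, both
  velocities are the minimiser of one quadratic function on the tangent space, by the chain rule and
  Riesz representation.

  Wasserstein differentiability only controls \<open>D\<close> along optimal plans, while the lift moves along
  arbitrary couplings.  For a gradient \<open>\<nabla>\<psi>\<close> with \<open>\<psi>\<close> of class C11, \<open>\<integral>\<langle>\<nabla>\<psi>(x), y - x\<rangle> d\<pi>\<close> equals
  \<open>\<integral>\<psi> d\<gamma> - \<integral>\<psi> d\<rho>\<close> up to the cost of \<open>\<pi>\<close>, so for \<open>\<xi>\<close> in the closure of such gradients the pairing with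
  \<open>y - x\<close> is the same for all couplings of \<open>\<rho>\<close> and \<open>\<gamma>\<close> to first order.  The element of minimal norm lies
  in this closure because the orthogonal part \<open>w\<close> of a differential is invisible to optimal plans:
  \<open>\<integral>\<langle>w(x), y - x\<rangle> d\<pi> = 0\<close>.  To see this, let \<open>\<phi>\<close> be a convex potential with \<open>y \<in> \<partial>\<phi>(x)\<close>, regularised, and
  let \<open>v\<close> be a smooth field close to \<open>w\<close>.  Testing \<open>w\<close> against the gradient of \<open>x \<mapsto> \<phi>(x + s v(x))\<close> gives
  \<open>\<integral>\<langle>w, \<nabla>\<phi>(x + s v)\<rangle> = O(s)\<close>, while convexity gives \<open>\<langle>\<nabla>\<phi>(x + s v), v\<rangle> \<ge> \<langle>y, v\<rangle>\<close>; hence \<open>\<integral>\<langle>y, w\<rangle> d\<pi> \<le> 0\<close>,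
  and the same holds for \<open>-w\<close>.
\<close>

section \<open>Square-integrable maps\<close>

text \<open>The measures at which D is differentiated, \<open>distr \<rho>\<^sub>0 borel f\<close>
  with f arbitrary in L2, may be singular. Optimal plans from them need not come from maps, so the
  orthogonality is proved on the plans themselves. C11 regularity is expressed by one inequality, a
  quadratic bound on the Taylor remainder: this is what integration against a coupling uses, and it
  survives both Moreau regularisation and composition with x + s v(x). Three parameters are removed
  in a fixed order. First s tends to 0. The potential is regularised with parameter s^2, so that its
  error, of order s^2, is still small after division by s; the remainder constant blows up like
  1/s^2, but orthogonality to a gradient is exact whatever that constant is. Then v tends to w in
  L1, while the targets y are cut off at a radius R, which keeps all slopes bounded. Last, R tends
  to infinity.\<close>

lemma L2_measurable [measurable_dest]: "f \<in> L2 M \<Longrightarrow> f \<in> borel_measurable M"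
  by (simp add: L2_def)

lemma L2_integrable_inner:
  fixes f g :: "'a \<Rightarrow> 'b::euclidean_space"
  assumes "f \<in> L2 M" "g \<in> L2 M"
  shows "integrable M (\<lambda>x. f x \<bullet> g x)"
proof (rule Bochner_Integration.integrable_bound)
  show "integrable M (\<lambda>x. (norm (f x))\<^sup>2 + (norm (g x))\<^sup>2)"
    using assms by (simp add: L2_def)
  show "(\<lambda>x. f x \<bullet> g x) \<in> borel_measurable M"
    using assms by measurable
  have "\<bar>a \<bullet> b\<bar> \<le> (norm a)\<^sup>2 + (norm b)\<^sup>2" for a b :: 'b
  proof -
    have "\<bar>a \<bullet> b\<bar> \<le> norm a * norm b" by (rule Cauchy_Schwarz_ineq2)
    also have "\<dots> \<le> (norm a)\<^sup>2 + (norm b)\<^sup>2"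
      using sum_squares_bound[of "norm a" "norm b"] zero_le_power2[of "norm a"] zero_le_power2[of "norm b"]
        mult_nonneg_nonneg[OF norm_ge_zero[of a] norm_ge_zero[of b]] by linarith
    finally show ?thesis .
  qed
  then show "AE x in M. norm (f x \<bullet> g x) \<le> norm ((norm (f x))\<^sup>2 + (norm (g x))\<^sup>2)"
    by simp
qed

lemma L2_add:
  fixes f g :: "'a \<Rightarrow> 'b::euclidean_space"
  assumes "f \<in> L2 M" "g \<in> L2 M"
  shows "(\<lambda>x. f x + g x) \<in> L2 M"
proof -
  have "(\<lambda>x. (norm (f x + g x))\<^sup>2) = (\<lambda>x. (norm (f x))\<^sup>2 + 2 * (f x \<bullet> g x) + (norm (g x))\<^sup>2)"
    by (auto simp: power2_norm_eq_inner algebra_simps inner_commute)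
  then have "integrable M (\<lambda>x. (norm (f x + g x))\<^sup>2)"
    using L2_integrable_inner[OF assms] assms by (simp add: L2_def)
  moreover have "(\<lambda>x. f x + g x) \<in> borel_measurable M"
    using assms by measurable
  ultimately show ?thesis
    by (simp add: L2_def)
qed

lemma L2_scaleR: "f \<in> L2 M \<Longrightarrow> (\<lambda>x. c *\<^sub>R f x) \<in> L2 M"
  by (auto simp: L2_def power_mult_distrib)

lemma L2_uminus: "f \<in> L2 M \<Longrightarrow> (\<lambda>x. - f x) \<in> L2 M"
  using L2_scaleR[of f M "-1"] by simp

lemma L2_diff: "f \<in> L2 M \<Longrightarrow> g \<in> L2 M \<Longrightarrow> (\<lambda>x. f x - g x) \<in> L2 M"
  using L2_add[of f M "\<lambda>x. - g x"] L2_uminus[of g M] by simp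

lemma L2_inner_add_left:
  "f \<in> L2 M \<Longrightarrow> g \<in> L2 M \<Longrightarrow> h \<in> L2 M \<Longrightarrow>
    L2_inner M (\<lambda>x. f x + g x) h = L2_inner M f h + L2_inner M g h"
  by (simp add: L2_inner_def inner_add_left L2_integrable_inner)

lemma L2_inner_diff_left:
  "f \<in> L2 M \<Longrightarrow> g \<in> L2 M \<Longrightarrow> h \<in> L2 M \<Longrightarrow>
    L2_inner M (\<lambda>x. f x - g x) h = L2_inner M f h - L2_inner M g h"
  by (simp add: L2_inner_def inner_diff_left L2_integrable_inner)

lemma L2_inner_uminus_left: "L2_inner M (\<lambda>x. - f x) h = - L2_inner M f h"
  by (simp add: L2_inner_def)

lemma L2_inner_commute: "L2_inner M f g = L2_inner M g f"
  by (simp add: L2_inner_def inner_commute)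

lemma L2_inner_add_right:
  "f \<in> L2 M \<Longrightarrow> g \<in> L2 M \<Longrightarrow> h \<in> L2 M \<Longrightarrow>
    L2_inner M h (\<lambda>x. f x + g x) = L2_inner M h f + L2_inner M h g"
  by (simp add: L2_inner_def inner_add_right L2_integrable_inner)

lemma L2_inner_diff_right:
  "f \<in> L2 M \<Longrightarrow> g \<in> L2 M \<Longrightarrow> h \<in> L2 M \<Longrightarrow>
    L2_inner M h (\<lambda>x. f x - g x) = L2_inner M h f - L2_inner M h g"
  by (simp add: L2_inner_def inner_diff_right L2_integrable_inner)

lemma L2_inner_scaleR_right: "L2_inner M h (\<lambda>x. c *\<^sub>R f x) = c * L2_inner M h f"
  by (simp add: L2_inner_def)

lemma L2_norm_square: "(L2_norm M f)\<^sup>2 = L2_inner M f f"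
  by (simp add: L2_norm_def L2_inner_def power2_norm_eq_inner)

lemma L2_norm_nonneg [simp]: "0 \<le> L2_norm M f"
  by (simp add: L2_norm_def)

lemma L2_norm_scaleR: "L2_norm M (\<lambda>x. c *\<^sub>R f x) = \<bar>c\<bar> * L2_norm M f"
  by (simp add: L2_norm_def power_mult_distrib real_sqrt_mult)

lemma L2_norm_uminus: "L2_norm M (\<lambda>x. - f x) = L2_norm M f"
  by (simp add: L2_norm_def)

lemma L2_norm_add_square:
  assumes "f \<in> L2 M" "g \<in> L2 M"
  shows "(L2_norm M (\<lambda>x. f x + g x))\<^sup>2 = (L2_norm M f)\<^sup>2 + 2 * L2_inner M f g + (L2_norm M g)\<^sup>2"
  using assms by (simp add: L2_norm_square L2_inner_add_left L2_inner_add_right L2_add L2_inner_commute[of M g f])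

lemma L2_norm_diff_square:
  assumes "f \<in> L2 M" "g \<in> L2 M"
  shows "(L2_norm M (\<lambda>x. f x - g x))\<^sup>2 = (L2_norm M f)\<^sup>2 - 2 * L2_inner M f g + (L2_norm M g)\<^sup>2"
  using assms by (simp add: L2_norm_square L2_inner_diff_left L2_inner_diff_right L2_diff L2_inner_commute[of M g f])

lemma L2_Cauchy_Schwarz:
  assumes "f \<in> L2 M" "g \<in> L2 M"
  shows "\<bar>L2_inner M f g\<bar> \<le> L2_norm M f * L2_norm M g"
proof -
  have *: "0 \<le> (L2_norm M f)\<^sup>2 - 2 * c * L2_inner M f g + c\<^sup>2 * (L2_norm M g)\<^sup>2" for c
  proof -
    have "(L2_norm M (\<lambda>x. f x - c *\<^sub>R g x))\<^sup>2
        = (L2_norm M f)\<^sup>2 - 2 * c * L2_inner M f g + c\<^sup>2 * (L2_norm M g)\<^sup>2"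
      using assms by (simp add: L2_norm_diff_square L2_scaleR L2_inner_scaleR_right L2_norm_scaleR power_mult_distrib)
    then show ?thesis by (metis zero_le_power2)
  qed
  have "(L2_inner M f g)\<^sup>2 \<le> (L2_norm M f * L2_norm M g)\<^sup>2"
  proof (cases "L2_norm M g = 0")
    case True
    have "L2_inner M f g = 0"
    proof (rule ccontr)
      assume n: "L2_inner M f g \<noteq> 0"
      have "0 \<le> (L2_norm M f)\<^sup>2 - 2 * (((L2_norm M f)\<^sup>2 + 1) / L2_inner M f g) * L2_inner M f g"
        using *[of "((L2_norm M f)\<^sup>2 + 1) / L2_inner M f g"] True by simp
      also have "\<dots> = - (L2_norm M f)\<^sup>2 - 2" using n by simp
      finally show False using zero_le_power2[of "L2_norm M f"] by linarith
    qed
    then show ?thesis by simp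
  next
    case False
    define a where "a = (L2_norm M g)\<^sup>2"
    have a: "a > 0" using False by (simp add: a_def)
    have "0 \<le> (L2_norm M f)\<^sup>2 - 2 * (L2_inner M f g / a) * L2_inner M f g + (L2_inner M f g / a)\<^sup>2 * a"
      using *[of "L2_inner M f g / a"] by (simp add: a_def)
    also have "\<dots> = (L2_norm M f)\<^sup>2 - (L2_inner M f g)\<^sup>2 / a"
      using a by (simp add: field_simps power2_eq_square)
    finally have "(L2_inner M f g)\<^sup>2 \<le> (L2_norm M f)\<^sup>2 * a"
      using a by (simp add: field_simps)
    then show ?thesis by (simp add: a_def power_mult_distrib)
  qed
  then show ?thesis
    by (metis abs_le_square_iff abs_mult abs_of_nonneg L2_norm_nonneg)
qed

lemma L2_norm_triangle:
  assumes "f \<in> L2 M" "g \<in> L2 M"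
  shows "L2_norm M (\<lambda>x. f x + g x) \<le> L2_norm M f + L2_norm M g"
proof (rule power2_le_imp_le)
  show "(L2_norm M (\<lambda>x. f x + g x))\<^sup>2 \<le> (L2_norm M f + L2_norm M g)\<^sup>2"
    using L2_Cauchy_Schwarz[OF assms] by (simp add: L2_norm_add_square[OF assms] power2_sum)
qed simp

lemma L2_norm_eq_0_iff:
  assumes "f \<in> L2 M"
  shows "L2_norm M f = 0 \<longleftrightarrow> (AE x in M. f x = 0)"
  using assms by (simp add: L2_norm_def L2_def integral_nonneg_eq_0_iff_AE)

lemma (in finite_measure) L2_const: "(\<lambda>x. c) \<in> L2 M"
  by (simp add: L2_def)

lemma (in finite_measure) L2_integrable:
  assumes "f \<in> L2 M" shows "integrable M f"
proof (rule Bochner_Integration.integrable_bound)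
  show "integrable M (\<lambda>x. 1 + (norm (f x))\<^sup>2)" using assms by (simp add: L2_def)
  show "f \<in> borel_measurable M" using assms by (simp add: L2_def)
  have "n \<le> 1 + n\<^sup>2" for n :: real
    using sum_squares_bound[of n 1] zero_le_power2[of n]
    unfolding power_one mult_1_right by linarith
  then show "AE x in M. norm (f x) \<le> norm (1 + (norm (f x))\<^sup>2)"
    by simp
qed

lemma L2_distr_iff:
  assumes "T \<in> measurable M N"
    and "f \<in> borel_measurable N"
  shows "f \<in> L2 (distr M N T) \<longleftrightarrow> (\<lambda>x. f (T x)) \<in> L2 M"
  using assms by (simp add: L2_def integrable_distr_eq)

lemma L2_inner_distr:
  assumes "T \<in> measurable M N" "f \<in> borel_measurable N" "g \<in> borel_measurable N"
  shows "L2_inner (distr M N T) f g = L2_inner M (\<lambda>x. f (T x)) (\<lambda>x. g (T x))"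
  using assms by (simp add: L2_inner_def integral_distr)

lemma L2_norm_distr:
  assumes "T \<in> measurable M N" "f \<in> borel_measurable N"
  shows "L2_norm (distr M N T) f = L2_norm M (\<lambda>x. f (T x))"
  using assms by (simp add: L2_norm_def integral_distr)

section \<open>Completeness of L2 and projection onto the closure of a subspace\<close>

lemma L2_nn_integral:
  assumes "f \<in> L2 M"
  shows "(\<integral>\<^sup>+x. ennreal ((norm (f x))\<^sup>2) \<partial>M) = ennreal ((L2_norm M f)\<^sup>2)"
  using assms by (subst nn_integral_eq_integral) (auto simp: L2_def L2_norm_def)

lemma L2_bound_nn_integral:
  assumes f: "f \<in> borel_measurable M" and "0 \<le> c"
    and le: "(\<integral>\<^sup>+x. ennreal ((norm (f x))\<^sup>2) \<partial>M) \<le> ennreal (c\<^sup>2)"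
  shows "f \<in> L2 M" "L2_norm M f \<le> c"
proof -
  have "integrable M (\<lambda>x. (norm (f x))\<^sup>2)"
    using f le by (intro integrableI_nonneg) (auto simp: le_less_trans[OF le])
  with f show *: "f \<in> L2 M" by (simp add: L2_def)
  have "(L2_norm M f)\<^sup>2 \<le> c\<^sup>2"
    using le by (simp add: L2_nn_integral[OF *])
  then show "L2_norm M f \<le> c"
    using \<open>0 \<le> c\<close> by (rule power2_le_imp_le)
qed

text \<open>Riesz-Fischer for fast Cauchy sequences. On a finite measure the increments are also
  summable in L1, which gives convergence almost everywhere; Fatou's lemma then carries the L2
  bounds to the limit.\<close>

lemma (in finite_measure) L2_complete:
  fixes f :: "nat \<Rightarrow> 'a \<Rightarrow> 'b::euclidean_space"
  assumes f: "\<And>n. f n \<in> L2 M"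
    and le: "\<And>n. L2_norm M (\<lambda>x. f (Suc n) x - f n x) \<le> (1/2)^n"
  obtains g where "g \<in> L2 M" "\<And>n. L2_norm M (\<lambda>x. g x - f n x) \<le> 2 * (1/2)^n"
proof -
  define c where "c = L2_norm M (\<lambda>x. 1::real)"
  have [measurable]: "f n \<in> borel_measurable M" for n using f by (simp add: L2_def)
  have d: "(\<lambda>x. f (Suc n) x - f n x) \<in> L2 M" for n by (intro L2_diff f)
  have "(\<integral>\<^sup>+x. ennreal (norm (f (Suc n) x - f n x)) \<partial>M) \<le> ennreal (c * (1/2)^n)" for n
  proof -
    have n: "(\<lambda>x. norm (f (Suc n) x - f n x)) \<in> L2 M"
      using d[of n] by (simp add: L2_def)
    have "(\<integral>\<^sup>+x. ennreal (norm (f (Suc n) x - f n x)) \<partial>M) = ennreal (LINT x|M. norm (f (Suc n) x - f n x))"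
      using L2_integrable[OF n] by (intro nn_integral_eq_integral) auto
    also have "(LINT x|M. norm (f (Suc n) x - f n x)) = L2_inner M (\<lambda>x. norm (f (Suc n) x - f n x)) (\<lambda>x. 1)"
      by (simp add: L2_inner_def)
    also have "\<dots> \<le> L2_norm M (\<lambda>x. norm (f (Suc n) x - f n x)) * c"
      using L2_Cauchy_Schwarz[OF n L2_const[of 1]] by (simp add: c_def)
    also have "\<dots> \<le> (1/2)^n * c"
      using le[of n] by (intro mult_right_mono) (auto simp: c_def L2_norm_def)
    finally show ?thesis by (simp add: mult.commute ennreal_leI)
  qed
  then have "(\<Sum>n. \<integral>\<^sup>+x. ennreal (norm (f (Suc n) x - f n x)) \<partial>M) \<le> (\<Sum>n. ennreal (c * (1/2)^n))"
    by (intro suminf_le) auto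
  also have "\<dots> = ennreal (\<Sum>n. c * (1/2)^n)"
    by (intro suminf_ennreal2 summable_mult summable_geometric) (auto simp: c_def)
  finally have "(\<integral>\<^sup>+x. (\<Sum>n. ennreal (norm (f (Suc n) x - f n x))) \<partial>M) \<noteq> \<infinity>"
    by (subst nn_integral_suminf) (auto simp: top_unique)
  then have "AE x in M. (\<Sum>n. ennreal (norm (f (Suc n) x - f n x))) \<noteq> \<infinity>"
    by (intro nn_integral_PInf_AE) auto
  then have conv: "AE x in M. convergent (\<lambda>n. f n x)"
  proof eventually_elim
    case (elim x)
    then have "summable (\<lambda>n. norm (f (Suc n) x - f n x))"
      by (intro summable_suminf_not_top) auto
    then have "summable (\<lambda>n. f (Suc n) x - f n x)"
      by (rule summable_norm_cancel)
    then have "convergent (\<lambda>n. \<Sum>i<n. f (Suc i) x - f i x)"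
      by (simp add: summable_iff_convergent)
    then have "convergent (\<lambda>n. f n x - f 0 x)"
      by (simp add: sum_lessThan_telescope[of "\<lambda>n. f n x"])
    then show ?case
      by (simp add: convergent_diff_const_right_iff)
  qed
  define g where "g x = lim (\<lambda>n. f n x)" for x
  have g[measurable]: "g \<in> borel_measurable M"
    unfolding g_def by measurable
  \<comment> \<open>The exact partial geometric sum, which the induction on k reproduces; the bound
    2 (1/2)^n is its limit.\<close>
  have inc: "L2_norm M (\<lambda>x. f (n + k) x - f n x) \<le> (2 - 2 * (1/2)^k) * (1/2)^n" for n k
  proof (induction k)
    case 0
    then show ?case by (simp add: L2_norm_def)
  next
    case (Suc k)
    have "L2_norm M (\<lambda>x. f (n + Suc k) x - f n x)
        = L2_norm M (\<lambda>x. (f (Suc (n + k)) x - f (n + k) x) + (f (n + k) x - f n x))"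
      by simp
    also have "\<dots> \<le> L2_norm M (\<lambda>x. f (Suc (n + k)) x - f (n + k) x) + L2_norm M (\<lambda>x. f (n + k) x - f n x)"
      by (intro L2_norm_triangle d L2_diff f)
    also have "\<dots> \<le> (1/2)^(n+k) + (2 - 2 * (1/2)^k) * (1/2)^n"
      by (intro add_mono le Suc.IH)
    also have "\<dots> = (2 - 2 * (1/2)^Suc k) * (1/2)^n"
      by (simp add: power_add algebra_simps)
    finally show ?case .
  qed
  have bd: "(\<integral>\<^sup>+x. ennreal ((norm (g x - f n x))\<^sup>2) \<partial>M) \<le> ennreal ((2 * (1/2)^n)\<^sup>2)" for n
  proof -
    have "(\<integral>\<^sup>+x. ennreal ((norm (g x - f n x))\<^sup>2) \<partial>M)
        = (\<integral>\<^sup>+x. liminf (\<lambda>k. ennreal ((norm (f (n + k) x - f n x))\<^sup>2)) \<partial>M)"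
    proof (rule nn_integral_cong_AE)
      show "AE x in M. ennreal ((norm (g x - f n x))\<^sup>2)
          = liminf (\<lambda>k. ennreal ((norm (f (n + k) x - f n x))\<^sup>2))"
        using conv
      proof eventually_elim
        case (elim x)
        then have "(\<lambda>n. f n x) \<longlonglongrightarrow> g x"
          unfolding g_def by (simp add: convergent_LIMSEQ_iff)
        then have "(\<lambda>k. f (k + n) x) \<longlonglongrightarrow> g x" by (rule LIMSEQ_ignore_initial_segment)
        then have "(\<lambda>k. f (n + k) x) \<longlonglongrightarrow> g x" by (simp add: add.commute)
        then have "(\<lambda>k. ennreal ((norm (f (n + k) x - f n x))\<^sup>2)) \<longlonglongrightarrow> ennreal ((norm (g x - f n x))\<^sup>2)"
          by (intro tendsto_ennrealI tendsto_intros)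
        then show ?case
          using lim_imp_Liminf by (metis trivial_limit_sequentially)
      qed
    qed
    also have "\<dots> \<le> liminf (\<lambda>k. \<integral>\<^sup>+x. ennreal ((norm (f (n + k) x - f n x))\<^sup>2) \<partial>M)"
      by (intro nn_integral_liminf) measurable
    also have "\<dots> \<le> ennreal ((2 * (1/2)^n)\<^sup>2)"
    proof (rule Liminf_le)
      show "\<forall>\<^sub>F k in sequentially. (\<integral>\<^sup>+x. ennreal ((norm (f (n + k) x - f n x))\<^sup>2) \<partial>M) \<le> ennreal ((2 * (1/2)^n)\<^sup>2)"
      proof (rule always_eventually, rule allI)
        fix k
        have "L2_norm M (\<lambda>x. f (n + k) x - f n x) \<le> 2 * (1/2)^n"
          using inc[of n k] by (rule order_trans) (simp add: mult_right_mono)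
        then have "ennreal ((L2_norm M (\<lambda>x. f (n + k) x - f n x))\<^sup>2) \<le> ennreal ((2 * (1/2)^n)\<^sup>2)"
          by (intro ennreal_leI power_mono) simp_all
        then show "(\<integral>\<^sup>+x. ennreal ((norm (f (n + k) x - f n x))\<^sup>2) \<partial>M) \<le> ennreal ((2 * (1/2)^n)\<^sup>2)"
          by (simp only: L2_nn_integral[OF L2_diff[OF f f]])
      qed
    qed simp
    finally show ?thesis .
  qed
  have gf: "(\<lambda>x. g x - f n x) \<in> L2 M" "L2_norm M (\<lambda>x. g x - f n x) \<le> 2 * (1/2)^n" for n
    using L2_bound_nn_integral[OF _ _ bd[of n]] by auto
  have "g \<in> L2 M"
    using L2_add[OF gf(1)[of 0] f[of 0]] by simp
  with gf(2) show ?thesis using that by blast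
qed

text \<open>V need not be closed, so \<eta> is only a limit of elements of V. A minimising sequence
  is used, and the parallelogram law gives the Cauchy rate that \<open>L2_complete\<close> asks
  for.\<close>

lemma (in finite_measure) L2_projection:
  fixes \<xi> :: "'a \<Rightarrow> 'b::euclidean_space"
  assumes V: "V \<subseteq> L2 M" "(\<lambda>x. 0) \<in> V"
    and add: "\<And>u v. u \<in> V \<Longrightarrow> v \<in> V \<Longrightarrow> (\<lambda>x. u x + v x) \<in> V"
    and scale: "\<And>c v. v \<in> V \<Longrightarrow> (\<lambda>x. c *\<^sub>R v x) \<in> V"
    and \<xi>: "\<xi> \<in> L2 M"
  obtains \<eta> where "\<eta> \<in> L2 M" "\<And>e. e > 0 \<Longrightarrow> \<exists>v\<in>V. L2_norm M (\<lambda>x. \<eta> x - v x) < e"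
    "\<And>v. v \<in> V \<Longrightarrow> L2_inner M (\<lambda>x. \<xi> x - \<eta> x) v = 0"
proof -
  define q where "q v = (L2_norm M (\<lambda>x. \<xi> x - v x))\<^sup>2" for v
  define d where "d = (INF v\<in>V. q v)"
  have bb: "bdd_below (q ` V)" by (rule bdd_belowI[of _ 0]) (auto simp: q_def)
  have dle: "d \<le> q v" if "v \<in> V" for v
    unfolding d_def using bb that by (rule cINF_lower)
  \<comment> \<open>The excess is chosen for the parallelogram law: a squared increment is at most 2
    (1/4)^(n+1) + 2 (1/4)^(n+2), hence at most ((1/2)^n)^2.\<close>
  have "\<exists>v\<in>V. q v < d + (1/4)^Suc n" for n :: nat
  proof -
    have "d < d + (1/4)^Suc n" by simp
    then show ?thesis
      unfolding d_def using V(2) bb by (subst (asm) cINF_less_iff) auto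
  qed
  then obtain v where v: "\<And>n. v n \<in> V" and vq: "\<And>n. q (v n) < d + (1/4)^Suc n" by metis
  have vL: "v n \<in> L2 M" for n using v V(1) by auto
  have "L2_norm M (\<lambda>x. v (Suc n) x - v n x) \<le> (1/2)^n" for n
  proof -
    define a b where "a = (\<lambda>x. \<xi> x - v n x)" and "b = (\<lambda>x. \<xi> x - v (Suc n) x)"
    have ab: "a \<in> L2 M" "b \<in> L2 M" unfolding a_def b_def by (intro L2_diff \<xi> vL)+
    define m where "m = (\<lambda>x. (1/2) *\<^sub>R (v n x + v (Suc n) x))"
    have "m \<in> V" unfolding m_def by (intro scale add v)
    have "(L2_norm M (\<lambda>x. v (Suc n) x - v n x))\<^sup>2 = (L2_norm M (\<lambda>x. a x - b x))\<^sup>2"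
      by (simp add: a_def b_def)
    also have "\<dots> = 2 * (L2_norm M a)\<^sup>2 + 2 * (L2_norm M b)\<^sup>2 - (L2_norm M (\<lambda>x. a x + b x))\<^sup>2"
      by (simp add: L2_norm_diff_square L2_norm_add_square ab)
    also have "(\<lambda>x. a x + b x) = (\<lambda>x. 2 *\<^sub>R (\<xi> x - m x))"
      by (auto simp: a_def b_def m_def algebra_simps scaleR_2)
    also have "(L2_norm M (\<lambda>x. 2 *\<^sub>R (\<xi> x - m x)))\<^sup>2 = 4 * q m"
      unfolding L2_norm_scaleR q_def by (simp add: power_mult_distrib)
    also have "2 * (L2_norm M a)\<^sup>2 + 2 * (L2_norm M b)\<^sup>2 - 4 * q m
        \<le> 2 * (d + (1/4)^Suc n) + 2 * (d + (1/4)^Suc (Suc n)) - 4 * d"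
      using dle[OF \<open>m \<in> V\<close>] vq[of n] vq[of "Suc n"] by (simp add: q_def a_def b_def)
    also have "\<dots> \<le> ((1/2)^n)\<^sup>2"
      by (simp add: power2_eq_square flip: power_mult_distrib)
    finally show ?thesis by (rule power2_le_imp_le) simp
  qed
  then obtain \<eta> where \<eta>: "\<eta> \<in> L2 M" "\<And>n. L2_norm M (\<lambda>x. \<eta> x - v n x) \<le> 2 * (1/2)^n"
    using L2_complete[of v] vL by metis
  have lim: "(\<lambda>n. 2 * (1/2)^n :: real) \<longlonglongrightarrow> 0"
    by (rule tendsto_mult_right_zero) (simp add: LIMSEQ_realpow_zero)
  have "L2_inner M (\<lambda>x. \<xi> x - \<eta> x) u = 0" if u: "u \<in> V" for u
  proof -
    have uL: "u \<in> L2 M" using u V by auto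
    define k where "k = L2_inner M (\<lambda>x. \<xi> x - \<eta> x) u"
    have kn: "(\<lambda>n. L2_inner M (\<lambda>x. \<xi> x - v n x) u) \<longlonglongrightarrow> k"
    proof (rule LIMSEQ_I)
      fix r :: real assume "0 < r"
      have "(\<lambda>n. 2 * (1/2)^n * L2_norm M u) \<longlonglongrightarrow> 0"
        using tendsto_mult_left_zero[OF lim, of "L2_norm M u"] .
      then obtain N where N: "\<And>n. n \<ge> N \<Longrightarrow> norm (2 * (1/2)^n * L2_norm M u - 0) < r"
        using LIMSEQ_D \<open>0 < r\<close> by blast
      have "norm (L2_inner M (\<lambda>x. \<xi> x - v n x) u - k) < r" if "n \<ge> N" for n
      proof -
        have "L2_inner M (\<lambda>x. \<xi> x - v n x) u - k = L2_inner M (\<lambda>x. \<eta> x - v n x) u"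
          by (simp add: k_def L2_inner_diff_left \<xi> \<eta> vL uL)
        then have "norm (L2_inner M (\<lambda>x. \<xi> x - v n x) u - k) \<le> L2_norm M (\<lambda>x. \<eta> x - v n x) * L2_norm M u"
          using L2_Cauchy_Schwarz[OF L2_diff[OF \<eta>(1) vL[of n]] uL] by simp
        also have "\<dots> \<le> 2 * (1/2)^n * L2_norm M u"
          by (intro mult_right_mono \<eta>) simp
        also have "\<dots> < r" using N[OF that] by simp
        finally show ?thesis .
      qed
      then show "\<exists>N. \<forall>n\<ge>N. norm (L2_inner M (\<lambda>x. \<xi> x - v n x) u - k) < r" by blast
    qed
    \<comment> \<open>Near-minimality of v n against v n + t u. The excess tends to 0, so in the
      limit a quadratic in t without constant term is nonnegative, which forces its linear
      coefficient to vanish.\<close>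
    have quad: "0 \<le> t\<^sup>2 * (L2_norm M u)\<^sup>2 - 2 * t * k" for t
    proof (rule LIMSEQ_le)
      show "(\<lambda>n. - ((1/4)^Suc n :: real)) \<longlonglongrightarrow> 0"
        using tendsto_minus[OF LIMSEQ_Suc[OF LIMSEQ_realpow_zero[of "1/4"]]] by simp
      show "(\<lambda>n. t\<^sup>2 * (L2_norm M u)\<^sup>2 - 2 * t * L2_inner M (\<lambda>x. \<xi> x - v n x) u)
          \<longlonglongrightarrow> t\<^sup>2 * (L2_norm M u)\<^sup>2 - 2 * t * k"
        by (intro tendsto_intros kn)
      have "- ((1/4)^Suc n) \<le> t\<^sup>2 * (L2_norm M u)\<^sup>2 - 2 * t * L2_inner M (\<lambda>x. \<xi> x - v n x) u" for n
      proof -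
        have "(\<lambda>x. v n x + t *\<^sub>R u x) \<in> V" by (intro add scale v u)
        from dle[OF this] have "d \<le> (L2_norm M (\<lambda>x. (\<xi> x - v n x) - t *\<^sub>R u x))\<^sup>2"
          by (simp add: q_def algebra_simps)
        also have "\<dots> = q (v n) - 2 * t * L2_inner M (\<lambda>x. \<xi> x - v n x) u + t\<^sup>2 * (L2_norm M u)\<^sup>2"
          by (simp add: L2_norm_diff_square L2_diff L2_scaleR \<xi> vL uL q_def
              L2_inner_scaleR_right L2_norm_scaleR power_mult_distrib)
        finally show ?thesis using vq[of n] by linarith
      qed
      then show "\<exists>N. \<forall>n\<ge>N. - ((1/4)^Suc n) \<le> t\<^sup>2 * (L2_norm M u)\<^sup>2 - 2 * t * L2_inner M (\<lambda>x. \<xi> x - v n x) u"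
        by blast
    qed
    show ?thesis
    proof (rule ccontr)
      assume "L2_inner M (\<lambda>x. \<xi> x - \<eta> x) u \<noteq> 0"
      then have k: "k \<noteq> 0" by (simp add: k_def)
      \<comment> \<open>Adding 1 keeps t = k / a meaningful when the norm of u vanishes.\<close>
      define a where "a = (L2_norm M u)\<^sup>2 + 1"
      have a: "a > 0" "(L2_norm M u)\<^sup>2 < a" by (simp_all add: a_def add_nonneg_pos)
      have "0 \<le> (k/a)\<^sup>2 * (L2_norm M u)\<^sup>2 - 2 * (k/a) * k" by (rule quad)
      also have "\<dots> < (k/a)\<^sup>2 * a - 2 * (k/a) * k"
        using a k by (intro diff_strict_right_mono mult_strict_left_mono) auto
      also have "\<dots> = - (k\<^sup>2 / a)" using a by (simp add: field_simps power2_eq_square)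
      finally show False using a divide_nonneg_pos[OF zero_le_power2[of k] a(1)] by linarith
    qed
  qed
  moreover have "\<exists>v\<in>V. L2_norm M (\<lambda>x. \<eta> x - v x) < e" if "e > 0" for e
  proof -
    from LIMSEQ_D[OF lim that] obtain n where "norm (2 * (1/2)^n - 0 :: real) < e" by blast
    then have "L2_norm M (\<lambda>x. \<eta> x - v n x) < e" using \<eta>(2)[of n] by simp
    then show ?thesis using v by blast
  qed
  ultimately show ?thesis using \<eta>(1) that by blast
qed

section \<open>Cyclical monotonicity of optimal plans\<close>

lemma measurable_fst_snd_borel [measurable]:
  "fst \<in> borel_measurable (borel :: ('a::euclidean_space \<times> 'a) measure)"
  "snd \<in> borel_measurable (borel :: ('a::euclidean_space \<times> 'a) measure)"
  by (intro borel_measurable_continuous_onI continuous_intros)+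

lemma P2_prob_space: "\<rho> \<in> P2 \<Longrightarrow> prob_space \<rho>"
  by (simp add: P2_def)

lemma P2_sets: "\<rho> \<in> P2 \<Longrightarrow> sets \<rho> = sets borel"
  by (simp add: P2_def)

lemma P2_measurable_iff: "\<rho> \<in> P2 \<Longrightarrow> f \<in> borel_measurable \<rho> \<longleftrightarrow> f \<in> borel_measurable borel"
  by (simp add: P2_sets cong: measurable_cong_sets)

lemma P2_ident_L2: "\<rho> \<in> P2 \<Longrightarrow> (\<lambda>x. x) \<in> L2 \<rho>"
  by (simp add: P2_def L2_def measurable_ident_sets)

lemma coupling_sets: "\<pi> \<in> couplings \<rho> \<gamma> \<Longrightarrow> sets \<pi> = sets borel"
  by (simp add: couplings_def)

lemma coupling_measurable:
  assumes "\<pi> \<in> couplings \<rho> \<gamma>"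
  shows "fst \<in> borel_measurable \<pi>" "snd \<in> borel_measurable \<pi>"
  unfolding measurable_cong_sets[OF coupling_sets[OF assms] refl] by measurable

lemma coupling_distr:
  assumes "\<pi> \<in> couplings \<rho> \<gamma>"
  shows "distr \<pi> borel fst = \<rho>" "distr \<pi> borel snd = \<gamma>"
  using assms by (simp_all add: couplings_def)

lemma coupling_prob_space:
  assumes "\<pi> \<in> couplings \<rho> \<gamma>" "\<rho> \<in> P2"
  shows "prob_space \<pi>"
proof (rule prob_space_distrD)
  show "fst \<in> borel_measurable \<pi>" using coupling_measurable[OF assms(1)] by simp
  show "prob_space (distr \<pi> borel fst)"
    using assms by (simp add: coupling_distr P2_def)
qed

lemma coupling_L2_fst:
  fixes f :: "'a::euclidean_space \<Rightarrow> 'b::euclidean_space"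
  assumes "\<pi> \<in> couplings \<rho> \<gamma>" "f \<in> L2 \<rho>" "\<rho> \<in> P2"
  shows "(\<lambda>z. f (fst z)) \<in> L2 \<pi>"
proof -
  have "f \<in> borel_measurable borel"
    using L2_measurable[OF assms(2)] by (simp add: P2_measurable_iff[OF assms(3)])
  then show ?thesis
    using assms L2_distr_iff[OF coupling_measurable(1)[OF assms(1)], of f] by (simp add: coupling_distr)
qed

lemma coupling_L2_snd:
  fixes f :: "'a::euclidean_space \<Rightarrow> 'b::euclidean_space"
  assumes "\<pi> \<in> couplings \<rho> \<gamma>" "f \<in> L2 \<gamma>" "\<gamma> \<in> P2"
  shows "(\<lambda>z. f (snd z)) \<in> L2 \<pi>"
proof -
  have "f \<in> borel_measurable borel"
    using L2_measurable[OF assms(2)] by (simp add: P2_measurable_iff[OF assms(3)])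
  then show ?thesis
    using assms L2_distr_iff[OF coupling_measurable(2)[OF assms(1)], of f] by (simp add: coupling_distr)
qed

lemma coupling_displacement_L2:
  assumes "\<pi> \<in> couplings \<rho> \<gamma>" "\<rho> \<in> P2" "\<gamma> \<in> P2"
  shows "(\<lambda>z. snd z - fst z) \<in> L2 \<pi>"
  by (intro L2_diff coupling_L2_fst[OF assms(1) _ assms(2)] coupling_L2_snd[OF assms(1) _ assms(3)]
      P2_ident_L2 assms)

lemma transport_cost_L2_norm: "transport_cost \<pi> = (L2_norm \<pi> (\<lambda>z. snd z - fst z))\<^sup>2"
  by (simp add: transport_cost_def L2_norm_def case_prod_unfold norm_minus_commute)

lemma bij_betw_Suc_mod:
  assumes "0 < N"
  shows "bij_betw (\<lambda>i. Suc i mod N) {..<N} {..<N}"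
proof -
  have "inj_on (\<lambda>i. Suc i mod N) {..<N}"
    by (rule inj_onI) (metis Suc_inject lessThan_iff mod_Suc mod_less nat.simps(3))
  moreover have "(\<lambda>i. Suc i mod N) ` {..<N} \<subseteq> {..<N}" using assms by auto
  ultimately show ?thesis
    by (metis bij_betw_def card_image card_subset_eq finite_lessThan)
qed

text \<open>
  On the event where the cyclic rearrangement is strictly cheaper, re-pairing the sampled points
  along the cycle gives a competitor plan; as the event is invariant under cyclic shifts, it is
  enough to re-pair the first sample.
\<close>

lemma optimal_plan_AE_cyclically_monotone:
  fixes \<pi> :: "('a::euclidean_space \<times> 'a) measure"
  assumes opt: "\<pi> \<in> optimal_plans \<rho> \<gamma>" and \<rho>: "\<rho> \<in> P2" and \<gamma>: "\<gamma> \<in> P2" and N: "0 < N"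
  shows "AE w in PiM {..<N} (\<lambda>_. \<pi>).
    (\<Sum>i<N. snd (w i) \<bullet> fst (w (Suc i mod N))) \<le> (\<Sum>i<N. snd (w i) \<bullet> fst (w i))"
proof -
  have c: "\<pi> \<in> couplings \<rho> \<gamma>" using opt by (simp add: optimal_plans_def)
  interpret \<pi>: prob_space \<pi> by (rule coupling_prob_space[OF c \<rho>])
  interpret P: product_prob_space "\<lambda>_::nat. \<pi>" "{..<N}" by standard
  define M where "M = PiM {..<N} (\<lambda>_::nat. \<pi>)"
  interpret M: prob_space M unfolding M_def by (rule P.prob_space_axioms)
  note [measurable] = coupling_measurable[OF c]
  have comp[measurable]: "(\<lambda>w. w i) \<in> M \<rightarrow>\<^sub>M \<pi>" if "i < N" for i
    unfolding M_def using that by simp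
  have dcomp: "distr M \<pi> (\<lambda>w. w i) = \<pi>" if "i < N" for i
    unfolding M_def using P.PiM_component[of i] that by simp
  define s where "s i = Suc i mod N" for i
  have s: "s i < N" for i using N by (simp add: s_def)
  have sbij: "bij_betw s {..<N} {..<N}"
    using bij_betw_Suc_mod[OF N] by (simp add: s_def[abs_def])
  define S where "S w = (\<Sum>i<N. snd (w i) \<bullet> fst (w (s i))) - (\<Sum>i<N. snd (w i) \<bullet> fst (w i))"
    for w :: "nat \<Rightarrow> 'a \<times> 'a"
  have fm[measurable]: "(\<lambda>w. fst (w i)) \<in> borel_measurable M" "(\<lambda>w. snd (w i)) \<in> borel_measurable M"
    if "i < N" for i using that by measurable
  have [measurable]: "S \<in> borel_measurable M"
    unfolding S_def
    by (intro borel_measurable_diff borel_measurable_sum borel_measurable_inner fm s) auto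
  define T where "T w = (\<lambda>i\<in>{..<N}. w (s i))" for w :: "nat \<Rightarrow> 'a \<times> 'a"
  have Tm[measurable]: "T \<in> M \<rightarrow>\<^sub>M M"
    unfolding T_def[abs_def] M_def by (intro measurable_restrict measurable_component_singleton) (simp add: s)
  have TM: "distr M M T = M"
    unfolding M_def T_def[abs_def]
    using distr_PiM_reindex[of "{..<N}" "\<lambda>_. \<pi>" s "{..<N}"] sbij \<pi>.prob_space_axioms
    by (auto simp: bij_betw_def)
  have Tapp: "T w i = w (s i)" if "i < N" for w i using that by (simp add: T_def)
  have ST: "S (T w) = S w" for w
  proof -
    have "S (T w) = (\<Sum>i<N. snd (w (s i)) \<bullet> fst (w (s (s i)))) - (\<Sum>i<N. snd (w (s i)) \<bullet> fst (w (s i)))"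
      by (simp add: S_def Tapp s)
    also have "\<dots> = S w"
      unfolding S_def
      using sum.reindex_bij_betw[OF sbij, of "\<lambda>i. snd (w i) \<bullet> fst (w (s i))"]
        sum.reindex_bij_betw[OF sbij, of "\<lambda>i. snd (w i) \<bullet> fst (w i)"] by simp
    finally show ?thesis .
  qed
  define h where "h w = (if S w > 0 then fst (w (s 0)) else fst (w 0))" for w :: "nat \<Rightarrow> 'a \<times> 'a"
  have hm[measurable]: "h \<in> borel_measurable M"
    unfolding h_def[abs_def] using N s by measurable
  define \<pi>' where "\<pi>' = distr M borel (\<lambda>w. (h w, snd (w 0)))"
  have pm[measurable]: "(\<lambda>w. (h w, snd (w 0))) \<in> M \<rightarrow>\<^sub>M borel"
    using N by (intro borel_measurable_Pair) measurable
  have "distr \<pi>' borel snd = \<gamma>"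
  proof -
    have "distr \<pi>' borel snd = distr M borel (\<lambda>w. snd (w 0))"
      unfolding \<pi>'_def by (subst distr_distr) (auto simp: comp_def)
    also have "\<dots> = distr (distr M \<pi> (\<lambda>w. w 0)) borel snd"
      using N by (subst distr_distr) (auto simp: comp_def)
    finally show ?thesis using N by (simp add: dcomp coupling_distr[OF c])
  qed
  moreover have "distr \<pi>' borel fst = \<rho>"
  proof -
    have "distr \<pi>' borel fst = distr M borel h"
      unfolding \<pi>'_def by (subst distr_distr) (auto simp: comp_def)
    \<comment> \<open>\<open>T\<close> preserves M and the event S > 0, so on this event fst (w (s
      0)) and fst (w 0) have the same law; off the event nothing is changed.\<close>
    also have "\<dots> = distr M borel (\<lambda>w. fst (w 0))"
    proof (rule measure_eqI)
      fix B assume "B \<in> sets (distr M borel h)"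
      then have [measurable]: "B \<in> sets borel" by simp
      define a where "a w = (indicator {w. S w > 0} w * indicator B (fst (w 0)) :: ennreal)" for w
      have am: "a \<in> borel_measurable M"
        unfolding a_def[abs_def] indicator_def of_bool_def mem_Collect_eq using N by measurable
      have aT: "a (T w) = indicator {w. S w > 0} w * indicator B (fst (w (s 0)))" for w
        using N by (simp add: a_def ST Tapp indicator_def)
      have [measurable]: "(\<lambda>w. indicator {w. \<not> S w > 0} w * indicator B (fst (w 0)) :: ennreal) \<in> borel_measurable M"
        unfolding indicator_def of_bool_def mem_Collect_eq using N by measurable
      have "emeasure (distr M borel h) B = (\<integral>\<^sup>+w. indicator B (h w) \<partial>M)"
        using nn_integral_distr[OF hm, of "indicator B"] by simp
      also have "\<dots> = (\<integral>\<^sup>+w. a (T w) + indicator {w. \<not> S w > 0} w * indicator B (fst (w 0)) \<partial>M)"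
        by (intro nn_integral_cong) (auto simp: aT h_def indicator_def)
      also have "\<dots> = (\<integral>\<^sup>+w. a (T w) \<partial>M) + (\<integral>\<^sup>+w. indicator {w. \<not> S w > 0} w * indicator B (fst (w 0)) \<partial>M)"
        using measurable_compose[OF Tm am] by (intro nn_integral_add) auto
      also have "(\<integral>\<^sup>+w. a (T w) \<partial>M) = (\<integral>\<^sup>+w. a w \<partial>M)"
        using nn_integral_distr[OF Tm, of a] am by (simp add: TM)
      also have "(\<integral>\<^sup>+w. a w \<partial>M) + (\<integral>\<^sup>+w. indicator {w. \<not> S w > 0} w * indicator B (fst (w 0)) \<partial>M)
          = (\<integral>\<^sup>+w. a w + indicator {w. \<not> S w > 0} w * indicator B (fst (w 0)) \<partial>M)"
        using am by (intro nn_integral_add[symmetric]) auto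
      also have "\<dots> = (\<integral>\<^sup>+w. indicator B (fst (w 0)) \<partial>M)"
        by (intro nn_integral_cong) (auto simp: a_def indicator_def)
      also have "\<dots> = emeasure (distr M borel (\<lambda>w. fst (w 0))) B"
        using N by (subst nn_integral_distr[of "\<lambda>w. fst (w 0)" M borel "indicator B", symmetric]) auto
      finally show "emeasure (distr M borel h) B = emeasure (distr M borel (\<lambda>w. fst (w 0))) B" .
    qed simp
    also have "\<dots> = distr (distr M \<pi> (\<lambda>w. w 0)) borel fst"
      using N by (subst distr_distr) (auto simp: comp_def)
    finally show ?thesis using N by (simp add: dcomp coupling_distr[OF c])
  qed
  ultimately have c': "\<pi>' \<in> couplings \<rho> \<gamma>"
    by (simp add: couplings_def \<pi>'_def)
  have L: "(\<lambda>w. fst (w i)) \<in> L2 M" "(\<lambda>w. snd (w i)) \<in> L2 M" if "i < N" for i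
  proof -
    have "fst \<in> L2 (distr M \<pi> (\<lambda>w. w i))" "snd \<in> L2 (distr M \<pi> (\<lambda>w. w i))"
      unfolding dcomp[OF that]
      using coupling_L2_fst[OF c P2_ident_L2[OF \<rho>] \<rho>] coupling_L2_snd[OF c P2_ident_L2[OF \<gamma>] \<gamma>] by simp_all
    then show "(\<lambda>w. fst (w i)) \<in> L2 M" "(\<lambda>w. snd (w i)) \<in> L2 M"
      using L2_distr_iff[OF comp[OF that], of fst] L2_distr_iff[OF comp[OF that], of snd]
        coupling_measurable[OF c] by simp_all
  qed
  \<comment> \<open>k i is the change in cost on re-pairing sample i. Shift invariance gives all of
    them the integral of k 0, which is the cost of the competitor minus the optimal cost, so their
    sum has nonnegative integral; pointwise that sum is -2 max 0 S.\<close>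
  define k where "k i w = (if S w > 0 then (norm (fst (w (s i)) - snd (w i)))\<^sup>2 - (norm (fst (w i) - snd (w i)))\<^sup>2 else 0)"
    for i and w :: "nat \<Rightarrow> 'a \<times> 'a"
  have d: "integrable M (\<lambda>w. (norm (fst (w j) - snd (w i)))\<^sup>2)" if "i < N" "j < N" for i j
    using L2_diff[OF L(1)[OF that(2)] L(2)[OF that(1)]] by (simp add: L2_def)
  have ki: "integrable M (k i)" if "i < N" for i
  proof (rule Bochner_Integration.integrable_bound)
    show "integrable M (\<lambda>w. (norm (fst (w (s i)) - snd (w i)))\<^sup>2 + (norm (fst (w i) - snd (w i)))\<^sup>2)"
      using that s by (intro Bochner_Integration.integrable_add d)
    show "k i \<in> borel_measurable M"
      unfolding k_def[abs_def] using that s by measurable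
    show "AE w in M. norm (k i w) \<le> norm ((norm (fst (w (s i)) - snd (w i)))\<^sup>2 + (norm (fst (w i) - snd (w i)))\<^sup>2)"
    proof (intro AE_I2)
      have abs: "\<bar>a - b\<bar> \<le> a + b" if "0 \<le> a" "0 \<le> b" for a b :: real using that by simp
      show "norm (k i w) \<le> norm ((norm (fst (w (s i)) - snd (w i)))\<^sup>2 + (norm (fst (w i) - snd (w i)))\<^sup>2)" for w
        by (simp add: k_def abs)
    qed
  qed
  have "transport_cost \<pi> \<le> transport_cost \<pi>'"
    using opt c' by (simp add: optimal_plans_def)
  moreover have "transport_cost \<pi> = (LINT w|M. (norm (fst (w 0) - snd (w 0)))\<^sup>2)"
    using integral_distr[OF comp[OF N], of "\<lambda>z. (norm (fst z - snd z))\<^sup>2"]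
    by (simp add: dcomp[OF N] transport_cost_def case_prod_unfold)
  moreover have "transport_cost \<pi>' = (LINT w|M. (norm (h w - snd (w 0)))\<^sup>2)"
    unfolding transport_cost_def \<pi>'_def case_prod_unfold
    by (subst integral_distr) auto
  moreover have "(LINT w|M. (norm (h w - snd (w 0)))\<^sup>2) = (LINT w|M. (norm (fst (w 0) - snd (w 0)))\<^sup>2 + k 0 w)"
    by (intro Bochner_Integration.integral_cong) (auto simp: k_def h_def)
  ultimately have k0: "0 \<le> (LINT w|M. k 0 w)"
    using d[OF N N] ki[OF N] by simp
  have kk: "(LINT w|M. k i w) = (LINT w|M. k 0 w)" if "i < N" for i
    using that
  proof (induction i)
    case (Suc i)
    have "k (Suc i) w = k i (T w)" for w
      using Suc.prems s by (simp add: k_def ST Tapp) (simp add: s_def)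
    then have "(LINT w|M. k (Suc i) w) = (LINT w|M. k i (T w))" by simp
    also have "\<dots> = (LINT w|M. k i w)"
      using integral_distr[OF Tm, of "k i"] ki[of i] Suc.prems by (simp add: TM)
    finally show ?case using Suc by simp
  qed simp
  have sumk: "(\<Sum>i<N. k i w) = - 2 * max 0 (S w)" for w
  proof (cases "S w > 0")
    case True
    have "k i w = (norm (fst (w (s i))))\<^sup>2 - (norm (fst (w i)))\<^sup>2
        - 2 * (snd (w i) \<bullet> fst (w (s i)) - snd (w i) \<bullet> fst (w i))" for i
      using True by (simp add: k_def power2_norm_eq_inner algebra_simps inner_commute)
    then have "(\<Sum>i<N. k i w) = (\<Sum>i<N. (norm (fst (w (s i))))\<^sup>2) - (\<Sum>i<N. (norm (fst (w i)))\<^sup>2) - 2 * S w"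
      by (simp only: sum_subtractf sum_distrib_left[symmetric] S_def)
    also have "(\<Sum>i<N. (norm (fst (w (s i))))\<^sup>2) = (\<Sum>i<N. (norm (fst (w i)))\<^sup>2)"
      by (rule sum.reindex_bij_betw[OF sbij])
    finally show ?thesis using True by simp
  qed (simp add: k_def)
  have "(LINT w|M. (\<Sum>i<N. k i w)) = N * (LINT w|M. k 0 w)"
  proof -
    have "(LINT w|M. (\<Sum>i<N. k i w)) = (\<Sum>i<N. LINT w|M. k i w)"
      by (rule Bochner_Integration.integral_sum) (rule ki, simp)
    also have "\<dots> = (\<Sum>i<N. LINT w|M. k 0 w)"
      by (intro sum.cong kk) simp_all
    finally show ?thesis by simp
  qed
  also have "0 \<le> \<dots>" using k0 by (intro mult_nonneg_nonneg) simp_all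
  finally have "0 \<le> (LINT w|M. (\<Sum>i<N. k i w))" .
  then have *: "(LINT w|M. max 0 (S w)) \<le> 0"
    by (simp add: sumk)
  have "integrable M (\<lambda>w. \<Sum>i<N. k i w)" using ki by (intro Bochner_Integration.integrable_sum) auto
  then have mi: "integrable M (\<lambda>w. max 0 (S w))"
    by (simp add: sumk)
  have "0 \<le> (LINT w|M. max 0 (S w))" by simp
  with * have "(LINT w|M. max 0 (S w)) = 0" by simp
  then have "AE w in M. max 0 (S w) = 0"
    using integral_nonneg_eq_0_iff_AE[OF mi] by simp
  then show ?thesis
    unfolding M_def[symmetric] by eventually_elim (simp add: S_def s_def)
qed

section \<open>From almost every tuple to every tuple of support points\<close>

definition msupport :: "'a::topological_space measure \<Rightarrow> 'a set" where
  "msupport M = {z. \<forall>U. open U \<longrightarrow> z \<in> U \<longrightarrow> emeasure M U \<noteq> 0}"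

text \<open>A point outside the support lies in a null set of a countable basis, and countably many
  null sets have a null union.\<close>

lemma AE_in_msupport:
  fixes M :: "'a::second_countable_topology measure"
  assumes "sets M = sets borel"
  shows "AE z in M. z \<in> msupport M"
proof -
  obtain B :: "'a set set" where B: "countable B" "topological_basis B"
    using ex_countable_basis by auto
  have "AE z in M. \<forall>b\<in>{b\<in>B. emeasure M b = 0}. z \<notin> b"
  proof (subst AE_ball_countable)
    show "countable {b\<in>B. emeasure M b = 0}" using B(1) by simp
    show "\<forall>b\<in>{b\<in>B. emeasure M b = 0}. AE z in M. z \<notin> b"
    proof
      fix b assume "b \<in> {b\<in>B. emeasure M b = 0}"
      moreover from this have "b \<in> sets M"
        using topological_basis_open[OF B(2)] assms by auto
      ultimately have "b \<in> null_sets M" by auto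
      then show "AE z in M. z \<notin> b" by (rule AE_not_in)
    qed
  qed
  then show ?thesis
  proof eventually_elim
    case (elim z)
    have "emeasure M U \<noteq> 0" if U: "open U" "z \<in> U" for U
    proof
      assume 0: "emeasure M U = 0"
      obtain b where b: "b \<in> B" "z \<in> b" "b \<subseteq> U"
        using topological_basisE[OF B(2) U] .
      have "emeasure M b \<le> emeasure M U"
        using b U assms by (intro emeasure_mono) auto
      then show False using elim b 0 by auto
    qed
    then show ?case by (simp add: msupport_def)
  qed
qed

text \<open>A product of balls around support points has positive mass, so it contains a tuple from
  the almost sure set; shrinking the balls gives the inequality by continuity. Potentials are built
  from chains of unbounded length in one fixed set, which the almost sure statement for each single
  N does not provide.\<close>

lemma optimal_plan_cyclically_monotone:
  fixes \<pi> :: "('a::euclidean_space \<times> 'a) measure"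
  assumes opt: "\<pi> \<in> optimal_plans \<rho> \<gamma>" and \<rho>: "\<rho> \<in> P2" and \<gamma>: "\<gamma> \<in> P2" and N: "0 < N"
    and z: "\<And>i. i < N \<Longrightarrow> z i \<in> msupport \<pi>"
  shows "(\<Sum>i<N. snd (z i) \<bullet> fst (z (Suc i mod N))) \<le> (\<Sum>i<N. snd (z i) \<bullet> fst (z i))"
proof -
  have c: "\<pi> \<in> couplings \<rho> \<gamma>" using opt by (simp add: optimal_plans_def)
  interpret \<pi>: prob_space \<pi> by (rule coupling_prob_space[OF c \<rho>])
  interpret P: product_prob_space "\<lambda>_::nat. \<pi>" "{..<N}" by standard
  define Q where "Q n w \<longleftrightarrow> (\<forall>i<N. dist (w i) (z i) < 1 / real (Suc n)) \<and>
      (\<Sum>i<N. snd (w i) \<bullet> fst (w (Suc i mod N))) \<le> (\<Sum>i<N. snd (w i) \<bullet> fst (w i))" for n w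
  have "\<exists>w. Q n w" for n
  proof (rule ccontr)
    assume no: "\<not> ?thesis"
    define A where "A = PiE {..<N} (\<lambda>i. ball (z i) (1 / real (Suc n)))"
    have bs: "ball x r \<in> sets \<pi>" for x r using coupling_sets[OF c] by simp
    have "AE w in PiM {..<N} (\<lambda>_. \<pi>). w \<notin> A"
      using optimal_plan_AE_cyclically_monotone[OF opt \<rho> \<gamma> N]
    proof eventually_elim
      case (elim w)
      then show ?case using no by (auto simp: Q_def A_def PiE_iff dist_commute)
    qed
    moreover have "A \<in> sets (PiM {..<N} (\<lambda>_. \<pi>))"
      unfolding A_def by (intro sets_PiM_I_finite bs) auto
    ultimately have "emeasure (PiM {..<N} (\<lambda>_. \<pi>)) A = 0"
      using AE_iff_null_sets[of A "PiM {..<N} (\<lambda>_. \<pi>)"] by blast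
    then have "(\<Prod>i<N. emeasure \<pi> (ball (z i) (1 / real (Suc n)))) = 0"
      unfolding A_def by (subst (asm) P.emeasure_PiM) (auto intro: bs)
    then obtain i where "i < N" "emeasure \<pi> (ball (z i) (1 / real (Suc n))) = 0"
      by auto
    moreover have "z i \<in> ball (z i) (1 / real (Suc n))" by simp
    ultimately have "z i \<notin> msupport \<pi>"
      unfolding msupport_def using open_ball by blast
    then show False using z \<open>i < N\<close> by blast
  qed
  then obtain w where "\<And>n. Q n (w n)" by metis
  then have w: "\<And>n i. i < N \<Longrightarrow> dist (w n i) (z i) < 1 / real (Suc n)"
    and le: "\<And>n. (\<Sum>i<N. snd (w n i) \<bullet> fst (w n (Suc i mod N))) \<le> (\<Sum>i<N. snd (w n i) \<bullet> fst (w n i))"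
    by (simp_all add: Q_def)
  have lim: "(\<lambda>n. w n i) \<longlonglongrightarrow> z i" if "i < N" for i
  proof (rule metric_tendsto_imp_tendsto[OF LIMSEQ_inverse_real_of_nat])
    show "\<forall>\<^sub>F n in sequentially. dist (w n i) (z i) \<le> dist (inverse (real (Suc n))) 0"
      using w[OF that] by (intro always_eventually) (auto simp: inverse_eq_divide intro: less_imp_le)
  qed
  have "(\<lambda>n. \<Sum>i<N. snd (w n i) \<bullet> fst (w n (Suc i mod N))) \<longlonglongrightarrow> (\<Sum>i<N. snd (z i) \<bullet> fst (z (Suc i mod N)))"
    using N by (intro tendsto_intros lim) auto
  moreover have "(\<lambda>n. \<Sum>i<N. snd (w n i) \<bullet> fst (w n i)) \<longlonglongrightarrow> (\<Sum>i<N. snd (z i) \<bullet> fst (z i))"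
    by (intro tendsto_intros lim) auto
  ultimately show ?thesis
    by (rule LIMSEQ_le) (use le in blast)
qed

section \<open>Potentials and their regularisation\<close>

text \<open>
  Rockafellar's potential; since the slopes are bounded, the supremum over all chains starting at a
  fixed point is finite everywhere.
\<close>

lemma cyclically_monotone_potential:
  fixes G :: "('a::euclidean_space \<times> 'a) set"
  assumes cyc: "\<And>N z. 0 < N \<Longrightarrow> (\<And>i. i < N \<Longrightarrow> z i \<in> G) \<Longrightarrow>
      (\<Sum>i<N. snd (z i) \<bullet> fst (z (Suc i mod N))) \<le> (\<Sum>i<N. snd (z i) \<bullet> fst (z i))"
    and bd: "\<And>x y. (x, y) \<in> G \<Longrightarrow> norm y \<le> R" and R: "0 \<le> R"
  obtains \<phi> where "\<And>x y. \<bar>\<phi> x - \<phi> y\<bar> \<le> R * norm (x - y)" "convex_on UNIV \<phi>"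
    "\<And>x y u. (x, y) \<in> G \<Longrightarrow> \<phi> x + y \<bullet> (u - x) \<le> \<phi> u"
proof (cases "G = {}")
  case True
  show ?thesis
    by (rule that[of "\<lambda>_. 0"]) (use True R in \<open>auto simp: convex_on_def\<close>)
next
  case False
  then obtain x0 y0 where z0: "(x0, y0) \<in> G" by auto
  \<comment> \<open>The affine function of x belonging to a chain of n + 1 points of G: each point
    is left along its own slope, the last one towards x.\<close>
  define val where "val = (\<lambda>(n::nat, z :: nat \<Rightarrow> 'a \<times> 'a). \<lambda>x :: 'a. (\<Sum>i<n. snd (z i) \<bullet> (fst (z (Suc i)) - fst (z i))) + snd (z n) \<bullet> (x - fst (z n)))"
  let ?C = "{(n, z). z 0 = (x0, y0) \<and> (\<forall>i\<le>n. z i \<in> G)} :: (nat \<times> (nat \<Rightarrow> 'a \<times> 'a)) set"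
  have ne: "?C \<noteq> {}"
  proof -
    have "(0, \<lambda>_. (x0, y0)) \<in> ?C" using z0 by simp
    then show ?thesis unfolding ex_in_conv[symmetric] by (rule exI)
  qed
  have slope: "val c x - val c y \<le> R * norm (x - y)" if "c \<in> ?C" for c x y
  proof -
    obtain n z where c: "c = (n, z)" by (cases c)
    have "norm (snd (z n)) \<le> R" using that bd[of "fst (z n)" "snd (z n)"] by (auto simp: c)
    moreover have "val c x - val c y = snd (z n) \<bullet> (x - y)"
      by (simp add: val_def c inner_diff_right)
    ultimately show ?thesis
      using norm_cauchy_schwarz[of "snd (z n)" "x - y"] mult_right_mono[of "norm (snd (z n))" R "norm (x - y)"]
      by simp
  qed
  \<comment> \<open>At x0 the chain closes into a cycle of Suc n points, which is where
    \<open>cyc\<close> enters; with the slope bound this makes the supremum finite.\<close>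
  have base: "val c x0 \<le> 0" if "c \<in> ?C" for c
  proof -
    obtain n z where c: "c = (n, z)" by (cases c)
    have z: "z 0 = (x0, y0)" "\<And>i. i \<le> n \<Longrightarrow> z i \<in> G" using that by (auto simp: c)
    have "(\<Sum>i<Suc n. snd (z i) \<bullet> fst (z (Suc i mod Suc n))) \<le> (\<Sum>i<Suc n. snd (z i) \<bullet> fst (z i))"
      by (rule cyc) (use z in auto)
    moreover have "(\<Sum>i<n. snd (z i) \<bullet> fst (z (Suc i mod Suc n))) = (\<Sum>i<n. snd (z i) \<bullet> fst (z (Suc i)))"
      by (rule sum.cong) auto
    ultimately show ?thesis
      using z(1) by (simp add: val_def c inner_diff_right sum_subtractf)
  qed
  have bdd: "bdd_above ((\<lambda>c. val c x) ` ?C)" for x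
  proof (rule bdd_aboveI2)
    fix c assume "c \<in> ?C"
    then show "val c x \<le> R * norm (x - x0)"
      using slope[of c x x0] base[of c] by linarith
  qed
  define \<phi> where "\<phi> x = (SUP c\<in>?C. val c x)" for x
  have up: "val c x \<le> \<phi> x" if "c \<in> ?C" for c x
    unfolding \<phi>_def by (rule cSUP_upper[OF that bdd])
  have least: "\<phi> x \<le> b" if "\<And>c. c \<in> ?C \<Longrightarrow> val c x \<le> b" for x b
    unfolding \<phi>_def by (rule cSUP_least[OF ne that])
  have half: "\<phi> x \<le> \<phi> y + R * norm (x - y)" for x y
    by (rule least) (use slope[of _ x y] up[of _ y] in \<open>smt (verit)\<close>)
  show ?thesis
  proof (rule that)
    show "\<bar>\<phi> x - \<phi> y\<bar> \<le> R * norm (x - y)" for x y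
      using half[of x y] half[of y x] by (simp add: norm_minus_commute abs_le_iff)
    show "convex_on UNIV \<phi>"
    proof (rule convex_onI)
      fix t :: real and x y :: 'a assume t: "0 < t" "t < 1"
      show "\<phi> ((1 - t) *\<^sub>R x + t *\<^sub>R y) \<le> (1 - t) * \<phi> x + t * \<phi> y"
      proof (rule least)
        fix c assume c: "c \<in> ?C"
        have "val c ((1 - t) *\<^sub>R x + t *\<^sub>R y) = (1 - t) * val c x + t * val c y"
          by (cases c) (simp add: val_def algebra_simps inner_add_right inner_diff_right)
        also have "\<dots> \<le> (1 - t) * \<phi> x + t * \<phi> y"
          using t up[OF c] by (intro add_mono mult_left_mono) auto
        finally show "val c ((1 - t) *\<^sub>R x + t *\<^sub>R y) \<le> (1 - t) * \<phi> x + t * \<phi> y" .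
      qed
    qed simp
    fix x y u assume xy: "(x, y) \<in> G"
    have "\<phi> x \<le> \<phi> u - y \<bullet> (u - x)"
    proof (rule least)
      fix c assume cC: "c \<in> ?C"
      obtain n z where c: "c = (n, z)" by (cases c)
      \<comment> \<open>Appending (x, y) to a chain adds y \<bullet> (u - x) to its value at x; this
        is the subgradient inequality before the supremum is taken.\<close>
      define z' where "z' = z(Suc n := (x, y))"
      have z'C: "(Suc n, z') \<in> ?C"
        using cC xy by (auto simp: c z'_def le_Suc_eq)
      have "(\<Sum>i<n. snd (z' i) \<bullet> (fst (z' (Suc i)) - fst (z' i))) = (\<Sum>i<n. snd (z i) \<bullet> (fst (z (Suc i)) - fst (z i)))"
        by (rule sum.cong) (auto simp: z'_def)
      then have "val (Suc n, z') u = val c x + y \<bullet> (u - x)"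
        by (simp add: val_def c) (simp add: z'_def)
      then show "val c x \<le> \<phi> u - y \<bullet> (u - x)"
        using up[OF z'C, of u] by simp
    qed
    then show "\<phi> x + y \<bullet> (u - x) \<le> \<phi> u" by simp
  qed
qed

text \<open>\<open>\<psi>\<close> is the Moreau envelope of \<open>\<phi>\<close> with parameter e,
  p x the proximal point, and q x = (x - p x) / e the gradient. As q x is a subgradient of
  \<open>\<phi>\<close> at p x, its norm is at most R. The subgradient inequality also gives the
  lower bound, and testing the envelope at y with the point p x gives the upper one.\<close>

lemma lipschitz_convex_smoothing:
  fixes \<phi> :: "'a::euclidean_space \<Rightarrow> real"
  assumes lip: "\<And>x y. \<bar>\<phi> x - \<phi> y\<bar> \<le> R * norm (x - y)" and cvx: "convex_on UNIV \<phi>"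
    and e: "0 < e"
  obtains \<psi> q where "\<And>x. \<bar>\<psi> x - \<phi> x\<bar> \<le> e * R\<^sup>2" "\<And>x. norm (q x) \<le> R"
    "\<And>x y. \<psi> x + q x \<bullet> (y - x) \<le> \<psi> y"
    "\<And>x y. \<psi> y \<le> \<psi> x + q x \<bullet> (y - x) + (norm (y - x))\<^sup>2 / (2 * e)"
proof -
  define f where "f x z = \<phi> z + (norm (x - z))\<^sup>2 / (2 * e)" for x z
  have R: "0 \<le> R"
  proof -
    obtain b :: 'a where "b \<in> Basis" using nonempty_Basis by blast
    then show ?thesis using lip[of b 0] by simp
  qed
  have eR: "0 \<le> 2 * e * R" using R e by (intro mult_nonneg_nonneg) simp_all
  have cont: "continuous_on S \<phi>" for S
  proof (rule lipschitz_on_continuous_on)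
    show "R-lipschitz_on S \<phi>"
      using lip R by (auto intro!: lipschitz_onI simp: dist_norm)
  qed
  \<comment> \<open>Beyond distance 2 e R the quadratic penalty exceeds what an R-Lipschitz function
    can gain, so a minimum over the compact ball is global.\<close>
  have far: "f x x \<le> f x z" if "2 * e * R < norm (x - z)" for x z
  proof -
    have "R * norm (x - z) \<le> (norm (x - z) / (2 * e)) * norm (x - z)"
      using that e by (intro mult_right_mono) (auto simp: field_simps)
    also have "\<dots> = (norm (x - z))\<^sup>2 / (2 * e)" by (simp add: power2_eq_square)
    finally show ?thesis using lip[of x z] by (simp add: f_def)
  qed
  have "\<exists>p. \<forall>z. f x p \<le> f x z" for x
  proof -
    have "\<exists>p\<in>cball x (2 * e * R). \<forall>z\<in>cball x (2 * e * R). f x p \<le> f x z"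
    proof (rule continuous_attains_inf)
      show "cball x (2 * e * R) \<noteq> {}" unfolding cball_eq_empty using eR by linarith
      show "continuous_on (cball x (2 * e * R)) (f x)"
        unfolding f_def[abs_def] using e by (intro continuous_intros cont) auto
    qed simp
    then obtain p where p: "\<And>z. z \<in> cball x (2 * e * R) \<Longrightarrow> f x p \<le> f x z" by blast
    have "f x p \<le> f x z" for z
    proof (cases "z \<in> cball x (2 * e * R)")
      case False
      then have "f x x \<le> f x z" by (intro far) (simp add: dist_norm)
      moreover have "f x p \<le> f x x" using eR by (intro p) (simp only: mem_cball dist_self)
      ultimately show ?thesis by simp
    qed (rule p)
    then show ?thesis by blast
  qed
  then obtain p where p: "\<And>x z. f x (p x) \<le> f x z" by metis
  define q where "q x = (1 / e) *\<^sub>R (x - p x)" for x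
  define \<psi> where "\<psi> x = f x (p x)" for x
  have xp: "x - p x = e *\<^sub>R q x" for x using e by (simp add: q_def)
  have sub: "\<phi> (p x) + q x \<bullet> (z - p x) \<le> \<phi> z" for x z
  proof -
    define d where "d = z - p x"
    \<comment> \<open>Minimality of p x against p x + t d, with \<phi> bounded by convexity on the
      segment to z; after division by t the quadratic term is still O(t).\<close>
    have "q x \<bullet> d \<le> \<phi> z - \<phi> (p x) + t * ((norm d)\<^sup>2 / (2 * e))" if t: "0 < t" "t < 1" for t
    proof -
      have "f x (p x) \<le> f x (p x + t *\<^sub>R d)" by (rule p)
      moreover have "\<phi> (p x + t *\<^sub>R d) \<le> (1 - t) * \<phi> (p x) + t * \<phi> z"
      proof -
        have "p x + t *\<^sub>R d = (1 - t) *\<^sub>R p x + t *\<^sub>R z" by (simp add: d_def algebra_simps)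
        then show ?thesis using convex_onD[OF cvx, of t "p x" z] t by simp
      qed
      moreover have "(norm (x - (p x + t *\<^sub>R d)))\<^sup>2 / (2 * e) = (norm (x - p x))\<^sup>2 / (2 * e) - t * (q x \<bullet> d) + t * t * ((norm d)\<^sup>2 / (2 * e))"
      proof -
        have "x - (p x + t *\<^sub>R d) = (x - p x) - t *\<^sub>R d" by simp
        then have "(norm (x - (p x + t *\<^sub>R d)))\<^sup>2 = (norm (x - p x))\<^sup>2 - 2 * t * ((x - p x) \<bullet> d) + t * t * (norm d)\<^sup>2"
          by (simp add: power2_norm_eq_inner inner_diff_left inner_diff_right inner_commute algebra_simps)
        also have "\<dots> = (norm (x - p x))\<^sup>2 - 2 * t * e * (q x \<bullet> d) + t * t * (norm d)\<^sup>2"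
          unfolding xp by simp
        finally show ?thesis using e by (simp add: field_simps)
      qed
      ultimately have "t * (q x \<bullet> d) \<le> t * (\<phi> z - \<phi> (p x) + t * ((norm d)\<^sup>2 / (2 * e)))"
        by (simp add: f_def algebra_simps)
      then show ?thesis using t by simp
    qed
    then have ev: "\<forall>\<^sub>F t in at_right 0. q x \<bullet> d \<le> \<phi> z - \<phi> (p x) + t * ((norm d)\<^sup>2 / (2 * e))"
      unfolding eventually_at_right_field by (intro exI[of _ 1]) auto
    have "((\<lambda>t. \<phi> z - \<phi> (p x) + t * ((norm d)\<^sup>2 / (2 * e))) \<longlongrightarrow> \<phi> z - \<phi> (p x) + 0 * ((norm d)\<^sup>2 / (2 * e))) (at_right 0)"
      by (intro tendsto_intros)
    from tendsto_lowerbound[OF this ev] have "q x \<bullet> d \<le> \<phi> z - \<phi> (p x)" by simp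
    then show ?thesis by (simp add: d_def)
  qed
  have \<psi>q: "\<psi> x = \<phi> (p x) + e / 2 * (norm (q x))\<^sup>2" for x
    using e by (simp add: \<psi>_def f_def xp power_mult_distrib) (simp add: power2_eq_square)
  have qR: "norm (q x) \<le> R" for x
  proof (cases "q x = 0")
    case False
    have "(norm (q x))\<^sup>2 \<le> R * norm (q x)"
      using sub[of x "p x + q x"] lip[of "p x + q x" "p x"] by (simp add: power2_norm_eq_inner)
    then show ?thesis using False by (simp add: power2_eq_square)
  qed (simp add: R)
  show ?thesis
  proof (rule that)
    show "norm (q x) \<le> R" for x by (rule qR)
    show "\<bar>\<psi> x - \<phi> x\<bar> \<le> e * R\<^sup>2" for x
    proof -
      have "\<psi> x \<le> \<phi> x" using p[of x x] by (simp add: \<psi>_def f_def)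
      moreover have "\<phi> x - \<psi> x \<le> e * R\<^sup>2"
      proof -
        have "\<phi> x - \<psi> x \<le> \<phi> x - \<phi> (p x)" using e by (simp add: \<psi>q)
        also have "\<dots> \<le> R * norm (x - p x)" using lip[of x "p x"] by simp
        also have "\<dots> = e * (R * norm (q x))" using e by (simp add: xp)
        also have "\<dots> \<le> e * (R * R)"
          using e R qR by (intro mult_left_mono) auto
        finally show ?thesis by (simp add: power2_eq_square)
      qed
      moreover have "0 \<le> e * R\<^sup>2" using e by simp
      ultimately show ?thesis by simp
    qed
    show "\<psi> x + q x \<bullet> (y - x) \<le> \<psi> y" for x y
    proof -
      have yx: "y - x = (p y - p x) + e *\<^sub>R (q y - q x)"
        by (simp add: scaleR_diff_right flip: xp)
      \<comment> \<open>The subgradient inequality controls the part p y - p x of y - x; this square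
        absorbs the part e (q y - q x) together with the envelope terms e / 2 times the squared norm
        of q.\<close>
      have "0 \<le> e / 2 * (norm (q y - q x))\<^sup>2" using e by simp
      also have "\<dots> = e / 2 * (norm (q y))\<^sup>2 - e / 2 * (norm (q x))\<^sup>2 - e * (q x \<bullet> (q y - q x))"
        by (simp add: power2_norm_eq_inner inner_diff_left inner_diff_right inner_commute algebra_simps)
      finally show ?thesis
        using sub[of x "p y"] unfolding \<psi>q yx by (simp add: inner_add_right)
    qed
    show "\<psi> y \<le> \<psi> x + q x \<bullet> (y - x) + (norm (y - x))\<^sup>2 / (2 * e)" for x y
    proof -
      have "\<psi> y \<le> f y (p x)" unfolding \<psi>_def by (rule p)
      also have "f y (p x) = \<phi> (p x) + ((norm (y - x))\<^sup>2 + 2 * e * (q x \<bullet> (y - x)) + e * e * (norm (q x))\<^sup>2) / (2 * e)"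
      proof -
        have "(norm (d + e *\<^sub>R q x))\<^sup>2 = (norm d)\<^sup>2 + 2 * e * (q x \<bullet> d) + e * e * (norm (q x))\<^sup>2" for d
          by (simp add: power2_norm_eq_inner inner_add_left inner_add_right inner_commute algebra_simps)
        moreover have "y - p x = (y - x) + e *\<^sub>R q x" by (simp flip: xp)
        ultimately show ?thesis unfolding f_def by (simp only:)
      qed
      also have "\<dots> = \<psi> x + q x \<bullet> (y - x) + (norm (y - x))\<^sup>2 / (2 * e)"
        using e by (simp add: \<psi>q field_simps)
      finally show ?thesis .
    qed
  qed
qed

section \<open>Density of bounded C11 functions\<close>

text \<open>The last clause is the Taylor remainder of a function with Lipschitz gradient. Stated as
  an inequality, it makes the treatment of sums, products and compositions purely algebraic.\<close>

definition C11_bound :: "real \<Rightarrow> ('a::euclidean_space \<Rightarrow> real) \<Rightarrow> ('a \<Rightarrow> 'a) \<Rightarrow> bool" where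
  "C11_bound B k g \<longleftrightarrow> (\<forall>x y. \<bar>k x\<bar> \<le> B \<and> norm (g x) \<le> B \<and> \<bar>k y - k x\<bar> \<le> B * norm (y - x) \<and>
     \<bar>k y - k x - g x \<bullet> (y - x)\<bar> \<le> B * (norm (y - x))\<^sup>2)"

text \<open>An algebra with constants that stands in for the smooth compactly supported functions as
  components of test fields; its building blocks are arctangents of affine functions.\<close>

definition bounded_C11 :: "('a::euclidean_space \<Rightarrow> real) set" where
  "bounded_C11 = {k. \<exists>g B. C11_bound B k g}"

lemma C11_boundD:
  assumes "C11_bound B k g"
  shows "0 \<le> B" "\<bar>k x\<bar> \<le> B" "norm (g x) \<le> B" "\<bar>k y - k x\<bar> \<le> B * norm (y - x)"
    "\<bar>k y - k x - g x \<bullet> (y - x)\<bar> \<le> B * (norm (y - x))\<^sup>2"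
proof -
  show *: "\<bar>k x\<bar> \<le> B" "norm (g x) \<le> B" "\<bar>k y - k x\<bar> \<le> B * norm (y - x)"
    "\<bar>k y - k x - g x \<bullet> (y - x)\<bar> \<le> B * (norm (y - x))\<^sup>2" for x y
    using assms by (simp_all add: C11_bound_def)
  show "0 \<le> B" using *(1)[of undefined] by linarith
qed

lemma bounded_C11I:
  assumes "\<And>x. \<bar>k x\<bar> \<le> B1" "\<And>x. norm (g x) \<le> B2" "\<And>x y. \<bar>k y - k x\<bar> \<le> B3 * norm (y - x)"
    "\<And>x y. \<bar>k y - k x - g x \<bullet> (y - x)\<bar> \<le> B4 * (norm (y - x))\<^sup>2"
  shows "k \<in> bounded_C11"
proof -
  define B where "B = max (max B1 B2) (max B3 B4)"
  have B: "B1 \<le> B" "B2 \<le> B" "B3 \<le> B" "B4 \<le> B" by (simp_all add: B_def)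
  have "\<bar>k x\<bar> \<le> B" "norm (g x) \<le> B" for x
    using assms(1,2)[of x] B by auto
  moreover have "\<bar>k y - k x\<bar> \<le> B * norm (y - x)" for x y
    using assms(3)[of y x] mult_right_mono[OF B(3), of "norm (y - x)"] by simp
  moreover have "\<bar>k y - k x - g x \<bullet> (y - x)\<bar> \<le> B * (norm (y - x))\<^sup>2" for x y
    using assms(4)[of y x] mult_right_mono[OF B(4), of "(norm (y - x))\<^sup>2"] by simp
  ultimately show ?thesis unfolding bounded_C11_def C11_bound_def by blast
qed

lemma bounded_C11_const: "(\<lambda>_. c) \<in> bounded_C11"
  by (rule bounded_C11I[of _ "\<bar>c\<bar>" "\<lambda>_. 0" 0 0 0]) auto

lemma bounded_C11_add:
  assumes "k1 \<in> bounded_C11" "k2 \<in> bounded_C11"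
  shows "(\<lambda>x. k1 x + k2 x) \<in> bounded_C11"
proof -
  obtain g B where "C11_bound B k1 g" using assms(1) by (auto simp: bounded_C11_def)
  note 1 = C11_boundD[OF this]
  obtain h C where "C11_bound C k2 h" using assms(2) by (auto simp: bounded_C11_def)
  note 2 = C11_boundD[OF this]
  show ?thesis
  proof (rule bounded_C11I)
    show "\<bar>k1 x + k2 x\<bar> \<le> B + C" for x using 1(2)[of x] 2(2)[of x] by linarith
    show "norm (g x + h x) \<le> B + C" for x using norm_triangle_mono 1(3) 2(3) by blast
    show "\<bar>(k1 y + k2 y) - (k1 x + k2 x)\<bar> \<le> (B + C) * norm (y - x)" for x y
      using 1(4)[of y x] 2(4)[of y x] by (simp add: distrib_right)
    show "\<bar>(k1 y + k2 y) - (k1 x + k2 x) - (g x + h x) \<bullet> (y - x)\<bar> \<le> (B + C) * (norm (y - x))\<^sup>2" for x y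
      using 1(5)[of y x] 2(5)[of y x] by (simp add: distrib_right inner_add_left)
  qed
qed

lemma bounded_C11_mult:
  assumes "k1 \<in> bounded_C11" "k2 \<in> bounded_C11"
  shows "(\<lambda>x. k1 x * k2 x) \<in> bounded_C11"
proof -
  obtain g B where "C11_bound B k1 g" using assms(1) by (auto simp: bounded_C11_def)
  note 1 = C11_boundD[OF this]
  obtain h C where "C11_bound C k2 h" using assms(2) by (auto simp: bounded_C11_def)
  note 2 = C11_boundD[OF this]
  have prod: "\<bar>a * b\<bar> \<le> p * q" if "\<bar>a\<bar> \<le> p" "\<bar>b\<bar> \<le> q" for a b p q :: real
    unfolding abs_mult using that by (intro mult_mono) auto
  show ?thesis
  proof (rule bounded_C11I)
    show "\<bar>k1 x * k2 x\<bar> \<le> B * C" for x by (rule prod[OF 1(2) 2(2)])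
    show "norm (k1 x *\<^sub>R h x + k2 x *\<^sub>R g x) \<le> B * C + C * B" for x
    proof (rule norm_triangle_mono)
      show "norm (k1 x *\<^sub>R h x) \<le> B * C" using 1 2 by (simp add: mult_mono)
      show "norm (k2 x *\<^sub>R g x) \<le> C * B" using 1 2 by (simp add: mult_mono)
    qed
    show "\<bar>k1 y * k2 y - k1 x * k2 x\<bar> \<le> (B * C + B * C) * norm (y - x)" for x y
    proof -
      have "k1 y * k2 y - k1 x * k2 x = k1 y * (k2 y - k2 x) + (k1 y - k1 x) * k2 x"
        by (simp add: algebra_simps)
      then show ?thesis
        using prod[OF 1(2)[of y] 2(4)[of y x]] prod[OF 1(4)[of y x] 2(2)[of x]] by (simp add: algebra_simps)
    qed
    show "\<bar>k1 y * k2 y - k1 x * k2 x - (k1 x *\<^sub>R h x + k2 x *\<^sub>R g x) \<bullet> (y - x)\<bar> \<le> (3 * (B * C)) * (norm (y - x))\<^sup>2" for x y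
    proof -
      \<comment> \<open>Leibniz rule. The cross term of the two increments is of second order by the
        Lipschitz bounds, so there are three contributions of size B C.\<close>
      have "k1 y * k2 y - k1 x * k2 x - (k1 x *\<^sub>R h x + k2 x *\<^sub>R g x) \<bullet> (y - x)
          = k1 x * (k2 y - k2 x - h x \<bullet> (y - x)) + (k1 y - k1 x - g x \<bullet> (y - x)) * k2 x
            + (k1 y - k1 x) * (k2 y - k2 x)"
        unfolding inner_add_left inner_scaleR_left by (simp only: algebra_simps)
      then show ?thesis
        using prod[OF 1(2)[of x] 2(5)[of y x]] prod[OF 1(5)[of y x] 2(2)[of x]] prod[OF 1(4)[of y x] 2(4)[of y x]]
        by (simp add: power2_eq_square algebra_simps)
    qed
  qed
qed

lemma bounded_C11_prod:
  "finite I \<Longrightarrow> (\<And>i. i \<in> I \<Longrightarrow> f i \<in> bounded_C11) \<Longrightarrow> (\<lambda>x. \<Prod>i\<in>I. f i x) \<in> bounded_C11"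
  by (induction I rule: finite_induct) (simp_all add: bounded_C11_const bounded_C11_mult)

text \<open>By the mean value theorem both bounds reduce to the derivative 1 / (1 + z^2) at an
  intermediate point: it is at most 1, and it is 1-Lipschitz.\<close>

lemma arctan_remainders:
  fixes s t :: real
  shows "\<bar>arctan s - arctan t\<bar> \<le> \<bar>s - t\<bar>"
    and "\<bar>arctan s - arctan t - (s - t) / (1 + t\<^sup>2)\<bar> \<le> (s - t)\<^sup>2"
proof -
  have "\<exists>z. \<bar>z - t\<bar> \<le> \<bar>s - t\<bar> \<and> arctan s - arctan t = (s - t) * inverse (1 + z\<^sup>2)"
  proof (rule linorder_cases[of s t])
    assume "s < t"
    from MVT2[OF this DERIV_arctan]
    obtain z where "s < z" "z < t" "arctan t - arctan s = (t - s) * inverse (1 + z\<^sup>2)" by blast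
    then show ?thesis by (intro exI[of _ z]) (auto simp: algebra_simps)
  next
    assume "t < s"
    from MVT2[OF this DERIV_arctan]
    obtain z where "t < z" "z < s" "arctan s - arctan t = (s - t) * inverse (1 + z\<^sup>2)" by blast
    then show ?thesis by (intro exI[of _ z]) auto
  qed auto
  then obtain z where z: "\<bar>z - t\<bar> \<le> \<bar>s - t\<bar>" and d: "arctan s - arctan t = (s - t) * inverse (1 + z\<^sup>2)"
    by blast
  have pos: "0 < 1 + u\<^sup>2" for u :: real by (simp add: add_pos_nonneg)
  have le1: "\<bar>inverse (1 + z\<^sup>2)\<bar> \<le> 1" by (simp add: inverse_le_1_iff)
  show "\<bar>arctan s - arctan t\<bar> \<le> \<bar>s - t\<bar>"
    unfolding d abs_mult using mult_left_mono[OF le1, of "\<bar>s - t\<bar>"] by simp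
  have half: "\<bar>u\<bar> / (1 + u\<^sup>2) \<le> 1 / 2" for u :: real
    using pos[of u] sum_squares_bound[of "\<bar>u\<bar>" 1] by (simp add: field_simps)
  have u1: "\<bar>u\<bar> / ((1 + z\<^sup>2) * (1 + t\<^sup>2)) \<le> \<bar>u\<bar> / (1 + u\<^sup>2)" if "u = z \<or> u = t" for u
  proof (rule divide_left_mono)
    show "1 + u\<^sup>2 \<le> (1 + z\<^sup>2) * (1 + t\<^sup>2)"
      using that by (auto simp: algebra_simps add_nonneg_nonneg)
    show "0 < (1 + z\<^sup>2) * (1 + t\<^sup>2) * (1 + u\<^sup>2)" by (intro mult_pos_pos pos)
  qed simp
  \<comment> \<open>The second factor is at most 1/2 + 1/2, one half for each of t and z by
    \<open>half\<close>; this is the Lipschitz constant 1.\<close>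
  have "inverse (1 + z\<^sup>2) - 1 / (1 + t\<^sup>2) = (t - z) * ((t + z) / ((1 + z\<^sup>2) * (1 + t\<^sup>2)))"
    using pos[of z] pos[of t] by (simp add: divide_simps) (simp add: power2_eq_square algebra_simps)
  moreover have "\<bar>(t + z) / ((1 + z\<^sup>2) * (1 + t\<^sup>2))\<bar> \<le> 1"
  proof -
    have "\<bar>(t + z) / ((1 + z\<^sup>2) * (1 + t\<^sup>2))\<bar> \<le> (\<bar>t\<bar> + \<bar>z\<bar>) / ((1 + z\<^sup>2) * (1 + t\<^sup>2))"
      using pos[of z] pos[of t] by (simp add: abs_mult divide_right_mono)
    also have "\<dots> \<le> 1"
      using u1[of t] u1[of z] half[of t] half[of z] unfolding add_divide_distrib by linarith
    finally show ?thesis .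
  qed
  ultimately have "\<bar>inverse (1 + z\<^sup>2) - 1 / (1 + t\<^sup>2)\<bar> \<le> \<bar>t - z\<bar> * 1"
    by (simp only: abs_mult) (intro mult_left_mono, auto)
  then have le2: "\<bar>inverse (1 + z\<^sup>2) - 1 / (1 + t\<^sup>2)\<bar> \<le> \<bar>s - t\<bar>"
    using z unfolding mult_1_right by (simp only: abs_minus_commute[of t z])
  have "arctan s - arctan t - (s - t) / (1 + t\<^sup>2) = (s - t) * (inverse (1 + z\<^sup>2) - 1 / (1 + t\<^sup>2))"
    by (simp add: d algebra_simps)
  then show "\<bar>arctan s - arctan t - (s - t) / (1 + t\<^sup>2)\<bar> \<le> (s - t)\<^sup>2"
    using mult_left_mono[OF le2, of "\<bar>s - t\<bar>"] by (simp only: abs_mult power2_eq_square abs_mult_self_eq abs_ge_zero)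
qed

lemma bounded_C11_arctan: "(\<lambda>x. arctan (a \<bullet> x + c)) \<in> bounded_C11"
proof (rule bounded_C11I)
  show "\<bar>arctan (a \<bullet> x + c)\<bar> \<le> pi / 2" for x
    using arctan_bounded[of "a \<bullet> x + c"] by linarith
  have ay: "(a \<bullet> y + c) - (a \<bullet> x + c) = a \<bullet> (y - x)" for x y by (simp add: inner_diff_right)
  show "norm ((1 / (1 + (a \<bullet> x + c)\<^sup>2)) *\<^sub>R a) \<le> 1 * norm a" for x
    unfolding norm_scaleR by (intro mult_right_mono) (simp_all add: add_pos_nonneg)
  show "\<bar>arctan (a \<bullet> y + c) - arctan (a \<bullet> x + c)\<bar> \<le> norm a * norm (y - x)" for x y
    using arctan_remainders(1)[of "a \<bullet> y + c" "a \<bullet> x + c"] Cauchy_Schwarz_ineq2[of a "y - x"]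
    by (simp only: ay)
  show "\<bar>arctan (a \<bullet> y + c) - arctan (a \<bullet> x + c) - (1 / (1 + (a \<bullet> x + c)\<^sup>2)) *\<^sub>R a \<bullet> (y - x)\<bar> \<le> (norm a)\<^sup>2 * (norm (y - x))\<^sup>2" for x y
  proof -
    have "(a \<bullet> (y - x))\<^sup>2 \<le> (norm a)\<^sup>2 * (norm (y - x))\<^sup>2"
      using power_mono[OF Cauchy_Schwarz_ineq2[of a "y - x"], of 2] by (simp add: power_mult_distrib)
    then show ?thesis
      using arctan_remainders(2)[of "a \<bullet> y + c" "a \<bullet> x + c"] unfolding ay by simp
  qed
qed

lemma bounded_C11_borel:
  assumes "k \<in> bounded_C11"
  shows "k \<in> borel_measurable borel"
proof -
  obtain B g where "C11_bound B k g" using assms by (auto simp: bounded_C11_def)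
  then have "B-lipschitz_on UNIV k"
    by (intro lipschitz_onI) (auto simp: dist_norm C11_boundD)
  then show ?thesis
    by (intro borel_measurable_continuous_onI lipschitz_on_continuous_on)
qed

lemma bounded_C11_integrable:
  fixes k :: "'a::euclidean_space \<Rightarrow> real"
  assumes "k \<in> bounded_C11" "finite_measure M" "sets M = sets borel"
  shows "integrable M k"
proof -
  interpret finite_measure M by fact
  have "k \<in> borel_measurable M"
    using bounded_C11_borel[OF assms(1)] by (simp add: assms(3) cong: measurable_cong_sets)
  moreover obtain B g where "C11_bound B k g" using assms(1) by (auto simp: bounded_C11_def)
  ultimately show ?thesis
    by (intro integrable_const_bound[of _ B]) (auto simp: C11_boundD)
qed

text \<open>The steepness n^2 and the shift by 1/n make the limit the indicator of the open
  half-line at every point: at t = 0 the argument of arctan is -n, while for fixed t > 0 it tends to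
  infinity.\<close>

definition smooth_step :: "nat \<Rightarrow> real \<Rightarrow> real" where
  "smooth_step n t = 1/2 + arctan (real n * (real n * t - 1)) / pi"

lemma smooth_step_bounds: "0 \<le> smooth_step n t" "smooth_step n t \<le> 1"
  using arctan_bounded[of "real n * (real n * t - 1)"] pi_gt_zero
  by (simp_all add: smooth_step_def field_simps)

lemma smooth_step_tendsto: "(\<lambda>n. smooth_step n t) \<longlonglongrightarrow> indicator {0<..} t"
proof (cases "t > 0")
  case True
  have "filterlim (\<lambda>n. real n * (-1 + t * real n)) at_top sequentially"
    using True
    by (intro filterlim_at_top_mult_at_top filterlim_tendsto_add_at_top[OF tendsto_const]
        filterlim_tendsto_pos_mult_at_top[OF tendsto_const] filterlim_real_sequentially)
  then have "filterlim (\<lambda>n. real n * (real n * t - 1)) at_top sequentially"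
    by (simp add: algebra_simps)
  then have "(\<lambda>n. arctan (real n * (real n * t - 1))) \<longlonglongrightarrow> pi / 2"
    by (rule filterlim_compose[OF tendsto_arctan_at_top])
  then have "(\<lambda>n. smooth_step n t) \<longlonglongrightarrow> 1/2 + (pi / 2) / pi"
    unfolding smooth_step_def by (intro tendsto_intros) auto
  then show ?thesis using True by simp
next
  case False
  have "filterlim (\<lambda>n. - real n) at_bot sequentially"
    using filterlim_real_sequentially by (simp add: filterlim_uminus_at_bot)
  then have "filterlim (\<lambda>n. real n * (real n * t - 1)) at_bot sequentially"
  proof (rule filterlim_at_bot_mono)
    show "\<forall>\<^sub>F n in sequentially. real n * (real n * t - 1) \<le> - real n"
    proof (intro always_eventually allI)
      fix n :: nat
      have "real n * (real n * t) \<le> 0" using False by (intro mult_nonneg_nonpos) auto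
      then show "real n * (real n * t - 1) \<le> - real n" by (simp add: right_diff_distrib)
    qed
  qed
  then have "(\<lambda>n. arctan (real n * (real n * t - 1))) \<longlonglongrightarrow> - (pi / 2)"
    by (rule filterlim_compose[OF tendsto_arctan_at_bot])
  then have "(\<lambda>n. smooth_step n t) \<longlonglongrightarrow> 1/2 + - (pi / 2) / pi"
    unfolding smooth_step_def by (intro tendsto_intros) auto
  then show ?thesis using False by simp
qed

lemma bounded_C11_smooth_step: "(\<lambda>x. smooth_step n (a \<bullet> x + c)) \<in> bounded_C11"
proof -
  have "(\<lambda>x. smooth_step n (a \<bullet> x + c))
      = (\<lambda>x. 1/2 + (1/pi) * arctan (((real n * real n) *\<^sub>R a) \<bullet> x + real n * (real n * c - 1)))"
    by (auto simp: smooth_step_def algebra_simps)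
  then show ?thesis
    by (simp only:) (intro bounded_C11_add bounded_C11_mult bounded_C11_const bounded_C11_arctan)
qed

definition L1_approximable :: "'a::euclidean_space measure \<Rightarrow> ('a \<Rightarrow> real) \<Rightarrow> bool" where
  "L1_approximable M f \<longleftrightarrow> integrable M f \<and> (\<forall>e>0. \<exists>k\<in>bounded_C11. (LINT x|M. \<bar>f x - k x\<bar>) < e)"

context
  fixes M :: "'a::euclidean_space measure"
  assumes fin: "finite_measure M" and sets: "sets M = sets borel"
begin

lemma L1_approximable_bounded_C11: "k \<in> bounded_C11 \<Longrightarrow> L1_approximable M k"
  unfolding L1_approximable_def using bounded_C11_integrable[OF _ fin sets] by (auto intro!: bexI[of _ k])

lemma L1_approximable_add:
  assumes "L1_approximable M f" "L1_approximable M g"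
  shows "L1_approximable M (\<lambda>x. f x + g x)"
  unfolding L1_approximable_def
proof (intro conjI allI impI)
  show "integrable M (\<lambda>x. f x + g x)" using assms by (simp add: L1_approximable_def)
  fix e :: real assume "e > 0"
  then obtain k \<eta> where *: "k \<in> bounded_C11" "(LINT x|M. \<bar>f x - k x\<bar>) < e / 2"
    "\<eta> \<in> bounded_C11" "(LINT x|M. \<bar>g x - \<eta> x\<bar>) < e / 2"
    using assms unfolding L1_approximable_def by (meson half_gt_zero)
  note i = bounded_C11_integrable[OF *(1) fin sets] bounded_C11_integrable[OF *(3) fin sets]
  have "(LINT x|M. \<bar>f x + g x - (k x + \<eta> x)\<bar>) \<le> (LINT x|M. \<bar>f x - k x\<bar> + \<bar>g x - \<eta> x\<bar>)"
    using assms i by (intro integral_mono) (auto simp: L1_approximable_def)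
  also have "\<dots> = (LINT x|M. \<bar>f x - k x\<bar>) + (LINT x|M. \<bar>g x - \<eta> x\<bar>)"
    using assms i by (intro Bochner_Integration.integral_add) (auto simp: L1_approximable_def)
  finally show "\<exists>k\<in>bounded_C11. (LINT x|M. \<bar>f x + g x - k x\<bar>) < e"
    using * by (intro bexI[of _ "\<lambda>x. k x + \<eta> x"] bounded_C11_add) auto
qed

lemma L1_approximable_cmult:
  assumes "L1_approximable M f"
  shows "L1_approximable M (\<lambda>x. c * f x)"
  unfolding L1_approximable_def
proof (intro conjI allI impI)
  show "integrable M (\<lambda>x. c * f x)" using assms by (simp add: L1_approximable_def)
  fix e :: real assume "e > 0"
  then have "0 < e / (\<bar>c\<bar> + 1)" by (simp add: add_nonneg_pos)
  then obtain k where k: "k \<in> bounded_C11" "(LINT x|M. \<bar>f x - k x\<bar>) < e / (\<bar>c\<bar> + 1)"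
    using assms unfolding L1_approximable_def by blast
  have "(LINT x|M. \<bar>c * f x - c * k x\<bar>) = \<bar>c\<bar> * (LINT x|M. \<bar>f x - k x\<bar>)"
    by (simp add: abs_mult flip: right_diff_distrib)
  also have "\<dots> \<le> (\<bar>c\<bar> + 1) * (LINT x|M. \<bar>f x - k x\<bar>)"
    by (intro mult_right_mono) auto
  also have "\<dots> < (\<bar>c\<bar> + 1) * (e / (\<bar>c\<bar> + 1))"
    using k(2) by (intro mult_strict_left_mono) auto
  also have "\<dots> = e" by simp
  finally show "\<exists>k\<in>bounded_C11. (LINT x|M. \<bar>c * f x - k x\<bar>) < e"
    using k by (intro bexI[of _ "\<lambda>x. c * k x"] bounded_C11_mult bounded_C11_const)
qed

text \<open>Closure under dominated pointwise limits drives the rest: from smooth steps to boxes,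
  through the disjoint unions of the Dynkin argument, and from simple to integrable
  functions.\<close>

lemma L1_approximable_limit:
  assumes s: "\<And>n. L1_approximable M (s n)" and f: "f \<in> borel_measurable M"
    and lim: "\<And>x. (\<lambda>n. s n x) \<longlonglongrightarrow> f x" and bd: "\<And>n x. \<bar>s n x\<bar> \<le> w x" and w: "integrable M w"
  shows "L1_approximable M f"
  unfolding L1_approximable_def
proof (intro conjI allI impI)
  have sm[measurable]: "s n \<in> borel_measurable M" for n
    using s[of n] by (auto simp: L1_approximable_def)
  show fi: "integrable M f"
    by (rule integrable_dominated_convergence[of f M s w]) (use f sm w lim bd in auto)
  have 0: "(\<lambda>n. LINT x|M. \<bar>f x - s n x\<bar>) \<longlonglongrightarrow> (LINT x|M. 0)"
  proof (rule integral_dominated_convergence)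
    show "integrable M (\<lambda>x. \<bar>f x\<bar> + w x)" using fi w by simp
    show "AE x in M. (\<lambda>n. \<bar>f x - s n x\<bar>) \<longlonglongrightarrow> 0"
    proof (rule AE_I2)
      fix x
      have "(\<lambda>n. \<bar>f x - s n x\<bar>) \<longlonglongrightarrow> \<bar>f x - f x\<bar>" by (intro tendsto_intros lim)
      then show "(\<lambda>n. \<bar>f x - s n x\<bar>) \<longlonglongrightarrow> 0" by simp
    qed
    show "AE x in M. norm \<bar>f x - s n x\<bar> \<le> \<bar>f x\<bar> + w x" for n
    proof (rule AE_I2)
      fix x show "norm \<bar>f x - s n x\<bar> \<le> \<bar>f x\<bar> + w x" using bd[of n x] by simp
    qed
    show "(\<lambda>x. \<bar>f x - s n x\<bar>) \<in> borel_measurable M" for n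
      using f by measurable
  qed simp
  fix e :: real assume "e > 0"
  then have "0 < e / 2" by simp
  from LIMSEQ_D[OF 0 this] obtain n where "norm ((LINT x|M. \<bar>f x - s n x\<bar>) - (LINT x|M. 0)) < e / 2" by blast
  then have n: "(LINT x|M. \<bar>f x - s n x\<bar>) < e / 2" by simp
  obtain k where k: "k \<in> bounded_C11" "(LINT x|M. \<bar>s n x - k x\<bar>) < e / 2"
    using s[of n] \<open>0 < e / 2\<close> unfolding L1_approximable_def by blast
  have i: "integrable M (s n)" using s by (simp add: L1_approximable_def)
  note i = i fi bounded_C11_integrable[OF k(1) fin sets]
  have "(LINT x|M. \<bar>f x - k x\<bar>) \<le> (LINT x|M. \<bar>f x - s n x\<bar> + \<bar>s n x - k x\<bar>)"
    using i by (intro integral_mono) auto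
  also have "\<dots> = (LINT x|M. \<bar>f x - s n x\<bar>) + (LINT x|M. \<bar>s n x - k x\<bar>)"
    using i by (intro Bochner_Integration.integral_add) auto
  finally show "\<exists>k\<in>bounded_C11. (LINT x|M. \<bar>f x - k x\<bar>) < e"
    using k n by (intro bexI[of _ k]) auto
qed

lemma L1_approximable_box: "L1_approximable M (indicator (box a b))"
proof (rule L1_approximable_limit)
  interpret finite_measure M by (rule fin)
  define s where "s n x = (\<Prod>i\<in>Basis. smooth_step n (i \<bullet> x + - (a \<bullet> i)) * smooth_step n ((- i) \<bullet> x + b \<bullet> i))" for n x
  have "s n \<in> bounded_C11" for n
    unfolding s_def by (intro bounded_C11_prod bounded_C11_mult bounded_C11_smooth_step) simp
  then show "L1_approximable M (s n)" for n by (rule L1_approximable_bounded_C11)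
  show "indicator (box a b) \<in> borel_measurable M" using sets by simp
  show "(\<lambda>n. s n x) \<longlonglongrightarrow> indicator (box a b) x" for x
  proof -
    have "(\<lambda>n. s n x) \<longlonglongrightarrow> (\<Prod>i\<in>Basis. indicator {0<..} (i \<bullet> x + - (a \<bullet> i)) * indicator {0<..} ((- i) \<bullet> x + b \<bullet> i))"
      unfolding s_def by (intro tendsto_prod tendsto_mult smooth_step_tendsto)
    also have "(\<Prod>i\<in>Basis. indicator {0<..} (i \<bullet> x + - (a \<bullet> i)) * indicator {0<..} ((- i) \<bullet> x + b \<bullet> i)) = (indicator (box a b) x :: real)"
    proof (cases "x \<in> box a b")
      case True
      then show ?thesis by (auto simp: mem_box inner_commute intro!: prod.neutral)
    next
      case False
      then obtain i where "i \<in> Basis" "\<not> (a \<bullet> i < x \<bullet> i \<and> x \<bullet> i < b \<bullet> i)" by (auto simp: mem_box)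
      then have "\<exists>i\<in>Basis. indicator {0<..} (i \<bullet> x + - (a \<bullet> i)) * indicator {0<..} ((- i) \<bullet> x + b \<bullet> i) = (0::real)"
        by (intro bexI[of _ i]) (auto simp: inner_commute indicator_def)
      then show ?thesis using False by (simp add: prod_zero del: mult_eq_0_iff)
    qed
    finally show ?thesis .
  qed
  show "\<bar>s n x\<bar> \<le> 1" for n x
    unfolding s_def abs_prod abs_mult
    by (intro prod_le_1 conjI mult_le_one) (simp_all add: smooth_step_bounds abs_of_nonneg)
  show "integrable M (\<lambda>x. 1 :: real)" by simp
qed

lemma L1_approximable_indicator:
  assumes "A \<in> sets M"
  shows "L1_approximable M (indicator A)"
proof -
  interpret finite_measure M by (rule fin)
  \<comment> \<open>Open boxes are stable under intersection and generate the Borel sets, so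
    complements and disjoint countable unions suffice.\<close>
  have "Int_stable (range (\<lambda>(a, b). box a b :: 'a set))"
    by (rule Int_stableI) (force simp: box_Int_box)
  moreover have "range (\<lambda>(a, b). box a b :: 'a set) \<subseteq> Pow UNIV" by simp
  moreover have "A \<in> sigma_sets UNIV (range (\<lambda>(a, b). box a b :: 'a set))"
    using assms unfolding sets borel_eq_box by (simp add: sets_measure_of)
  ultimately show ?thesis
  proof (induction rule: sigma_sets_induct_disjoint)
    case (basic A)
    then show ?case by (auto simp: L1_approximable_box)
  next
    case empty
    then show ?case using L1_approximable_bounded_C11[OF bounded_C11_const[of 0]] by simp
  next
    case (compl A)
    have "L1_approximable M (\<lambda>x. 1 + (-1) * indicator A x)"
      by (intro L1_approximable_add L1_approximable_cmult compl.IH L1_approximable_bounded_C11[OF bounded_C11_const])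
    moreover have "(\<lambda>x. 1 + (-1) * indicator A x) = (indicator (UNIV - A) :: 'a \<Rightarrow> real)"
      by (auto simp: indicator_def)
    ultimately show ?case by simp
  next
    case (union A)
    have Am: "A i \<in> sets M" for i
      using union(2) unfolding sets borel_eq_box by (auto simp: sets_measure_of)
    have fin_sum: "L1_approximable M (\<lambda>x. \<Sum>i<n. indicator (A i) x)" for n
      by (induction n) (simp_all add: L1_approximable_bounded_C11 bounded_C11_const L1_approximable_add union)
    show ?case
    proof (rule L1_approximable_limit[OF fin_sum])
      show "indicator (\<Union>i. A i) \<in> borel_measurable M" using Am by auto
      have eq: "(\<Sum>i<n. indicator (A i) x :: real) = indicator (\<Union>i<n. A i) x" for n x
        using union(1) by (intro indicator_UN_disjoint[symmetric]) (auto simp: disjoint_family_on_def)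
      show "(\<lambda>n. \<Sum>i<n. indicator (A i) x :: real) \<longlonglongrightarrow> indicator (\<Union>i. A i) x" for x
        unfolding eq by (rule LIMSEQ_indicator_UN)
      show "\<bar>\<Sum>i<n. indicator (A i) x :: real\<bar> \<le> 1" for n x
        unfolding eq by (simp add: indicator_def)
      show "integrable M (\<lambda>x. 1 :: real)" by simp
    qed
  qed
qed

lemma integrable_L1_approximable:
  fixes f :: "'a \<Rightarrow> real"
  assumes "integrable M f"
  shows "L1_approximable M f"
  using assms
proof (induction rule: integrable_induct)
  case (base A c)
  then show ?case
    using L1_approximable_cmult[OF L1_approximable_indicator[OF base(1)], of c] by (simp add: mult.commute)
next
  case (add f g)
  then show ?case by (intro L1_approximable_add)
next
  case (lim f s)
  have "space M = UNIV" using sets_eq_imp_space_eq[OF sets] by simp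
  then show ?case
    using lim by (intro L1_approximable_limit[of s f "\<lambda>x. 2 * norm (f x)"]) auto
qed

end

section \<open>Tangent fields\<close>

definition C11_gradients :: "('a::euclidean_space \<Rightarrow> 'a) set" where
  "C11_gradients = {g. \<exists>\<psi> C. \<forall>x y. \<bar>\<psi> y - \<psi> x - g x \<bullet> (y - x)\<bar> \<le> C * (norm (y - x))\<^sup>2}"

lemma C11_gradientsI:
  "(\<And>x y. \<bar>\<psi> y - \<psi> x - g x \<bullet> (y - x)\<bar> \<le> C * (norm (y - x))\<^sup>2) \<Longrightarrow> g \<in> C11_gradients"
  unfolding C11_gradients_def by blast

text \<open>Expand \<psi>(x + h) around x and around z, and \<psi>(x) around z, with h of length
  norm (x - z) in the direction of g x - g z. The remainders are C, 4 C and C times the squared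
  distance, since x + h is within twice the distance of z; they add up to the constant 6.\<close>

lemma C11_gradient_lipschitz:
  fixes g :: "'a::euclidean_space \<Rightarrow> 'a"
  assumes \<psi>: "\<And>x y. \<bar>\<psi> y - \<psi> x - g x \<bullet> (y - x)\<bar> \<le> C * (norm (y - x))\<^sup>2"
  shows "norm (g x - g z) \<le> 6 * C * norm (x - z)"
proof (cases "g x = g z")
  case True
  obtain b :: 'a where b: "b \<in> Basis" using nonempty_Basis by blast
  have "0 \<le> C * (norm b)\<^sup>2" using \<psi>[of b 0] abs_ge_zero order_trans by (metis diff_zero)
  then have "0 \<le> C" using b by simp
  then show ?thesis using True by simp
next
  case False
  define d where "d = g x - g z"
  define n where "n = norm (x - z)"
  have d: "norm d > 0" and n: "n > 0" using False by (auto simp: d_def n_def)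
  define h where "h = (n / norm d) *\<^sub>R d"
  have h: "norm h = n" using d n by (simp add: h_def)
  have dh: "d \<bullet> h = n * norm d"
    using d by (simp add: h_def power2_norm_eq_inner[symmetric] power2_eq_square)
  have C: "0 \<le> C"
    using \<psi>[of x z] n zero_le_mult_iff[of C "n\<^sup>2"] by (simp add: n_def) (smt (verit) zero_less_power)
  have "norm (x + h - z) \<le> 2 * n"
    using norm_triangle_ineq[of "x - z" h] by (simp add: h n_def add_diff_eq diff_add_eq)
  then have "(norm (x + h - z))\<^sup>2 \<le> (2 * n)\<^sup>2" by (intro power_mono) auto
  then have "C * (norm (x + h - z))\<^sup>2 \<le> C * (4 * n\<^sup>2)"
    using C by (intro mult_left_mono) (auto simp: power_mult_distrib)
  moreover have "\<bar>\<psi> (x + h) - \<psi> x - g x \<bullet> h\<bar> \<le> C * n\<^sup>2"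
    using \<psi>[of "x + h" x] by (simp add: h)
  moreover have "\<bar>\<psi> (x + h) - \<psi> z - (g z \<bullet> (x - z) + g z \<bullet> h)\<bar> \<le> C * (norm (x + h - z))\<^sup>2"
  proof -
    have "x + h - z = (x - z) + h" by simp
    then have "g z \<bullet> (x + h - z) = g z \<bullet> (x - z) + g z \<bullet> h" by (simp only: inner_add_right)
    then show ?thesis using \<psi>[of "x + h" z] by simp
  qed
  moreover have "\<bar>\<psi> x - \<psi> z - g z \<bullet> (x - z)\<bar> \<le> C * n\<^sup>2"
    using \<psi>[of x z] by (simp add: n_def)
  ultimately have "g x \<bullet> h - g z \<bullet> h \<le> 6 * C * n\<^sup>2" by (simp add: abs_le_iff)
  then have "n * norm d \<le> n * (6 * C * n)"
    using dh by (simp add: d_def inner_diff_left power2_eq_square algebra_simps)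
  then show ?thesis using n by (simp add: d_def n_def)
qed

lemma C11_gradient_borel:
  assumes "g \<in> C11_gradients"
  shows "g \<in> borel_measurable borel"
proof -
  obtain \<psi> C where *: "\<And>x y. \<bar>\<psi> y - \<psi> x - g x \<bullet> (y - x)\<bar> \<le> C * (norm (y - x))\<^sup>2"
    using assms by (auto simp: C11_gradients_def)
  have "\<bar>6 * C\<bar>-lipschitz_on UNIV g"
  proof (rule lipschitz_onI)
    fix x y show "dist (g x) (g y) \<le> \<bar>6 * C\<bar> * dist x y"
      using C11_gradient_lipschitz[OF *, of x y] mult_right_mono[OF abs_ge_self[of "6 * C"], of "norm (x - y)"]
      by (simp add: dist_norm)
  qed simp
  then show ?thesis
    by (intro borel_measurable_continuous_onI lipschitz_on_continuous_on)
qed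

lemma C11_gradient_L2:
  assumes "g \<in> C11_gradients" "\<rho> \<in> P2"
  shows "g \<in> L2 \<rho>"
proof -
  interpret prob_space \<rho> using assms(2) by (rule P2_prob_space)
  obtain \<psi> C where *: "\<And>x y. \<bar>\<psi> y - \<psi> x - g x \<bullet> (y - x)\<bar> \<le> C * (norm (y - x))\<^sup>2"
    using assms by (auto simp: C11_gradients_def)
  have gm: "g \<in> borel_measurable \<rho>"
    using C11_gradient_borel[OF assms(1)] by (simp add: P2_measurable_iff[OF assms(2)])
  moreover have "integrable \<rho> (\<lambda>x. (norm (g x))\<^sup>2)"
  proof (rule Bochner_Integration.integrable_bound)
    show "integrable \<rho> (\<lambda>x. 2 * (norm (g 0))\<^sup>2 + 2 * (6 * C)\<^sup>2 * (norm x)\<^sup>2)"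
      using assms(2) by (simp add: P2_def)
    show "(\<lambda>x. (norm (g x))\<^sup>2) \<in> borel_measurable \<rho>" using gm by simp
    show "AE x in \<rho>. norm ((norm (g x))\<^sup>2) \<le> norm (2 * (norm (g 0))\<^sup>2 + 2 * (6 * C)\<^sup>2 * (norm x)\<^sup>2)"
    proof (rule AE_I2)
      fix x
      have "norm (g x) \<le> norm (g 0) + 6 * C * norm x"
        using C11_gradient_lipschitz[OF *, of x 0] norm_triangle_sub[of "g x" "g 0"] by simp
      then have "(norm (g x))\<^sup>2 \<le> (norm (g 0) + 6 * C * norm x)\<^sup>2"
        by (intro power_mono) auto
      also have "\<dots> \<le> 2 * (norm (g 0))\<^sup>2 + 2 * (6 * C * norm x)\<^sup>2"
        using sum_squares_bound[of "norm (g 0)" "6 * C * norm x"] by (simp add: power2_sum)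
      finally show "norm ((norm (g x))\<^sup>2) \<le> norm (2 * (norm (g 0))\<^sup>2 + 2 * (6 * C)\<^sup>2 * (norm x)\<^sup>2)"
        by (simp add: power_mult_distrib)
    qed
  qed
  ultimately show ?thesis by (simp add: L2_def)
qed

lemma C11_gradients_zero: "(\<lambda>x. 0) \<in> C11_gradients"
  unfolding C11_gradients_def by (intro CollectI exI[of _ "\<lambda>_. 0"] exI[of _ 0]) simp

lemma C11_gradients_ident: "(\<lambda>x. x) \<in> C11_gradients"
proof -
  have "\<bar>(norm y)\<^sup>2 / 2 - (norm x)\<^sup>2 / 2 - x \<bullet> (y - x)\<bar> \<le> 1/2 * (norm (y - x))\<^sup>2" for x y :: 'a
  proof -
    have "(norm y)\<^sup>2 / 2 - (norm x)\<^sup>2 / 2 - x \<bullet> (y - x) = 1/2 * (norm (y - x))\<^sup>2"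
      by (simp add: power2_norm_eq_inner inner_diff_left inner_diff_right inner_commute field_simps)
    then show ?thesis by (simp only:) simp
  qed
  then show ?thesis
    unfolding C11_gradients_def by (intro CollectI exI[of _ "\<lambda>x. (norm x)\<^sup>2 / 2"] exI[of _ "1/2"]) blast
qed

lemma C11_gradients_add:
  assumes "g \<in> C11_gradients" "h \<in> C11_gradients"
  shows "(\<lambda>x. g x + h x) \<in> C11_gradients"
proof -
  obtain \<psi> C where 1: "\<And>x y. \<bar>\<psi> y - \<psi> x - g x \<bullet> (y - x)\<bar> \<le> C * (norm (y - x))\<^sup>2"
    using assms by (auto simp: C11_gradients_def)
  obtain \<phi> B where 2: "\<And>x y. \<bar>\<phi> y - \<phi> x - h x \<bullet> (y - x)\<bar> \<le> B * (norm (y - x))\<^sup>2"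
    using assms by (auto simp: C11_gradients_def)
  have "\<bar>(\<psi> y + \<phi> y) - (\<psi> x + \<phi> x) - (g x + h x) \<bullet> (y - x)\<bar> \<le> (C + B) * (norm (y - x))\<^sup>2" for x y
    using 1[of y x] 2[of y x] unfolding inner_add_left distrib_right by linarith
  then show ?thesis
    unfolding C11_gradients_def by (intro CollectI exI[of _ "\<lambda>x. \<psi> x + \<phi> x"] exI[of _ "C + B"]) blast
qed

lemma C11_gradients_scaleR:
  assumes "g \<in> C11_gradients"
  shows "(\<lambda>x. c *\<^sub>R g x) \<in> C11_gradients"
proof -
  obtain \<psi> C where 1: "\<And>x y. \<bar>\<psi> y - \<psi> x - g x \<bullet> (y - x)\<bar> \<le> C * (norm (y - x))\<^sup>2"
    using assms by (auto simp: C11_gradients_def)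
  have "\<bar>c * \<psi> y - c * \<psi> x - (c *\<^sub>R g x) \<bullet> (y - x)\<bar> \<le> (\<bar>c\<bar> * C) * (norm (y - x))\<^sup>2" for x y
  proof -
    have "c * \<psi> y - c * \<psi> x - (c *\<^sub>R g x) \<bullet> (y - x) = c * (\<psi> y - \<psi> x - g x \<bullet> (y - x))"
      by (simp add: algebra_simps)
    then show ?thesis
      using mult_left_mono[OF 1[of y x], of "\<bar>c\<bar>"] by (simp add: abs_mult mult.assoc)
  qed
  then show ?thesis
    unfolding C11_gradients_def by (intro CollectI exI[of _ "\<lambda>x. c * \<psi> x"] exI[of _ "\<bar>c\<bar> * C"]) blast
qed

text \<open>The chain rule for the potential \<psi>(x + s v(x)): the sum is the transposed Jacobian
  of v applied to q. As q is bounded, the second-order remainder of v enters with the uniform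
  constant R L times the modulus of s.\<close>

lemma C11_gradients_compose:
  fixes q :: "'a::euclidean_space \<Rightarrow> 'a"
  assumes q: "\<And>x y. \<bar>\<psi> y - \<psi> x - q x \<bullet> (y - x)\<bar> \<le> C * (norm (y - x))\<^sup>2"
    and C: "0 \<le> C" and qR: "\<And>x. norm (q x) \<le> R" and B: "\<And>b. 0 \<le> B b"
    and lip: "\<And>b x y. b \<in> Basis \<Longrightarrow> \<bar>\<kappa> b y - \<kappa> b x\<bar> \<le> B b * norm (y - x)"
    and rem: "\<And>b x y. b \<in> Basis \<Longrightarrow> \<bar>\<kappa> b y - \<kappa> b x - g b x \<bullet> (y - x)\<bar> \<le> B b * (norm (y - x))\<^sup>2"
  defines "v \<equiv> \<lambda>x. \<Sum>b\<in>Basis. \<kappa> b x *\<^sub>R b"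
  shows "(\<lambda>x. q (x + s *\<^sub>R v x) + s *\<^sub>R (\<Sum>b\<in>Basis. (q (x + s *\<^sub>R v x) \<bullet> b) *\<^sub>R g b x)) \<in> C11_gradients"
proof -
  define L where "L = (\<Sum>b\<in>(Basis::'a set). B b)"
  have "\<bar>\<psi> (y + s *\<^sub>R v y) - \<psi> (x + s *\<^sub>R v x)
      - (q (x + s *\<^sub>R v x) + s *\<^sub>R (\<Sum>b\<in>Basis. (q (x + s *\<^sub>R v x) \<bullet> b) *\<^sub>R g b x)) \<bullet> (y - x)\<bar>
      \<le> (C * (1 + \<bar>s\<bar> * L)\<^sup>2 + \<bar>s\<bar> * (R * L)) * (norm (y - x))\<^sup>2" for x y
  proof -
    define d where "d = y - x"
    define p where "p = q (x + s *\<^sub>R v x)"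
    define e where "e = (y + s *\<^sub>R v y) - (x + s *\<^sub>R v x)"
    have vd: "v y - v x = (\<Sum>b\<in>Basis. (\<kappa> b y - \<kappa> b x) *\<^sub>R b)"
      by (simp add: v_def sum_subtractf scaleR_diff_left)
    have e: "e = d + s *\<^sub>R (v y - v x)" by (simp add: e_def d_def algebra_simps)
    have "norm (v y - v x) \<le> L * norm d"
      unfolding vd L_def sum_distrib_right d_def
      by (intro sum_norm_le) (use lip in auto)
    then have "norm e \<le> norm d + \<bar>s\<bar> * (L * norm d)"
      unfolding e by (intro norm_triangle_mono) (auto intro!: mult_left_mono)
    also have "\<dots> = (1 + \<bar>s\<bar> * L) * norm d" by (simp add: algebra_simps)
    finally have "(norm e)\<^sup>2 \<le> ((1 + \<bar>s\<bar> * L) * norm d)\<^sup>2" by (intro power_mono) auto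
    then have "C * (norm e)\<^sup>2 \<le> C * ((1 + \<bar>s\<bar> * L)\<^sup>2 * (norm d)\<^sup>2)"
      using C by (intro mult_left_mono) (simp_all add: power_mult_distrib)
    then have 1: "\<bar>\<psi> (y + s *\<^sub>R v y) - \<psi> (x + s *\<^sub>R v x) - p \<bullet> e\<bar> \<le> C * (1 + \<bar>s\<bar> * L)\<^sup>2 * (norm d)\<^sup>2"
      using q[of "y + s *\<^sub>R v y" "x + s *\<^sub>R v x"] unfolding e_def[symmetric] p_def[symmetric] by simp
    \<comment> \<open>The linear terms of p \<bullet> e cancel against the proposed gradient; what
      is left are the remainders of the components of v.\<close>
    have "p \<bullet> e - (p + s *\<^sub>R (\<Sum>b\<in>Basis. (p \<bullet> b) *\<^sub>R g b x)) \<bullet> d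
        = s * (\<Sum>b\<in>Basis. (p \<bullet> b) * (\<kappa> b y - \<kappa> b x - g b x \<bullet> d))"
      unfolding e vd by (simp add: inner_add_left inner_add_right inner_sum_left inner_sum_right
          right_diff_distrib sum_subtractf sum.distrib algebra_simps)
    moreover have "\<bar>\<Sum>b\<in>Basis. (p \<bullet> b) * (\<kappa> b y - \<kappa> b x - g b x \<bullet> d)\<bar> \<le> (\<Sum>b\<in>(Basis::'a set). R * (B b * (norm d)\<^sup>2))"
    proof (intro order_trans[OF sum_abs] sum_mono)
      fix b :: 'a assume b: "b \<in> Basis"
      have "\<bar>p \<bullet> b\<bar> \<le> R"
        using Basis_le_norm[OF b, of p] qR[of "x + s *\<^sub>R v x"] by (simp add: p_def)
      then show "\<bar>(p \<bullet> b) * (\<kappa> b y - \<kappa> b x - g b x \<bullet> d)\<bar> \<le> R * (B b * (norm d)\<^sup>2)"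
        unfolding abs_mult d_def by (intro mult_mono rem b) (auto intro: order_trans[OF abs_ge_zero])
    qed
    moreover have "(\<Sum>b\<in>(Basis::'a set). R * (B b * (norm d)\<^sup>2)) = R * L * (norm d)\<^sup>2"
      by (simp add: L_def sum_distrib_left sum_distrib_right mult.assoc)
    ultimately have 2: "\<bar>p \<bullet> e - (p + s *\<^sub>R (\<Sum>b\<in>Basis. (p \<bullet> b) *\<^sub>R g b x)) \<bullet> d\<bar> \<le> \<bar>s\<bar> * (R * L * (norm d)\<^sup>2)"
      by (simp only: abs_mult) (rule mult_left_mono, auto)
    from 1 2 show ?thesis
      unfolding d_def[symmetric] p_def[symmetric] distrib_right by (simp only: mult.assoc)
  qed
  then show ?thesis
    unfolding C11_gradients_def
    by (intro CollectI exI[of _ "\<lambda>x. \<psi> (x + s *\<^sub>R v x)"] exI[of _ "C * (1 + \<bar>s\<bar> * L)\<^sup>2 + \<bar>s\<bar> * (R * L)"]) blast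
qed

text \<open>A lower bound for the slope of the potential in direction u. A pair with norm (snd z) >
  R is left out of the construction of the potential, and there R-Lipschitz continuity still
  guarantees the slope - R norm (u (fst z)).\<close>

definition truncated_pairing :: "real \<Rightarrow> ('a \<Rightarrow> 'a) \<Rightarrow> 'a \<times> 'a::euclidean_space \<Rightarrow> real" where
  "truncated_pairing R u z = (if norm (snd z) \<le> R then snd z \<bullet> u (fst z) else - R * norm (u (fst z)))"

lemma truncated_pairing_bound:
  assumes R: "0 \<le> R"
  shows "\<bar>truncated_pairing R u z\<bar> \<le> R * norm (u (fst z))"
proof (cases "norm (snd z) \<le> R")
  case True
  then show ?thesis
    using Cauchy_Schwarz_ineq2[of "snd z" "u (fst z)"] mult_right_mono[OF True, of "norm (u (fst z))"]
    by (simp add: truncated_pairing_def)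
qed (simp add: truncated_pairing_def R)

text \<open>In the application v is close to w. The regularised slope p, evaluated at x + s v, is
  nearly orthogonal to w, so its pairing with v is at most R times the L1 distance of v and w, up to
  O(s). Convexity bounds the truncated pairing of the plan by the pairing of p with v.\<close>

lemma optimal_plan_test_field:
  fixes \<pi> :: "('a::euclidean_space \<times> 'a) measure"
  assumes opt: "\<pi> \<in> optimal_plans \<rho> \<gamma>" and \<rho>: "\<rho> \<in> P2" and \<gamma>: "\<gamma> \<in> P2"
    and w: "w \<in> L2 \<rho>" and orth: "\<And>g. g \<in> C11_gradients \<Longrightarrow> L2_inner \<rho> w g = 0"
    and k: "\<And>b. k b \<in> bounded_C11" and R: "0 \<le> R"
  defines "v \<equiv> \<lambda>x. \<Sum>b\<in>Basis. k b x *\<^sub>R b"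
  shows "(LINT z|\<pi>. truncated_pairing R v z) \<le> R * (LINT x|\<rho>. norm (v x - w x))"
proof -
  have c: "\<pi> \<in> couplings \<rho> \<gamma>" using opt by (simp add: optimal_plans_def)
  interpret \<pi>: prob_space \<pi> by (rule coupling_prob_space[OF c \<rho>])
  interpret \<rho>: prob_space \<rho> by (rule P2_prob_space[OF \<rho>])
  note [measurable] = coupling_measurable[OF c]
  note \<rho>m = P2_measurable_iff[OF \<rho>]
  have wb[measurable]: "w \<in> borel_measurable borel" using L2_measurable[OF w] by (simp add: \<rho>m)
  have wi: "integrable \<rho> w" by (rule \<rho>.L2_integrable[OF w])
  have vb[measurable]: "v \<in> borel_measurable borel"
    unfolding v_def using bounded_C11_borel[OF k] by measurable
  obtain g B where bnd: "\<And>b. C11_bound (B b) (k b) (g b)"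
    using k unfolding bounded_C11_def mem_Collect_eq by metis
  note B = C11_boundD(1)[OF bnd] and kB = C11_boundD(2)[OF bnd] and gB = C11_boundD(3)[OF bnd]
    and lip = C11_boundD(4)[OF bnd] and rem = C11_boundD(5)[OF bnd]
  have gb[measurable]: "g b \<in> borel_measurable borel" for b
    by (rule C11_gradient_borel[OF C11_gradientsI[OF rem]])
  define L where "L = (\<Sum>b\<in>(Basis::'a set). B b)"
  have vL: "norm (v x) \<le> L" for x
    unfolding v_def L_def using kB by (intro sum_norm_le) auto
  have vi: "integrable \<rho> v"
    using vL by (intro \<rho>.integrable_const_bound[of _ L]) (auto simp: \<rho>m)
  \<comment> \<open>The cut-off bounds the slopes of the chains, so the potential is finite and
    R-Lipschitz on the whole space.\<close>
  define \<Gamma> where "\<Gamma> = {z \<in> msupport \<pi>. norm (snd z) \<le> R}"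
  obtain \<phi> where \<phi>lip: "\<And>x y. \<bar>\<phi> x - \<phi> y\<bar> \<le> R * norm (x - y)" and \<phi>cvx: "convex_on UNIV \<phi>"
    and \<phi>sub: "\<And>x y u. (x, y) \<in> \<Gamma> \<Longrightarrow> \<phi> x + y \<bullet> (u - x) \<le> \<phi> u"
  proof (rule cyclically_monotone_potential[of \<Gamma> R])
    show "(\<Sum>i<N. snd (z i) \<bullet> fst (z (Suc i mod N))) \<le> (\<Sum>i<N. snd (z i) \<bullet> fst (z i))"
      if "0 < N" "\<And>i. i < N \<Longrightarrow> z i \<in> \<Gamma>" for N z
      using optimal_plan_cyclically_monotone[OF opt \<rho> \<gamma> that(1), of z] that(2) by (auto simp: \<Gamma>_def)
  qed (use R in \<open>auto simp: \<Gamma>_def\<close>)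
  let ?a = "truncated_pairing R v"
  have am[measurable]: "?a \<in> borel_measurable \<pi>"
    unfolding truncated_pairing_def by measurable
  have ai: "integrable \<pi> ?a"
  proof (rule \<pi>.integrable_const_bound[of _ "R * L"])
    show "AE z in \<pi>. norm (?a z) \<le> R * L"
      using vL R by (auto intro!: AE_I2 order_trans[OF truncated_pairing_bound] mult_left_mono)
  qed measurable
  have main: "(LINT z|\<pi>. ?a z) \<le> R * (LINT x|\<rho>. norm (v x - w x)) + s * (R * L * (LINT x|\<rho>. norm (w x)) + 2 * R\<^sup>2)"
    if s: "0 < s" for s
  proof -
    \<comment> \<open>The parameter s^2: two evaluations of the envelope cost 2 s^2 R^2, which after
      division by s leaves 2 s R^2.\<close>
    obtain \<psi> q where \<psi>\<phi>: "\<And>x. \<bar>\<psi> x - \<phi> x\<bar> \<le> s\<^sup>2 * R\<^sup>2" and qR: "\<And>x. norm (q x) \<le> R"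
      and low: "\<And>x y. \<psi> x + q x \<bullet> (y - x) \<le> \<psi> y"
      and up: "\<And>x y. \<psi> y \<le> \<psi> x + q x \<bullet> (y - x) + (norm (y - x))\<^sup>2 / (2 * s\<^sup>2)"
      by (rule lipschitz_convex_smoothing[OF \<phi>lip \<phi>cvx, of "s\<^sup>2"]) (use s in auto)
    have q: "\<bar>\<psi> y - \<psi> x - q x \<bullet> (y - x)\<bar> \<le> (1 / (2 * s\<^sup>2)) * (norm (y - x))\<^sup>2" for x y
      using low[of x y] up[of y x] by simp
    have [measurable]: "q \<in> borel_measurable borel"
      by (rule C11_gradient_borel[OF C11_gradientsI[OF q]])
    define p where "p x = q (x + s *\<^sub>R v x)" for x
    have pb[measurable]: "p \<in> borel_measurable borel" unfolding p_def[abs_def] by measurable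
    have pR: "norm (p x) \<le> R" for x using qR by (simp add: p_def)
    define m where "m x = (\<Sum>b\<in>Basis. (p x \<bullet> b) *\<^sub>R g b x)" for x
    have mb[measurable]: "m \<in> borel_measurable borel" unfolding m_def[abs_def] by measurable
    have mRL: "norm (m x) \<le> R * L" for x
      unfolding m_def L_def sum_distrib_left
    proof (rule sum_norm_le)
      fix b :: 'a assume b: "b \<in> Basis"
      show "norm ((p x \<bullet> b) *\<^sub>R g b x) \<le> R * B b"
        unfolding norm_scaleR using Basis_le_norm[OF b, of "p x"] pR[of x] gB[of b x] R
        by (intro mult_mono) auto
    qed
    \<comment> \<open>This is the gradient of \<psi>(x + s v x). Orthogonality turns the pairing of
      w with p into -s times its pairing with m, and the bound R L on m does not depend on
      s.\<close>
    have "(\<lambda>x. p x + s *\<^sub>R m x) \<in> C11_gradients"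
      unfolding p_def m_def v_def
      by (rule C11_gradients_compose[OF q _ qR B lip rem]) simp
    from orth[OF this] have "(LINT x|\<rho>. w x \<bullet> p x + s * (w x \<bullet> m x)) = 0"
      by (simp add: L2_inner_def inner_add_right)
    moreover have wp: "integrable \<rho> (\<lambda>x. w x \<bullet> p x)"
      by (rule Bochner_Integration.integrable_bound[of _ "\<lambda>x. R * norm (w x)"])
         (use wi R pR in \<open>auto simp: \<rho>m abs_mult intro!: AE_I2 order_trans[OF Cauchy_Schwarz_ineq2] mult_right_mono simp: mult.commute\<close>)
    moreover have wm: "integrable \<rho> (\<lambda>x. w x \<bullet> m x)"
      by (rule Bochner_Integration.integrable_bound[of _ "\<lambda>x. \<bar>R * L\<bar> * norm (w x)"])
         (use wi mRL in \<open>auto simp: \<rho>m abs_mult[symmetric] intro!: AE_I2 order_trans[OF Cauchy_Schwarz_ineq2] mult_left_mono order_trans[OF _ abs_ge_self] simp: mult.commute\<close>)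
    ultimately have "(LINT x|\<rho>. w x \<bullet> p x) = - s * (LINT x|\<rho>. w x \<bullet> m x)"
      by simp
    also have "\<dots> \<le> s * (R * L * (LINT x|\<rho>. norm (w x)))"
    proof -
      have "- (LINT x|\<rho>. w x \<bullet> m x) = (LINT x|\<rho>. - (w x \<bullet> m x))" by simp
      also have "\<dots> \<le> (LINT x|\<rho>. R * L * norm (w x))"
      proof (rule integral_mono)
        fix x
        have "\<bar>w x \<bullet> m x\<bar> \<le> norm (w x) * norm (m x)" by (rule Cauchy_Schwarz_ineq2)
        also have "\<dots> \<le> norm (w x) * (R * L)" by (intro mult_left_mono mRL) simp
        finally show "- (w x \<bullet> m x) \<le> R * L * norm (w x)" by (simp add: mult.commute)
      qed (use wm wi in auto)
      finally show ?thesis using mult_left_mono[of _ _ s] s by fastforce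
    qed
    finally have 1: "(LINT x|\<rho>. w x \<bullet> p x) \<le> s * (R * L * (LINT x|\<rho>. norm (w x)))" .
    have pv: "integrable \<rho> (\<lambda>x. p x \<bullet> v x)"
      by (rule Bochner_Integration.integrable_bound[of _ "\<lambda>x. R * norm (v x)"])
         (use vi R pR in \<open>auto simp: \<rho>m abs_mult intro!: AE_I2 order_trans[OF Cauchy_Schwarz_ineq2] mult_right_mono\<close>)
    have "(LINT x|\<rho>. p x \<bullet> v x) - (LINT x|\<rho>. w x \<bullet> p x) = (LINT x|\<rho>. p x \<bullet> (v x - w x))"
      using pv wp by (simp add: inner_diff_right inner_commute)
    also have "\<dots> \<le> (LINT x|\<rho>. R * norm (v x - w x))"
    proof (rule integral_mono)
      fix x
      have "p x \<bullet> (v x - w x) \<le> norm (p x) * norm (v x - w x)" by (rule norm_cauchy_schwarz)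
      also have "\<dots> \<le> R * norm (v x - w x)" by (intro mult_right_mono pR) simp
      finally show "p x \<bullet> (v x - w x) \<le> R * norm (v x - w x)" .
    next
      show "integrable \<rho> (\<lambda>x. p x \<bullet> (v x - w x))"
        using pv wp by (simp add: inner_diff_right inner_commute)
    qed (use vi wi in auto)
    finally have 2: "(LINT x|\<rho>. p x \<bullet> v x) \<le> R * (LINT x|\<rho>. norm (v x - w x)) + s * (R * L * (LINT x|\<rho>. norm (w x)))"
      using 1 by simp
    have pt: "?a z \<le> p (fst z) \<bullet> v (fst z) + 2 * s * R\<^sup>2" if z: "z \<in> msupport \<pi>" for z
    proof -
      define x where "x = fst z"
      \<comment> \<open>The gradient inequality is taken at the endpoint x + s v x and evaluated
        back at x; in this direction convexity bounds the pairing with p from below.\<close>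
      have "s * (p x \<bullet> v x) \<ge> \<psi> (x + s *\<^sub>R v x) - \<psi> x"
        using low[of "x + s *\<^sub>R v x" x] by (simp add: p_def)
      moreover have "\<psi> (x + s *\<^sub>R v x) - \<psi> x \<ge> \<phi> (x + s *\<^sub>R v x) - \<phi> x - 2 * (s\<^sup>2 * R\<^sup>2)"
        using \<psi>\<phi>[of "x + s *\<^sub>R v x"] \<psi>\<phi>[of x] by linarith
      moreover have "\<phi> (x + s *\<^sub>R v x) - \<phi> x \<ge> s * ?a z"
      proof (cases "norm (snd z) \<le> R")
        case True
        then have "(x, snd z) \<in> \<Gamma>" using z by (simp add: \<Gamma>_def x_def)
        from \<phi>sub[OF this, of "x + s *\<^sub>R v x"] True show ?thesis by (simp add: truncated_pairing_def x_def)
      next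
        case False
        then show ?thesis
          using \<phi>lip[of "x + s *\<^sub>R v x" x] s by (simp add: truncated_pairing_def x_def abs_le_iff algebra_simps)
      qed
      ultimately have "s * ?a z \<le> s * (p x \<bullet> v x + 2 * s * R\<^sup>2)"
        by (simp add: algebra_simps power2_eq_square)
      then show ?thesis using s by (simp add: x_def)
    qed
    have pvi: "integrable \<pi> (\<lambda>z. p (fst z) \<bullet> v (fst z))"
      using integrable_distr_eq[OF coupling_measurable(1)[OF c], of "\<lambda>x. p x \<bullet> v x"] pv
      by (simp add: coupling_distr[OF c])
    have "(LINT z|\<pi>. ?a z) \<le> (LINT z|\<pi>. p (fst z) \<bullet> v (fst z) + 2 * s * R\<^sup>2)"
      using AE_in_msupport[OF coupling_sets[OF c]] pt pvi ai by (intro integral_mono_AE) auto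
    also have "\<dots> = (LINT z|\<pi>. p (fst z) \<bullet> v (fst z)) + 2 * s * R\<^sup>2"
      using pvi by (simp add: \<pi>.prob_space)
    also have "(LINT z|\<pi>. p (fst z) \<bullet> v (fst z)) = (LINT x|\<rho>. p x \<bullet> v x)"
      using integral_distr[OF coupling_measurable(1)[OF c], of "\<lambda>x. p x \<bullet> v x"]
      by (simp add: coupling_distr[OF c])
    finally show ?thesis using 2 by (simp add: algebra_simps)
  qed
  show ?thesis
  proof (rule tendsto_lowerbound)
    define K where "K = R * L * (LINT x|\<rho>. norm (w x)) + 2 * R\<^sup>2"
    have "((\<lambda>s. R * (LINT x|\<rho>. norm (v x - w x)) + s * K) \<longlongrightarrow> R * (LINT x|\<rho>. norm (v x - w x)) + 0 * K) (at_right 0)"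
      by (intro tendsto_intros)
    then show "((\<lambda>s. R * (LINT x|\<rho>. norm (v x - w x)) + s * K) \<longlongrightarrow> R * (LINT x|\<rho>. norm (v x - w x))) (at_right 0)"
      by simp
    show "\<forall>\<^sub>F s in at_right 0. (LINT z|\<pi>. ?a z) \<le> R * (LINT x|\<rho>. norm (v x - w x)) + s * K"
      unfolding eventually_at_right_field K_def using main by (intro exI[of _ 1]) auto
  qed simp
qed

text \<open>With R fixed the slopes are bounded, so approximating w in L1 by test fields is enough.
  The cut-off is removed afterwards by dominated convergence, with the product of the norms of w
  (fst z) and snd z as majorant.\<close>

lemma optimal_plan_orthogonal_le:
  fixes \<pi> :: "('a::euclidean_space \<times> 'a) measure"
  assumes opt: "\<pi> \<in> optimal_plans \<rho> \<gamma>" and \<rho>: "\<rho> \<in> P2" and \<gamma>: "\<gamma> \<in> P2"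
    and w: "w \<in> L2 \<rho>" and orth: "\<And>g. g \<in> C11_gradients \<Longrightarrow> L2_inner \<rho> w g = 0"
  shows "L2_inner \<pi> (\<lambda>z. w (fst z)) snd \<le> 0"
proof -
  have c: "\<pi> \<in> couplings \<rho> \<gamma>" using opt by (simp add: optimal_plans_def)
  interpret \<pi>: prob_space \<pi> by (rule coupling_prob_space[OF c \<rho>])
  interpret \<rho>: prob_space \<rho> by (rule P2_prob_space[OF \<rho>])
  note [measurable] = coupling_measurable[OF c]
  note \<rho>m = P2_measurable_iff[OF \<rho>]
  have wb[measurable]: "w \<in> borel_measurable borel" using L2_measurable[OF w] by (simp add: \<rho>m)
  have wi: "integrable \<rho> w" by (rule \<rho>.L2_integrable[OF w])
  let ?a = "truncated_pairing"
  have am: "?a R u \<in> borel_measurable \<pi>" if [measurable]: "u \<in> borel_measurable borel" for R u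
    unfolding truncated_pairing_def by measurable
  have fsti: "integrable \<pi> (\<lambda>z. u (fst z))" "(LINT z|\<pi>. u (fst z)) = (LINT x|\<rho>. u x)"
    if "integrable \<rho> u" for u :: "'a \<Rightarrow> real"
  proof -
    have "u \<in> borel_measurable borel" using that by (auto simp: \<rho>m[symmetric])
    then show "integrable \<pi> (\<lambda>z. u (fst z))" "(LINT z|\<pi>. u (fst z)) = (LINT x|\<rho>. u x)"
      using integrable_distr_eq[OF coupling_measurable(1)[OF c], of u] that
        integral_distr[OF coupling_measurable(1)[OF c], of u]
      by (simp_all add: coupling_distr[OF c])
  qed
  have ai: "integrable \<pi> (?a R u)" if "0 \<le> R" "integrable \<rho> u" for R u
  proof (rule Bochner_Integration.integrable_bound)
    show "integrable \<pi> (\<lambda>z. R * norm (u (fst z)))"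
      using fsti(1)[of "\<lambda>x. R * norm (u x)"] that by simp
    have "u \<in> borel_measurable borel" using that by (auto simp: \<rho>m[symmetric])
    then show "?a R u \<in> borel_measurable \<pi>" by (rule am)
    show "AE z in \<pi>. norm (?a R u z) \<le> norm (R * norm (u (fst z)))"
      using truncated_pairing_bound[OF that(1)] that(1) by (auto intro!: AE_I2)
  qed
  have trunc: "(LINT z|\<pi>. ?a R w z) \<le> 0" if R: "0 \<le> R" for R
  proof (rule field_le_epsilon)
    fix e :: real assume e: "0 < e"
    \<comment> \<open>There are DIM('a) coordinates and two errors, each R times the L1 distance; R
      + 1 in place of R covers R = 0.\<close>
    define \<epsilon> where "\<epsilon> = e / (2 * (R + 1) * DIM('a))"
    have \<epsilon>: "\<epsilon> > 0" using e R by (simp add: \<epsilon>_def)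
    have "\<exists>k\<in>bounded_C11. (LINT x|\<rho>. \<bar>w x \<bullet> b - k x\<bar>) < \<epsilon>" for b
    proof -
      have "integrable \<rho> (\<lambda>x. w x \<bullet> b)" using wi by simp
      from integrable_L1_approximable[OF _ P2_sets[OF \<rho>] this]
      show ?thesis using \<epsilon> \<rho>.finite_measure_axioms by (simp add: L1_approximable_def)
    qed
    then obtain k where k: "\<And>b. k b \<in> bounded_C11" and kw: "\<And>b. (LINT x|\<rho>. \<bar>w x \<bullet> b - k b x\<bar>) < \<epsilon>"
      by metis
    define v where "v x = (\<Sum>b\<in>Basis. k b x *\<^sub>R b)" for x
    have ki: "integrable \<rho> (k b)" for b
      by (rule bounded_C11_integrable[OF k \<rho>.finite_measure_axioms P2_sets[OF \<rho>]])
    have vi: "integrable \<rho> v" unfolding v_def[abs_def] using ki by simp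
    have "(LINT x|\<rho>. norm (v x - w x)) \<le> (LINT x|\<rho>. (\<Sum>b\<in>Basis. \<bar>w x \<bullet> b - k b x\<bar>))"
    proof (rule integral_mono)
      fix x
      have "norm (v x - w x) \<le> (\<Sum>b\<in>Basis. \<bar>(v x - w x) \<bullet> b\<bar>)" by (rule norm_le_l1)
      also have "\<dots> = (\<Sum>b\<in>Basis. \<bar>w x \<bullet> b - k b x\<bar>)"
        by (rule sum.cong) (simp_all add: v_def inner_diff_left abs_minus_commute)
      finally show "norm (v x - w x) \<le> (\<Sum>b\<in>Basis. \<bar>w x \<bullet> b - k b x\<bar>)" .
    qed (use vi wi ki in auto)
    also have "\<dots> = (\<Sum>b\<in>Basis. (LINT x|\<rho>. \<bar>w x \<bullet> b - k b x\<bar>))"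
      using wi ki by (intro Bochner_Integration.integral_sum) auto
    also have "\<dots> \<le> (\<Sum>b\<in>(Basis::'a set). \<epsilon>)"
      by (intro sum_mono less_imp_le kw)
    finally have vw: "(LINT x|\<rho>. norm (v x - w x)) \<le> DIM('a) * \<epsilon>" by simp
    have "(LINT z|\<pi>. ?a R v z) \<le> R * (LINT x|\<rho>. norm (v x - w x))"
      unfolding v_def[abs_def]
      by (rule optimal_plan_test_field[OF opt \<rho> \<gamma> w orth k R])
    moreover have "(LINT z|\<pi>. ?a R w z) - (LINT z|\<pi>. ?a R v z) \<le> R * (LINT x|\<rho>. norm (v x - w x))"
    proof -
      have nvw: "integrable \<rho> (\<lambda>x. R * norm (v x - w x))" using vi wi by simp
      have "(LINT z|\<pi>. ?a R w z) - (LINT z|\<pi>. ?a R v z) = (LINT z|\<pi>. ?a R w z - ?a R v z)"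
        using ai[OF R vi] ai[OF R wi] by simp
      also have "\<dots> \<le> (LINT z|\<pi>. R * norm (v (fst z) - w (fst z)))"
      proof (rule integral_mono)
        show "integrable \<pi> (\<lambda>z. R * norm (v (fst z) - w (fst z)))"
          using fsti(1)[OF nvw] .
        fix z
        show "?a R w z - ?a R v z \<le> R * norm (v (fst z) - w (fst z))"
        proof (cases "norm (snd z) \<le> R")
          case True
          have "snd z \<bullet> (w (fst z) - v (fst z)) \<le> norm (snd z) * norm (w (fst z) - v (fst z))"
            by (rule norm_cauchy_schwarz)
          also have "\<dots> \<le> R * norm (w (fst z) - v (fst z))" by (intro mult_right_mono True) simp
          finally show ?thesis using True by (simp add: truncated_pairing_def inner_diff_right norm_minus_commute)
        next
          case False
          have "R * norm (v (fst z)) \<le> R * (norm (w (fst z)) + norm (v (fst z) - w (fst z)))"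
            using R norm_triangle_sub by (intro mult_left_mono) auto
          then show ?thesis using False by (simp add: truncated_pairing_def distrib_left)
        qed
      qed (use ai[OF R vi] ai[OF R wi] in simp)
      also have "\<dots> = R * (LINT x|\<rho>. norm (v x - w x))"
        using fsti(2)[OF nvw] by simp
      finally show ?thesis .
    qed
    ultimately have "(LINT z|\<pi>. ?a R w z) \<le> 2 * (R * (LINT x|\<rho>. norm (v x - w x)))" by simp
    also have "\<dots> \<le> 2 * (R * (DIM('a) * \<epsilon>))"
      using vw R by (intro mult_left_mono) auto
    also have "DIM('a) * \<epsilon> = e / (2 * (R + 1))" by (simp add: \<epsilon>_def)
    also have "2 * (R * (e / (2 * (R + 1)))) = e * (R / (R + 1))"
    proof -
      have "2 * (R * (e / (2 * r))) = e * (R / r)" if "r > 0" for r :: real using that by simp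
      from this[of "R + 1"] show ?thesis using R by (simp only: add_nonneg_pos zero_less_one)
    qed
    also have "\<dots> \<le> e * 1" using e R by (intro mult_left_mono) auto
    finally show "(LINT z|\<pi>. ?a R w z) \<le> 0 + e" by simp
  qed
  have sndL: "snd \<in> L2 \<pi>" using coupling_L2_snd[OF c P2_ident_L2[OF \<gamma>] \<gamma>] by simp
  have wL: "(\<lambda>z. w (fst z)) \<in> L2 \<pi>" by (rule coupling_L2_fst[OF c w \<rho>])
  have "(\<lambda>n. LINT z|\<pi>. ?a (real n) w z) \<longlonglongrightarrow> (LINT z|\<pi>. w (fst z) \<bullet> snd z)"
  proof (rule integral_dominated_convergence)
    have "(\<lambda>z. norm (w (fst z))) \<in> L2 \<pi>" "(\<lambda>z. norm (snd z)) \<in> L2 \<pi>"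
      using wL sndL by (auto simp: L2_def)
    from L2_integrable_inner[OF this]
    show "integrable \<pi> (\<lambda>z. norm (w (fst z)) * norm (snd z))" by simp
    show "(\<lambda>z. w (fst z) \<bullet> snd z) \<in> borel_measurable \<pi>" by measurable
    show "?a (real n) w \<in> borel_measurable \<pi>" for n by (rule am) measurable
    show "AE z in \<pi>. (\<lambda>n. ?a (real n) w z) \<longlonglongrightarrow> w (fst z) \<bullet> snd z"
    proof (rule AE_I2)
      fix z
      have "\<forall>\<^sub>F n in sequentially. ?a (real n) w z = w (fst z) \<bullet> snd z"
      proof (rule eventually_sequentiallyI)
        fix n assume "nat \<lceil>norm (snd z)\<rceil> \<le> n"
        then have "norm (snd z) \<le> real n" by linarith
        then show "?a (real n) w z = w (fst z) \<bullet> snd z" by (simp add: truncated_pairing_def inner_commute)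
      qed
      then show "(\<lambda>n. ?a (real n) w z) \<longlonglongrightarrow> w (fst z) \<bullet> snd z" by (rule tendsto_eventually)
    qed
    show "AE z in \<pi>. norm (?a (real n) w z) \<le> norm (w (fst z)) * norm (snd z)" for n
    proof (rule AE_I2)
      fix z
      show "norm (?a (real n) w z) \<le> norm (w (fst z)) * norm (snd z)"
      proof (cases "norm (snd z) \<le> real n")
        case True
        then show ?thesis
          using Cauchy_Schwarz_ineq2[of "snd z" "w (fst z)"] by (simp add: truncated_pairing_def mult.commute)
      next
        case False
        then have "real n * norm (w (fst z)) \<le> norm (snd z) * norm (w (fst z))"
          by (intro mult_right_mono) auto
        then show ?thesis using False by (simp add: truncated_pairing_def mult.commute)
      qed
    qed
  qed
  then have "(LINT z|\<pi>. w (fst z) \<bullet> snd z) \<le> 0"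
    by (rule LIMSEQ_le_const2) (use trunc in auto)
  then show ?thesis by (simp add: L2_inner_def)
qed

text \<open>
  The displacement of an optimal plan is tangent to Wasserstein space, even when \<open>\<rho>\<close> is singular
  and the plan is not induced by a map.
\<close>

lemma optimal_plan_displacement_orthogonal:
  fixes \<pi> :: "('a::euclidean_space \<times> 'a) measure"
  assumes opt: "\<pi> \<in> optimal_plans \<rho> \<gamma>" and \<rho>: "\<rho> \<in> P2" and \<gamma>: "\<gamma> \<in> P2"
    and w: "w \<in> L2 \<rho>" and orth: "\<And>g. g \<in> C11_gradients \<Longrightarrow> L2_inner \<rho> w g = 0"
  shows "L2_inner \<pi> (\<lambda>z. w (fst z)) (\<lambda>z. snd z - fst z) = 0"
proof -
  have c: "\<pi> \<in> couplings \<rho> \<gamma>" using opt by (simp add: optimal_plans_def)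
  have wb: "w \<in> borel_measurable borel"
    using L2_measurable[OF w] by (simp add: P2_measurable_iff[OF \<rho>])
  have le: "L2_inner \<pi> (\<lambda>z. w (fst z)) snd \<le> 0"
    by (rule optimal_plan_orthogonal_le[OF opt \<rho> \<gamma> w orth])
  have "L2_inner \<pi> (\<lambda>z. - w (fst z)) snd \<le> 0"
    by (rule optimal_plan_orthogonal_le[OF opt \<rho> \<gamma> L2_uminus[OF w]]) (simp add: L2_inner_uminus_left orth)
  then have "L2_inner \<pi> (\<lambda>z. w (fst z)) snd = 0"
    using le by (simp add: L2_inner_uminus_left)
  moreover have "L2_inner \<pi> (\<lambda>z. w (fst z)) fst = L2_inner \<rho> w (\<lambda>x. x)"
    using L2_inner_distr[OF coupling_measurable(1)[OF c] wb, of "\<lambda>x. x"] by (simp add: coupling_distr[OF c])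
  \<comment> \<open>The identity is the gradient of half the squared norm, so passing from snd to
    the displacement changes nothing.\<close>
  moreover have "\<dots> = 0" by (rule orth[OF C11_gradients_ident])
  ultimately show ?thesis
    using coupling_L2_fst[OF c w \<rho>] coupling_L2_fst[OF c P2_ident_L2[OF \<rho>] \<rho>] coupling_L2_snd[OF c P2_ident_L2[OF \<gamma>] \<gamma>]
    by (simp add: L2_inner_diff_right)
qed

section \<open>Wasserstein differentials and the lifted functional\<close>

text \<open>The L2-closure of gradients, in the role of the tangent space of Wasserstein space at
  \<open>\<rho>\<close>.\<close>

definition tangent_field :: "'a::euclidean_space measure \<Rightarrow> ('a \<Rightarrow> 'a) \<Rightarrow> bool" where
  "tangent_field \<rho> \<eta> \<longleftrightarrow> \<eta> \<in> L2 \<rho> \<and> (\<forall>e>0. \<exists>g\<in>C11_gradients. L2_norm \<rho> (\<lambda>x. \<eta> x - g x) < e)"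

abbreviation displacement :: "'a \<times> 'a \<Rightarrow> 'a::euclidean_space" where
  "displacement \<equiv> \<lambda>z. snd z - fst z"

abbreviation plan_norm :: "('a::euclidean_space \<times> 'a) measure \<Rightarrow> real" where
  "plan_norm \<pi> \<equiv> L2_norm \<pi> displacement"

abbreviation pairing :: "('a::euclidean_space \<times> 'a) measure \<Rightarrow> ('a \<Rightarrow> 'a) \<Rightarrow> real" where
  "pairing \<pi> \<xi> \<equiv> L2_inner \<pi> (\<lambda>z. \<xi> (fst z)) displacement"

section \<open>Comparison of couplings with the same marginals\<close>

lemma C11_gradient_coupling:
  fixes g :: "'a::euclidean_space \<Rightarrow> 'a"
  assumes \<psi>: "\<And>x y. \<bar>\<psi> y - \<psi> x - g x \<bullet> (y - x)\<bar> \<le> C * (norm (y - x))\<^sup>2"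
    and \<rho>: "\<rho> \<in> P2" and \<gamma>: "\<gamma> \<in> P2" and \<sigma>: "\<sigma> \<in> couplings \<rho> \<gamma>"
  shows "\<bar>pairing \<sigma> g - ((LINT x|\<gamma>. \<psi> x) - (LINT x|\<rho>. \<psi> x))\<bar>
      \<le> C * (plan_norm \<sigma>)\<^sup>2"
proof -
  interpret \<sigma>: prob_space \<sigma> by (rule coupling_prob_space[OF \<sigma> \<rho>])
  have gC: "g \<in> C11_gradients" by (rule C11_gradientsI[OF \<psi>])
  have "isCont \<psi> x" for x
  proof -
    have "((\<lambda>y. \<psi> y - \<psi> x - g x \<bullet> (y - x)) \<longlongrightarrow> 0) (at x)"
    proof (rule Lim_null_comparison)
      show "\<forall>\<^sub>F y in at x. norm (\<psi> y - \<psi> x - g x \<bullet> (y - x)) \<le> C * (norm (y - x))\<^sup>2"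
        using \<psi> by (intro always_eventually) auto
      have "((\<lambda>y. C * (norm (y - x))\<^sup>2) \<longlongrightarrow> C * (norm (x - x))\<^sup>2) (at x)" by (intro tendsto_intros)
      then show "((\<lambda>y. C * (norm (y - x))\<^sup>2) \<longlongrightarrow> 0) (at x)" by simp
    qed
    moreover have "((\<lambda>y. \<psi> x + g x \<bullet> (y - x)) \<longlongrightarrow> \<psi> x + g x \<bullet> (x - x)) (at x)"
      by (intro tendsto_intros)
    ultimately have "((\<lambda>y. (\<psi> y - \<psi> x - g x \<bullet> (y - x)) + (\<psi> x + g x \<bullet> (y - x))) \<longlongrightarrow> 0 + (\<psi> x + g x \<bullet> (x - x))) (at x)"
      by (rule tendsto_add)
    then show ?thesis by (simp add: isCont_def)
  qed
  then have \<psi>b: "\<psi> \<in> borel_measurable borel"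
    by (intro borel_measurable_continuous_onI) (simp add: continuous_at_imp_continuous_on)
  have \<psi>i: "integrable M \<psi>" if M: "M \<in> P2" for M
  proof (rule Bochner_Integration.integrable_bound)
    interpret M: prob_space M by (rule P2_prob_space[OF M])
    show "integrable M (\<lambda>x. \<bar>\<psi> 0\<bar> + norm (g 0) * norm x + C * (norm x)\<^sup>2)"
      using M M.L2_integrable[OF P2_ident_L2[OF M]] by (simp add: P2_def)
    show "\<psi> \<in> borel_measurable M"
      using \<psi>b by (simp add: P2_measurable_iff[OF M])
    show "AE x in M. norm (\<psi> x) \<le> norm (\<bar>\<psi> 0\<bar> + norm (g 0) * norm x + C * (norm x)\<^sup>2)"
    proof (rule AE_I2)
      fix x
      show "norm (\<psi> x) \<le> norm (\<bar>\<psi> 0\<bar> + norm (g 0) * norm x + C * (norm x)\<^sup>2)"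
        using \<psi>[of x 0] Cauchy_Schwarz_ineq2[of "g 0" x] by simp
    qed
  qed
  have f: "integrable \<sigma> (\<lambda>z. \<psi> (fst z))" "(LINT z|\<sigma>. \<psi> (fst z)) = (LINT x|\<rho>. \<psi> x)"
    using integrable_distr_eq[OF coupling_measurable(1)[OF \<sigma>] \<psi>b] integral_distr[OF coupling_measurable(1)[OF \<sigma>] \<psi>b]
      \<psi>i[OF \<rho>] by (simp_all add: coupling_distr[OF \<sigma>])
  have s: "integrable \<sigma> (\<lambda>z. \<psi> (snd z))" "(LINT z|\<sigma>. \<psi> (snd z)) = (LINT x|\<gamma>. \<psi> x)"
    using integrable_distr_eq[OF coupling_measurable(2)[OF \<sigma>] \<psi>b] integral_distr[OF coupling_measurable(2)[OF \<sigma>] \<psi>b]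
      \<psi>i[OF \<gamma>] by (simp_all add: coupling_distr[OF \<sigma>])
  note dL = coupling_displacement_L2[OF \<sigma> \<rho> \<gamma>]
  have i: "integrable \<sigma> (\<lambda>z. g (fst z) \<bullet> (snd z - fst z))"
    by (rule L2_integrable_inner[OF coupling_L2_fst[OF \<sigma> C11_gradient_L2[OF gC \<rho>] \<rho>] dL])
  have "pairing \<sigma> g - ((LINT x|\<gamma>. \<psi> x) - (LINT x|\<rho>. \<psi> x))
      = (LINT z|\<sigma>. g (fst z) \<bullet> (snd z - fst z) - (\<psi> (snd z) - \<psi> (fst z)))"
    using f s i by (simp add: L2_inner_def)
  also have "\<bar>\<dots>\<bar> \<le> (LINT z|\<sigma>. \<bar>g (fst z) \<bullet> (snd z - fst z) - (\<psi> (snd z) - \<psi> (fst z))\<bar>)"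
    by (rule integral_abs_bound)
  also have "\<dots> \<le> (LINT z|\<sigma>. C * (norm (snd z - fst z))\<^sup>2)"
  proof (rule integral_mono)
    fix z
    show "\<bar>g (fst z) \<bullet> (snd z - fst z) - (\<psi> (snd z) - \<psi> (fst z))\<bar> \<le> C * (norm (snd z - fst z))\<^sup>2"
      using \<psi>[of "snd z" "fst z"] by (simp add: abs_minus_commute)
  qed (use f s i dL in \<open>auto simp: L2_def\<close>)
  also have "\<dots> = C * (plan_norm \<sigma>)\<^sup>2"
    by (simp add: L2_norm_def)
  finally show ?thesis .
qed

text \<open>
  Pairing a tangent field with the displacement of a coupling depends, to first order, on the
  marginals only.
\<close>

lemma tangent_field_couplings:
  fixes \<rho> :: "'a::euclidean_space measure"
  assumes \<eta>: "tangent_field \<rho> \<eta>" and \<rho>: "\<rho> \<in> P2" and e: "0 < e"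
  obtains C where "0 \<le> C" "\<And>\<gamma> \<sigma> \<tau>. \<gamma> \<in> P2 \<Longrightarrow> \<sigma> \<in> couplings \<rho> \<gamma> \<Longrightarrow> \<tau> \<in> couplings \<rho> \<gamma> \<Longrightarrow>
    plan_norm \<tau> \<le> plan_norm \<sigma> \<Longrightarrow>
    \<bar>pairing \<sigma> \<eta> - pairing \<tau> \<eta>\<bar>
      \<le> e * plan_norm \<sigma> + C * (plan_norm \<sigma>)\<^sup>2"
proof -
  have "0 < e / 2" using e by simp
  then obtain g where g: "g \<in> C11_gradients" "L2_norm \<rho> (\<lambda>x. \<eta> x - g x) < e / 2"
    using \<eta> unfolding tangent_field_def by blast
  obtain \<psi> C where \<psi>: "\<And>x y. \<bar>\<psi> y - \<psi> x - g x \<bullet> (y - x)\<bar> \<le> C * (norm (y - x))\<^sup>2"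
    using g by (auto simp: C11_gradients_def)
  have \<eta>L: "\<eta> \<in> L2 \<rho>" using \<eta> by (simp add: tangent_field_def)
  note gL = C11_gradient_L2[OF g(1) \<rho>]
  have diff: "\<bar>pairing \<sigma> \<eta> - pairing \<sigma> g\<bar> \<le> e / 2 * plan_norm \<sigma>"
    if \<gamma>: "\<gamma> \<in> P2" and \<sigma>: "\<sigma> \<in> couplings \<rho> \<gamma>" for \<gamma> \<sigma>
  proof -
    note dL = coupling_displacement_L2[OF \<sigma> \<rho> \<gamma>]
    have d: "(\<lambda>x. \<eta> x - g x) \<in> L2 \<rho>" by (rule L2_diff[OF \<eta>L gL])
    have db: "(\<lambda>x. \<eta> x - g x) \<in> borel_measurable borel"
      using L2_measurable[OF d] by (simp add: P2_measurable_iff[OF \<rho>])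
    have "pairing \<sigma> \<eta> - pairing \<sigma> g
        = L2_inner \<sigma> (\<lambda>z. \<eta> (fst z) - g (fst z)) displacement"
      by (rule L2_inner_diff_left[symmetric, OF coupling_L2_fst[OF \<sigma> \<eta>L \<rho>] coupling_L2_fst[OF \<sigma> gL \<rho>] dL])
    also have "\<bar>\<dots>\<bar> \<le> L2_norm \<sigma> (\<lambda>z. \<eta> (fst z) - g (fst z)) * plan_norm \<sigma>"
      by (rule L2_Cauchy_Schwarz[OF coupling_L2_fst[OF \<sigma> d \<rho>] dL])
    also have "L2_norm \<sigma> (\<lambda>z. \<eta> (fst z) - g (fst z)) = L2_norm \<rho> (\<lambda>x. \<eta> x - g x)"
      using L2_norm_distr[OF coupling_measurable(1)[OF \<sigma>] db] by (simp add: coupling_distr[OF \<sigma>])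
    also have "\<dots> * plan_norm \<sigma> \<le> e / 2 * plan_norm \<sigma>"
      using g(2) by (intro mult_right_mono) auto
    finally show ?thesis .
  qed
  show ?thesis
  \<comment> \<open>One quadratic remainder for \<open>\<sigma>\<close> and one for
    \<open>\<tau>\<close>, whose norm is not larger. The constant depends on e through the
    approximating gradient g.\<close>
  proof (rule that[of "2 * \<bar>C\<bar>"])
    fix \<gamma> \<sigma> \<tau>
    assume \<gamma>: "\<gamma> \<in> P2" and \<sigma>: "\<sigma> \<in> couplings \<rho> \<gamma>" and \<tau>: "\<tau> \<in> couplings \<rho> \<gamma>"
      and le: "plan_norm \<tau> \<le> plan_norm \<sigma>"
    define a b where "a = plan_norm \<sigma>" and "b = plan_norm \<tau>"
    have "\<bar>pairing \<sigma> g - pairing \<tau> g\<bar> \<le> C * a\<^sup>2 + C * b\<^sup>2"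
      using C11_gradient_coupling[OF \<psi> \<rho> \<gamma> \<sigma>] C11_gradient_coupling[OF \<psi> \<rho> \<gamma> \<tau>] by (simp add: a_def b_def)
    moreover have "b\<^sup>2 \<le> a\<^sup>2" using le by (intro power_mono) (auto simp: a_def b_def)
    then have "C * a\<^sup>2 \<le> \<bar>C\<bar> * a\<^sup>2" "C * b\<^sup>2 \<le> \<bar>C\<bar> * a\<^sup>2"
      by (auto intro!: mult_right_mono mult_mono)
    moreover have "e / 2 * b \<le> e / 2 * a" using le e by (simp add: a_def b_def)
    ultimately show "\<bar>pairing \<sigma> \<eta> - pairing \<tau> \<eta>\<bar>
      \<le> e * plan_norm \<sigma> + 2 * \<bar>C\<bar> * (plan_norm \<sigma>)\<^sup>2"
      using diff[OF \<gamma> \<sigma>] diff[OF \<gamma> \<tau>] unfolding a_def[symmetric] b_def[symmetric] by linarith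
  qed simp
qed

lemma W2_le_coupling:
  assumes "\<sigma> \<in> couplings \<rho> \<gamma>"
  shows "W2 \<rho> \<gamma> \<le> plan_norm \<sigma>"
proof -
  have "(INF \<pi>\<in>couplings \<rho> \<gamma>. transport_cost \<pi>) \<le> transport_cost \<sigma>"
    by (rule cINF_lower[OF _ assms]) (auto simp: transport_cost_L2_norm intro!: bdd_belowI[of _ 0])
  moreover have "sqrt (transport_cost \<sigma>) = plan_norm \<sigma>"
    by (simp add: transport_cost_L2_norm)
  ultimately show ?thesis
    unfolding W2_def using real_sqrt_le_mono by metis
qed

lemma optimal_plan_norm_le:
  assumes "\<pi> \<in> optimal_plans \<rho> \<gamma>" "\<sigma> \<in> couplings \<rho> \<gamma>"
  shows "plan_norm \<pi> \<le> plan_norm \<sigma>"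
proof -
  have "(plan_norm \<pi>)\<^sup>2 \<le> (plan_norm \<sigma>)\<^sup>2"
    using assms by (simp add: optimal_plans_def transport_cost_L2_norm)
  then show ?thesis by (rule power2_le_imp_le) simp
qed

lemma subdifferential_pairing:
  "(LINT (x, y)|\<pi>. \<xi> x \<bullet> (y - x)) = pairing \<pi> \<xi>"
  by (simp add: L2_inner_def case_prod_unfold)

text \<open>An optimal plan is no longer than \<open>\<sigma>\<close>, so its pairing with a tangent
  field differs from that of \<open>\<sigma>\<close> by a small multiple of the norm of
  \<open>\<sigma>\<close>; the lower bound known for optimal plans is inherited by
  \<open>\<sigma>\<close>.\<close>

lemma tangent_subdifferential_all_couplings:
  fixes D :: "'a::euclidean_space measure \<Rightarrow> real"
  assumes \<xi>: "\<xi> \<in> wasserstein_subdifferential D \<rho>" and tan: "tangent_field \<rho> \<xi>" and \<rho>: "\<rho> \<in> P2"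
    and e: "0 < e"
  obtains \<delta> where "0 < \<delta>" "\<And>\<gamma> \<sigma>. \<gamma> \<in> P2 \<Longrightarrow> \<sigma> \<in> couplings \<rho> \<gamma> \<Longrightarrow> plan_norm \<sigma> < \<delta> \<Longrightarrow>
    pairing \<sigma> \<xi> - e * plan_norm \<sigma> \<le> D \<gamma> - D \<rho>"
proof -
  obtain C where C: "0 \<le> C" and cpl: "\<And>\<gamma> \<sigma> \<tau>. \<gamma> \<in> P2 \<Longrightarrow> \<sigma> \<in> couplings \<rho> \<gamma> \<Longrightarrow> \<tau> \<in> couplings \<rho> \<gamma> \<Longrightarrow>
    plan_norm \<tau> \<le> plan_norm \<sigma> \<Longrightarrow>
    \<bar>pairing \<sigma> \<xi> - pairing \<tau> \<xi>\<bar>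
      \<le> e / 3 * plan_norm \<sigma> + C * (plan_norm \<sigma>)\<^sup>2"
    by (rule tangent_field_couplings[OF tan \<rho>, of "e / 3"]) (use e in auto)
  have "e / 3 > 0" using e by simp
  then obtain \<delta>0 where \<delta>0: "0 < \<delta>0" and sub: "\<And>\<gamma>. \<gamma> \<in> P2 \<Longrightarrow> W2 \<rho> \<gamma> < \<delta>0 \<Longrightarrow>
        (INF \<pi>\<in>optimal_plans \<rho> \<gamma>. ereal (LINT (x, y)|\<pi>. \<xi> x \<bullet> (y - x))) - ereal (e / 3 * W2 \<rho> \<gamma>) \<le> ereal (D \<gamma> - D \<rho>)"
    using \<xi> unfolding wasserstein_subdifferential_def by blast
  \<comment> \<open>Three errors of e / 3: the approximation of \<xi> by a gradient, the quadratic
    remainder, made linear by C n \<le> e / 3, and the remainder of the subdifferential, where W2 is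
    at most the plan norm.\<close>
  define \<delta> where "\<delta> = min \<delta>0 (e / 3 / (C + 1))"
  show ?thesis
  proof (rule that[of \<delta>])
    show "0 < \<delta>" using \<delta>0 e C by (simp add: \<delta>_def)
    fix \<gamma> \<sigma> assume \<gamma>: "\<gamma> \<in> P2" and \<sigma>: "\<sigma> \<in> couplings \<rho> \<gamma>" and small: "plan_norm \<sigma> < \<delta>"
    define n where "n = plan_norm \<sigma>"
    have W: "W2 \<rho> \<gamma> \<le> n" using W2_le_coupling[OF \<sigma>] by (simp add: n_def)
    have n0: "0 \<le> n" by (simp add: n_def)
    have "n \<le> e / 3 / (C + 1)" using small by (simp add: \<delta>_def n_def)
    then have "(C + 1) * n \<le> e / 3" using C pos_le_divide_eq[of "C + 1" n "e / 3"] by (simp only: mult.commute)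
    then have "C * n \<le> e / 3" using n0 by (simp add: distrib_right)
    then have Cn: "C * n\<^sup>2 \<le> e / 3 * n"
      using mult_right_mono[OF _ n0, of "C * n" "e / 3"] by (simp add: power2_eq_square mult.assoc)
    define r where "r = pairing \<sigma> \<xi> - 2 * (e / 3) * n"
    have "ereal r \<le> (INF \<pi>\<in>optimal_plans \<rho> \<gamma>. ereal (LINT (x, y)|\<pi>. \<xi> x \<bullet> (y - x)))"
    proof (rule INF_greatest)
      fix \<pi> assume \<pi>: "\<pi> \<in> optimal_plans \<rho> \<gamma>"
      then have "\<pi> \<in> couplings \<rho> \<gamma>" by (simp add: optimal_plans_def)
      from cpl[OF \<gamma> \<sigma> this optimal_plan_norm_le[OF \<pi> \<sigma>]] Cn
      show "ereal r \<le> ereal (LINT (x, y)|\<pi>. \<xi> x \<bullet> (y - x))"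
        unfolding subdifferential_pairing r_def n_def[symmetric] by simp
    qed
    then have "ereal r - ereal (e / 3 * W2 \<rho> \<gamma>) \<le> (INF \<pi>\<in>optimal_plans \<rho> \<gamma>. ereal (LINT (x, y)|\<pi>. \<xi> x \<bullet> (y - x))) - ereal (e / 3 * W2 \<rho> \<gamma>)"
      by (intro ereal_minus_mono) auto
    also have "\<dots> \<le> ereal (D \<gamma> - D \<rho>)"
      using W small by (intro sub \<gamma>) (simp add: \<delta>_def n_def)
    finally have "r - e / 3 * W2 \<rho> \<gamma> \<le> D \<gamma> - D \<rho>" by simp
    moreover have "e / 3 * W2 \<rho> \<gamma> \<le> e / 3 * n" using W e by (intro mult_left_mono) auto
    ultimately show "pairing \<sigma> \<xi> - e * plan_norm \<sigma> \<le> D \<gamma> - D \<rho>"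
      unfolding r_def n_def[symmetric] by (simp add: field_simps)
  qed
qed

lemma superdifferential_iff:
  "\<xi> \<in> wasserstein_superdifferential D \<rho> \<longleftrightarrow> (\<lambda>x. - \<xi> x) \<in> wasserstein_subdifferential (\<lambda>\<gamma>. - D \<gamma>) \<rho>"
proof
  assume "(\<lambda>x. - \<xi> x) \<in> wasserstein_subdifferential (\<lambda>\<gamma>. - D \<gamma>) \<rho>"
  then show "\<xi> \<in> wasserstein_superdifferential D \<rho>"
    unfolding wasserstein_superdifferential_def by (rule image_eqI[rotated]) simp
qed (auto simp: wasserstein_superdifferential_def)

lemma tangent_field_uminus: "tangent_field \<rho> \<xi> \<Longrightarrow> tangent_field \<rho> (\<lambda>x. - \<xi> x)"
  unfolding tangent_field_def
proof (intro conjI allI impI)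
  fix e :: real
  assume *: "\<xi> \<in> L2 \<rho> \<and> (\<forall>e>0. \<exists>g\<in>C11_gradients. L2_norm \<rho> (\<lambda>x. \<xi> x - g x) < e)" and "0 < e"
  then obtain g where g: "g \<in> C11_gradients" "L2_norm \<rho> (\<lambda>x. \<xi> x - g x) < e" by blast
  have "L2_norm \<rho> (\<lambda>x. - \<xi> x - (-1) *\<^sub>R g x) = L2_norm \<rho> (\<lambda>x. \<xi> x - g x)"
    using L2_norm_uminus[of \<rho> "\<lambda>x. \<xi> x - g x"] by simp
  then show "\<exists>g\<in>C11_gradients. L2_norm \<rho> (\<lambda>x. - \<xi> x - g x) < e"
    using g C11_gradients_scaleR[OF g(1), of "-1"] by (intro bexI[of _ "\<lambda>x. (-1) *\<^sub>R g x"]) simp_all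
qed (simp add: L2_uminus)

text \<open>A strong form of differentiability. Couplings that are not optimal must be included,
  because a change of map from f to g moves the measure along the law of (f, g).\<close>

definition expands_along_couplings :: "('a::euclidean_space measure \<Rightarrow> real) \<Rightarrow> 'a measure \<Rightarrow> ('a \<Rightarrow> 'a) \<Rightarrow> bool" where
  "expands_along_couplings D \<rho> \<xi> \<longleftrightarrow> (\<forall>e>0. \<exists>\<delta>>0. \<forall>\<gamma>\<in>P2. \<forall>\<sigma>\<in>couplings \<rho> \<gamma>.
     plan_norm \<sigma> < \<delta> \<longrightarrow> \<bar>D \<gamma> - D \<rho> - pairing \<sigma> \<xi>\<bar> \<le> e * plan_norm \<sigma>)"

lemma tangent_differential_all_couplings:
  fixes D :: "'a::euclidean_space measure \<Rightarrow> real"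
  assumes \<xi>: "\<xi> \<in> wasserstein_differential D \<rho>" and tan: "tangent_field \<rho> \<xi>" and \<rho>: "\<rho> \<in> P2"
  shows "expands_along_couplings D \<rho> \<xi>"
  unfolding expands_along_couplings_def
proof (intro allI impI)
  fix e :: real assume e: "0 < e"
  have 1: "\<xi> \<in> wasserstein_subdifferential D \<rho>" and 2: "(\<lambda>x. - \<xi> x) \<in> wasserstein_subdifferential (\<lambda>\<gamma>. - D \<gamma>) \<rho>"
    using \<xi> by (simp_all add: wasserstein_differential_def superdifferential_iff)
  obtain \<delta>1 where \<delta>1: "0 < \<delta>1" "\<And>\<gamma> \<sigma>. \<gamma> \<in> P2 \<Longrightarrow> \<sigma> \<in> couplings \<rho> \<gamma> \<Longrightarrow> plan_norm \<sigma> < \<delta>1 \<Longrightarrow>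
    pairing \<sigma> \<xi> - e * plan_norm \<sigma> \<le> D \<gamma> - D \<rho>"
    by (rule tangent_subdifferential_all_couplings[OF 1 tan \<rho> e]) blast
  obtain \<delta>2 where \<delta>2: "0 < \<delta>2" "\<And>\<gamma> \<sigma>. \<gamma> \<in> P2 \<Longrightarrow> \<sigma> \<in> couplings \<rho> \<gamma> \<Longrightarrow> plan_norm \<sigma> < \<delta>2 \<Longrightarrow>
    L2_inner \<sigma> (\<lambda>z. - \<xi> (fst z)) displacement - e * plan_norm \<sigma> \<le> - D \<gamma> - - D \<rho>"
    by (rule tangent_subdifferential_all_couplings[OF 2 tangent_field_uminus[OF tan] \<rho> e]) blast
  show "\<exists>\<delta>>0. \<forall>\<gamma>\<in>P2. \<forall>\<sigma>\<in>couplings \<rho> \<gamma>. plan_norm \<sigma> < \<delta> \<longrightarrow> \<bar>D \<gamma> - D \<rho> - pairing \<sigma> \<xi>\<bar> \<le> e * plan_norm \<sigma>"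
  proof (intro exI[of _ "min \<delta>1 \<delta>2"] conjI ballI impI)
    fix \<gamma> \<sigma> assume *: "\<gamma> \<in> P2" "\<sigma> \<in> couplings \<rho> \<gamma>" "plan_norm \<sigma> < min \<delta>1 \<delta>2"
    show "\<bar>D \<gamma> - D \<rho> - pairing \<sigma> \<xi>\<bar> \<le> e * plan_norm \<sigma>"
      using \<delta>1(2)[OF *(1,2)] \<delta>2(2)[OF *(1,2)] *(3) unfolding L2_inner_uminus_left by simp
  qed (use \<delta>1 \<delta>2 in simp)
qed

text \<open>Optimal plans do not see the orthogonal part \<xi> - \<eta>, so both fields give the
  same infimum for every \<open>\<gamma>\<close>.\<close>

lemma subdifferential_orthogonal_shift:
  fixes D :: "'a::euclidean_space measure \<Rightarrow> real"
  assumes \<xi>: "\<xi> \<in> wasserstein_subdifferential D \<rho>" and \<eta>: "\<eta> \<in> L2 \<rho>" and \<rho>: "\<rho> \<in> P2"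
    and orth: "\<And>g. g \<in> C11_gradients \<Longrightarrow> L2_inner \<rho> (\<lambda>x. \<xi> x - \<eta> x) g = 0"
  shows "\<eta> \<in> wasserstein_subdifferential D \<rho>"
proof -
  have \<xi>L: "\<xi> \<in> L2 \<rho>" using \<xi> by (simp add: wasserstein_subdifferential_def)
  have "(LINT (x, y)|\<pi>. \<eta> x \<bullet> (y - x)) = (LINT (x, y)|\<pi>. \<xi> x \<bullet> (y - x))"
    if \<gamma>: "\<gamma> \<in> P2" and \<pi>: "\<pi> \<in> optimal_plans \<rho> \<gamma>" for \<gamma> \<pi>
  proof -
    have c: "\<pi> \<in> couplings \<rho> \<gamma>" using \<pi> by (simp add: optimal_plans_def)
    have "L2_inner \<pi> (\<lambda>z. \<xi> (fst z) - \<eta> (fst z)) displacement = 0"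
      by (rule optimal_plan_displacement_orthogonal[OF \<pi> \<rho> \<gamma> L2_diff[OF \<xi>L \<eta>] orth])
    then show ?thesis
      unfolding subdifferential_pairing
      using L2_inner_diff_left[OF coupling_L2_fst[OF c \<xi>L \<rho>] coupling_L2_fst[OF c \<eta> \<rho>] coupling_displacement_L2[OF c \<rho> \<gamma>]]
      by simp
  qed
  then have "(INF \<pi>\<in>optimal_plans \<rho> \<gamma>. ereal (LINT (x, y)|\<pi>. \<eta> x \<bullet> (y - x)))
      = (INF \<pi>\<in>optimal_plans \<rho> \<gamma>. ereal (LINT (x, y)|\<pi>. \<xi> x \<bullet> (y - x)))" if "\<gamma> \<in> P2" for \<gamma>
    using that by (intro INF_cong) auto
  then show ?thesis
    using \<xi> \<eta> unfolding wasserstein_subdifferential_def by simp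
qed

text \<open>Projecting onto the closure of the gradients removes a part that both one-sided
  differentials ignore. The Pythagorean identity is recorded because it forces an element of minimal
  norm to have no such part.\<close>

lemma tangent_projection:
  fixes D :: "'a::euclidean_space measure \<Rightarrow> real"
  assumes \<xi>: "\<xi> \<in> wasserstein_differential D \<rho>" and \<rho>: "\<rho> \<in> P2"
  obtains \<eta> where "\<eta> \<in> wasserstein_differential D \<rho>" "tangent_field \<rho> \<eta>"
    "(L2_norm \<rho> \<xi>)\<^sup>2 = (L2_norm \<rho> \<eta>)\<^sup>2 + (L2_norm \<rho> (\<lambda>x. \<xi> x - \<eta> x))\<^sup>2"
proof -
  interpret prob_space \<rho> by (rule P2_prob_space[OF \<rho>])
  have \<xi>L: "\<xi> \<in> L2 \<rho>"
    using \<xi> by (simp add: wasserstein_differential_def wasserstein_subdifferential_def)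
  obtain \<eta> where \<eta>: "\<eta> \<in> L2 \<rho>" and cl: "\<And>\<epsilon>. \<epsilon> > 0 \<Longrightarrow> \<exists>v\<in>C11_gradients. L2_norm \<rho> (\<lambda>x. \<eta> x - v x) < \<epsilon>"
    and orth: "\<And>v. v \<in> C11_gradients \<Longrightarrow> L2_inner \<rho> (\<lambda>x. \<xi> x - \<eta> x) v = 0"
    by (rule L2_projection[OF _ C11_gradients_zero C11_gradients_add C11_gradients_scaleR \<xi>L])
       (use C11_gradient_L2[OF _ \<rho>] in auto)
  have tan: "tangent_field \<rho> \<eta>" using \<eta> cl by (simp add: tangent_field_def)
  have w: "(\<lambda>x. \<xi> x - \<eta> x) \<in> L2 \<rho>" by (rule L2_diff[OF \<xi>L \<eta>])
  \<comment> \<open>Orthogonality is known against gradients and has to be extended to \<eta>, which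
    is only a limit of gradients.\<close>
  have "\<bar>L2_inner \<rho> (\<lambda>x. \<xi> x - \<eta> x) \<eta>\<bar> \<le> 0 + e" if "0 < e" for e
  proof -
    have "0 < e / (L2_norm \<rho> (\<lambda>x. \<xi> x - \<eta> x) + 1)" using that by (simp add: add_nonneg_pos)
    then obtain v where v: "v \<in> C11_gradients" "L2_norm \<rho> (\<lambda>x. \<eta> x - v x) < e / (L2_norm \<rho> (\<lambda>x. \<xi> x - \<eta> x) + 1)"
      using cl by blast
    have vL: "v \<in> L2 \<rho>" by (rule C11_gradient_L2[OF v(1) \<rho>])
    have "L2_inner \<rho> (\<lambda>x. \<xi> x - \<eta> x) \<eta> = L2_inner \<rho> (\<lambda>x. \<xi> x - \<eta> x) (\<lambda>x. \<eta> x - v x)"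
      by (simp add: L2_inner_diff_right[OF \<eta> vL w] orth[OF v(1)])
    also have "\<bar>\<dots>\<bar> \<le> L2_norm \<rho> (\<lambda>x. \<xi> x - \<eta> x) * L2_norm \<rho> (\<lambda>x. \<eta> x - v x)"
      by (rule L2_Cauchy_Schwarz[OF w L2_diff[OF \<eta> vL]])
    also have "\<dots> \<le> (L2_norm \<rho> (\<lambda>x. \<xi> x - \<eta> x) + 1) * (e / (L2_norm \<rho> (\<lambda>x. \<xi> x - \<eta> x) + 1))"
      using v(2) by (intro mult_mono) auto
    also have "\<dots> = e" by (simp add: add_nonneg_pos less_imp_neq[symmetric])
    finally show ?thesis by simp
  qed
  then have "\<bar>L2_inner \<rho> (\<lambda>x. \<xi> x - \<eta> x) \<eta>\<bar> \<le> 0" by (rule field_le_epsilon)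
  then have 0: "L2_inner \<rho> \<eta> (\<lambda>x. \<xi> x - \<eta> x) = 0" by (simp add: L2_inner_commute)
  have "\<eta> \<in> wasserstein_subdifferential D \<rho>"
    using \<xi> by (intro subdifferential_orthogonal_shift[OF _ \<eta> \<rho> orth]) (simp_all add: wasserstein_differential_def)
  moreover have "(\<lambda>x. - \<eta> x) \<in> wasserstein_subdifferential (\<lambda>\<gamma>. - D \<gamma>) \<rho>"
  proof (rule subdifferential_orthogonal_shift[OF _ L2_uminus[OF \<eta>] \<rho>])
    show "(\<lambda>x. - \<xi> x) \<in> wasserstein_subdifferential (\<lambda>\<gamma>. - D \<gamma>) \<rho>"
      using \<xi> by (simp add: wasserstein_differential_def superdifferential_iff)
    show "L2_inner \<rho> (\<lambda>x. - \<xi> x - - \<eta> x) g = 0" if "g \<in> C11_gradients" for g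
      using orth[OF that] L2_inner_uminus_left[of \<rho> "\<lambda>x. \<xi> x - \<eta> x" g] by simp
  qed
  ultimately have "\<eta> \<in> wasserstein_differential D \<rho>"
    by (simp add: wasserstein_differential_def superdifferential_iff)
  moreover have "(L2_norm \<rho> \<xi>)\<^sup>2 = (L2_norm \<rho> \<eta>)\<^sup>2 + (L2_norm \<rho> (\<lambda>x. \<xi> x - \<eta> x))\<^sup>2"
    using L2_norm_add_square[OF \<eta> w] 0 by simp
  ultimately show ?thesis using tan that by blast
qed

text \<open>The dictionary between L2 and transport: the law of (f, g) is a coupling whose plan norm
  is the L2 distance, and pairings with the displacement become inner products.\<close>

lemma map_coupling:
  fixes f g :: "'c \<Rightarrow> 'a::euclidean_space"
  assumes "prob_space M" and f: "f \<in> L2 M" and g: "g \<in> L2 M"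
  shows "distr M borel f \<in> P2"
    and "distr M borel (\<lambda>x. (f x, g x)) \<in> couplings (distr M borel f) (distr M borel g)"
    and "L2_norm (distr M borel (\<lambda>x. (f x, g x))) displacement = L2_norm M (\<lambda>x. g x - f x)"
    and "\<xi> \<in> L2 (distr M borel f) \<Longrightarrow>
      L2_inner (distr M borel (\<lambda>x. (f x, g x))) (\<lambda>z. \<xi> (fst z)) displacement = L2_inner M (\<lambda>x. \<xi> (f x)) (\<lambda>x. g x - f x)"
    and "\<xi> \<in> L2 (distr M borel f) \<Longrightarrow> (\<lambda>x. \<xi> (f x)) \<in> L2 M"
proof -
  interpret prob_space M by fact
  note [measurable] = L2_measurable[OF f] L2_measurable[OF g]
  show "distr M borel f \<in> P2"
    using f by (simp add: P2_def L2_def prob_space_distr integrable_distr_eq)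
  have pm[measurable]: "(\<lambda>x. (f x, g x)) \<in> borel_measurable M"
    by (intro borel_measurable_Pair) measurable
  show "distr M borel (\<lambda>x. (f x, g x)) \<in> couplings (distr M borel f) (distr M borel g)"
    by (simp add: couplings_def distr_distr comp_def)
  show "L2_norm (distr M borel (\<lambda>x. (f x, g x))) displacement = L2_norm M (\<lambda>x. g x - f x)"
    by (subst L2_norm_distr) auto
  assume \<xi>: "\<xi> \<in> L2 (distr M borel f)"
  then have [measurable]: "\<xi> \<in> borel_measurable borel" using L2_measurable by fastforce
  show "L2_inner (distr M borel (\<lambda>x. (f x, g x))) (\<lambda>z. \<xi> (fst z)) displacement = L2_inner M (\<lambda>x. \<xi> (f x)) (\<lambda>x. g x - f x)"
    by (subst L2_inner_distr) auto
  show "(\<lambda>x. \<xi> (f x)) \<in> L2 M"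
    using \<xi> L2_distr_iff[of f M borel \<xi>] by simp
qed

text \<open>Both fields expand D along the plan of x + s h(x) with h = \<xi> - \<eta>; comparing the
  two expansions bounds s times the squared norm of h by e s times the norm of h.\<close>

lemma tangent_differential_unique:
  fixes D :: "'a::euclidean_space measure \<Rightarrow> real"
  assumes \<rho>: "\<rho> \<in> P2" and \<xi>: "\<xi> \<in> wasserstein_differential D \<rho>" "tangent_field \<rho> \<xi>"
    and \<eta>: "\<eta> \<in> wasserstein_differential D \<rho>" "tangent_field \<rho> \<eta>"
  shows "L2_norm \<rho> (\<lambda>x. \<xi> x - \<eta> x) = 0"
proof -
  interpret prob_space \<rho> by (rule P2_prob_space[OF \<rho>])
  define h where "h x = \<xi> x - \<eta> x" for x
  have L: "\<xi> \<in> L2 \<rho>" "\<eta> \<in> L2 \<rho>" using \<xi> \<eta> by (simp_all add: tangent_field_def)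
  have h: "h \<in> L2 \<rho>" unfolding h_def by (rule L2_diff[OF L])
  have id: "distr \<rho> borel (\<lambda>x. x) = \<rho>"
    by (rule distr_id2) (simp add: P2_sets[OF \<rho>])
  have "L2_norm \<rho> h \<le> 0 + e" if e: "0 < e" for e
  proof (cases "L2_norm \<rho> h = 0")
    case False
    then have n: "0 < L2_norm \<rho> h" using L2_norm_nonneg[of \<rho> h] by linarith
    have e2: "0 < e / 2" using e by simp
    obtain \<delta>1 where \<delta>1: "0 < \<delta>1" "\<And>\<gamma> \<sigma>. \<gamma> \<in> P2 \<Longrightarrow> \<sigma> \<in> couplings \<rho> \<gamma> \<Longrightarrow> plan_norm \<sigma> < \<delta>1 \<Longrightarrow>
        \<bar>D \<gamma> - D \<rho> - pairing \<sigma> \<xi>\<bar> \<le> e / 2 * plan_norm \<sigma>"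
      using tangent_differential_all_couplings[OF \<xi> \<rho>] e2 unfolding expands_along_couplings_def by meson
    obtain \<delta>2 where \<delta>2: "0 < \<delta>2" "\<And>\<gamma> \<sigma>. \<gamma> \<in> P2 \<Longrightarrow> \<sigma> \<in> couplings \<rho> \<gamma> \<Longrightarrow> plan_norm \<sigma> < \<delta>2 \<Longrightarrow>
        \<bar>D \<gamma> - D \<rho> - pairing \<sigma> \<eta>\<bar> \<le> e / 2 * plan_norm \<sigma>"
      using tangent_differential_all_couplings[OF \<eta> \<rho>] e2 unfolding expands_along_couplings_def by meson
    \<comment> \<open>The plan norm becomes half of the smaller radius, so both expansions
      apply.\<close>
    define s where "s = min \<delta>1 \<delta>2 / 2 / L2_norm \<rho> h"
    have s: "0 < s" using \<delta>1(1) \<delta>2(1) n by (simp add: s_def)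
    have sn: "s * L2_norm \<rho> h < min \<delta>1 \<delta>2" 
    proof -
      have "s * L2_norm \<rho> h = min \<delta>1 \<delta>2 / 2" using n by (simp add: s_def)
      moreover have "0 < min \<delta>1 \<delta>2" using \<delta>1(1) \<delta>2(1) by simp
      ultimately show ?thesis by linarith
    qed
    define g where "g x = x + s *\<^sub>R h x" for x
    have g: "g \<in> L2 \<rho>" unfolding g_def by (intro L2_add P2_ident_L2[OF \<rho>] L2_scaleR h)
    note mc = map_coupling[OF prob_space_axioms P2_ident_L2[OF \<rho>] g, unfolded id]
    define \<sigma> where "\<sigma> = distr \<rho> borel (\<lambda>x. (x, g x))"
    have \<gamma>: "distr \<rho> borel g \<in> P2" by (rule map_coupling(1)[OF prob_space_axioms g g])
    have \<sigma>: "\<sigma> \<in> couplings \<rho> (distr \<rho> borel g)" unfolding \<sigma>_def by (rule mc(2))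
    have gx: "(\<lambda>x. g x - x) = (\<lambda>x. s *\<^sub>R h x)" by (auto simp: g_def)
    have n\<sigma>: "plan_norm \<sigma> = s * L2_norm \<rho> h"
      unfolding \<sigma>_def mc(3) gx L2_norm_scaleR using s by simp
    have i\<sigma>: "pairing \<sigma> \<zeta> = s * L2_inner \<rho> \<zeta> h" if "\<zeta> \<in> L2 \<rho>" for \<zeta>
      unfolding \<sigma>_def mc(4)[OF that] gx L2_inner_scaleR_right ..
    have "s * L2_inner \<rho> \<xi> h - s * L2_inner \<rho> \<eta> h \<le> e * (s * L2_norm \<rho> h)"
    proof -
      define t where "t = e * (s * L2_norm \<rho> h)"
      have t: "e / 2 * (s * L2_norm \<rho> h) = t / 2" by (simp add: t_def)
      have "s * L2_norm \<rho> h < \<delta>1" "s * L2_norm \<rho> h < \<delta>2" using sn by simp_all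
      then show ?thesis
        using \<delta>1(2)[OF \<gamma> \<sigma>] \<delta>2(2)[OF \<gamma> \<sigma>] unfolding n\<sigma> i\<sigma>[OF L(1)] i\<sigma>[OF L(2)] t t_def[symmetric]
        by linarith
    qed
    then have "s * (L2_inner \<rho> \<xi> h - L2_inner \<rho> \<eta> h) \<le> s * (e * L2_norm \<rho> h)"
      by (simp add: algebra_simps)
    then have "L2_inner \<rho> \<xi> h - L2_inner \<rho> \<eta> h \<le> e * L2_norm \<rho> h" using s by simp
    moreover have "L2_inner \<rho> \<xi> h - L2_inner \<rho> \<eta> h = (L2_norm \<rho> h)\<^sup>2"
      unfolding L2_norm_square using L2_inner_diff_left[OF L h, folded h_def] by simp
    ultimately show ?thesis using n by (simp add: power2_eq_square)
  qed (use e in simp)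
  then have "L2_norm \<rho> h \<le> 0" by (rule field_le_epsilon)
  then show ?thesis unfolding h_def using L2_norm_nonneg[of \<rho> "\<lambda>x. \<xi> x - \<eta> x"] by linarith
qed

text \<open>Tangent differentials agree up to null sets and projection does not increase the norm,
  so each of them is minimal and the choice in \<open>wasserstein_gradient\<close> has a witness.
  The chosen minimiser may be another representative; the Pythagorean identity shows that its
  orthogonal part vanishes almost everywhere.\<close>

lemma wasserstein_gradient_tangent:
  fixes D :: "'a::euclidean_space measure \<Rightarrow> real"
  assumes D: "wasserstein_differential D \<rho> \<noteq> {}" and \<rho>: "\<rho> \<in> P2"
  shows "wasserstein_gradient D \<rho> \<in> wasserstein_differential D \<rho>" "tangent_field \<rho> (wasserstein_gradient D \<rho>)"
proof -
  obtain \<xi>0 where \<xi>0: "\<xi>0 \<in> wasserstein_differential D \<rho>" using D by blast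
  obtain \<xi> where \<xi>: "\<xi> \<in> wasserstein_differential D \<rho>" "tangent_field \<rho> \<xi>"
    by (rule tangent_projection[OF \<xi>0 \<rho>]) blast
  have "L2_norm \<rho> \<xi> \<le> L2_norm \<rho> \<zeta>" if \<zeta>: "\<zeta> \<in> wasserstein_differential D \<rho>" for \<zeta>
  proof -
    obtain \<eta> where \<eta>: "\<eta> \<in> wasserstein_differential D \<rho>" "tangent_field \<rho> \<eta>"
      and n: "(L2_norm \<rho> \<zeta>)\<^sup>2 = (L2_norm \<rho> \<eta>)\<^sup>2 + (L2_norm \<rho> (\<lambda>x. \<zeta> x - \<eta> x))\<^sup>2"
      by (rule tangent_projection[OF \<zeta> \<rho>])
    have L: "\<xi> \<in> L2 \<rho>" "\<eta> \<in> L2 \<rho>" using \<xi> \<eta> by (simp_all add: tangent_field_def)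
    have "L2_norm \<rho> \<xi> \<le> L2_norm \<rho> \<eta> + L2_norm \<rho> (\<lambda>x. \<xi> x - \<eta> x)"
      using L2_norm_triangle[OF L(2) L2_diff[OF L]] by simp
    also have "\<dots> = L2_norm \<rho> \<eta>" using tangent_differential_unique[OF \<rho> \<xi> \<eta>] by simp
    also have "\<dots> \<le> L2_norm \<rho> \<zeta>"
    proof (rule power2_le_imp_le)
      show "(L2_norm \<rho> \<eta>)\<^sup>2 \<le> (L2_norm \<rho> \<zeta>)\<^sup>2" unfolding n by simp
    qed simp
    finally show ?thesis .
  qed
  then have "is_arg_min (L2_norm \<rho>) (\<lambda>\<xi>. \<xi> \<in> wasserstein_differential D \<rho>) \<xi>"
    using \<xi>(1) by (auto simp: is_arg_min_def not_less)
  then have am: "is_arg_min (L2_norm \<rho>) (\<lambda>\<xi>. \<xi> \<in> wasserstein_differential D \<rho>) (wasserstein_gradient D \<rho>)"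
    unfolding wasserstein_gradient_def
    by (rule someI[where P = "is_arg_min (L2_norm \<rho>) (\<lambda>\<xi>. \<xi> \<in> wasserstein_differential D \<rho>)"])
  define \<zeta> where "\<zeta> = wasserstein_gradient D \<rho>"
  have \<zeta>: "\<zeta> \<in> wasserstein_differential D \<rho>" and min: "\<And>\<eta>. \<eta> \<in> wasserstein_differential D \<rho> \<Longrightarrow> L2_norm \<rho> \<zeta> \<le> L2_norm \<rho> \<eta>"
    using am by (auto simp: is_arg_min_def not_less \<zeta>_def)
  obtain \<eta> where \<eta>: "\<eta> \<in> wasserstein_differential D \<rho>" "tangent_field \<rho> \<eta>"
    and n: "(L2_norm \<rho> \<zeta>)\<^sup>2 = (L2_norm \<rho> \<eta>)\<^sup>2 + (L2_norm \<rho> (\<lambda>x. \<zeta> x - \<eta> x))\<^sup>2"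
    by (rule tangent_projection[OF \<zeta> \<rho>])
  have "(L2_norm \<rho> \<zeta>)\<^sup>2 \<le> (L2_norm \<rho> \<eta>)\<^sup>2" by (intro power_mono min \<eta>) simp
  then have 0: "L2_norm \<rho> (\<lambda>x. \<zeta> x - \<eta> x) = 0" using n by simp
  have \<zeta>L: "\<zeta> \<in> L2 \<rho>" using \<zeta> by (simp add: wasserstein_differential_def wasserstein_subdifferential_def)
  have \<eta>L: "\<eta> \<in> L2 \<rho>" using \<eta> by (simp add: tangent_field_def)
  have "tangent_field \<rho> \<zeta>"
    unfolding tangent_field_def
  proof (intro conjI allI impI \<zeta>L)
    fix \<epsilon> :: real assume "0 < \<epsilon>"
    then obtain g where g: "g \<in> C11_gradients" "L2_norm \<rho> (\<lambda>x. \<eta> x - g x) < \<epsilon>"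
      using \<eta>(2) unfolding tangent_field_def by blast
    have "L2_norm \<rho> (\<lambda>x. \<zeta> x - g x) \<le> L2_norm \<rho> (\<lambda>x. \<zeta> x - \<eta> x) + L2_norm \<rho> (\<lambda>x. \<eta> x - g x)"
      using L2_norm_triangle[OF L2_diff[OF \<zeta>L \<eta>L] L2_diff[OF \<eta>L C11_gradient_L2[OF g(1) \<rho>]]] by simp
    then show "\<exists>g\<in>C11_gradients. L2_norm \<rho> (\<lambda>x. \<zeta> x - g x) < \<epsilon>"
      using g 0 by (intro bexI[of _ g]) auto
  qed
  with \<zeta> show "wasserstein_gradient D \<rho> \<in> wasserstein_differential D \<rho>" "tangent_field \<rho> (wasserstein_gradient D \<rho>)"
    by (simp_all add: \<zeta>_def)
qed

text \<open>Tangency of the gradient gives an expansion along all couplings; it is applied to the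
  law of (f, g).\<close>

lemma wasserstein_gradient_frechet:
  fixes D :: "'a::euclidean_space measure \<Rightarrow> real" and f :: "'c \<Rightarrow> 'a"
  assumes D: "wasserstein_differentiable D" and M: "prob_space M" and f: "f \<in> L2 M"
  shows "(\<lambda>x. wasserstein_gradient D (distr M borel f) (f x)) \<in> L2 M"
    and "has_L2_frechet_derivative (\<lambda>f. D (distr M borel f))
      (L2_inner M (\<lambda>x. wasserstein_gradient D (distr M borel f) (f x))) M f"
proof -
  define \<rho> where "\<rho> = distr M borel f"
  define \<xi> where "\<xi> = wasserstein_gradient D \<rho>"
  have \<rho>: "\<rho> \<in> P2" unfolding \<rho>_def by (rule map_coupling(1)[OF M f f])
  have "wasserstein_differential D \<rho> \<noteq> {}" using D \<rho> by (simp add: wasserstein_differentiable_def)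
  from wasserstein_gradient_tangent[OF this \<rho>]
  have \<xi>: "\<xi> \<in> wasserstein_differential D \<rho>" "tangent_field \<rho> \<xi>" by (simp_all add: \<xi>_def)
  have "\<xi> \<in> L2 (distr M borel f)" using \<xi>(2) by (simp add: tangent_field_def \<rho>_def)
  note mc = map_coupling[OF M f] and i = map_coupling(4)[OF M f _ this]
  have L: "(\<lambda>x. \<xi> (f x)) \<in> L2 M" by (rule mc(5)[OF f \<open>\<xi> \<in> L2 (distr M borel f)\<close>])
  then show "(\<lambda>x. wasserstein_gradient D (distr M borel f) (f x)) \<in> L2 M"
    by (simp add: \<xi>_def \<rho>_def)
  have "has_L2_frechet_derivative (\<lambda>f. D (distr M borel f)) (L2_inner M (\<lambda>x. \<xi> (f x))) M f"
    unfolding has_L2_frechet_derivative_def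
  proof (intro conjI ballI allI impI)
    fix g h :: "'c \<Rightarrow> 'a" and a b :: real assume "g \<in> L2 M" "h \<in> L2 M"
    then show "L2_inner M (\<lambda>x. \<xi> (f x)) (\<lambda>x. a *\<^sub>R g x + b *\<^sub>R h x)
        = a * L2_inner M (\<lambda>x. \<xi> (f x)) g + b * L2_inner M (\<lambda>x. \<xi> (f x)) h"
      by (simp add: L2_inner_add_right[OF L2_scaleR L2_scaleR L] L2_inner_scaleR_right)
  next
    show "\<exists>C. \<forall>g\<in>L2 M. \<bar>L2_inner M (\<lambda>x. \<xi> (f x)) g\<bar> \<le> C * L2_norm M g"
      using L2_Cauchy_Schwarz[OF L] by blast
  next
    fix \<epsilon> :: real assume \<epsilon>: "0 < \<epsilon>"
    obtain \<delta> where \<delta>: "0 < \<delta>" "\<And>\<gamma> \<sigma>. \<gamma> \<in> P2 \<Longrightarrow> \<sigma> \<in> couplings \<rho> \<gamma> \<Longrightarrow> plan_norm \<sigma> < \<delta> \<Longrightarrow>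
        \<bar>D \<gamma> - D \<rho> - pairing \<sigma> \<xi>\<bar> \<le> \<epsilon> * plan_norm \<sigma>"
      using tangent_differential_all_couplings[OF \<xi> \<rho>] \<epsilon> unfolding expands_along_couplings_def by meson
    show "\<exists>\<delta>>0. \<forall>g\<in>L2 M. L2_norm M (\<lambda>x. g x - f x) < \<delta> \<longrightarrow>
        \<bar>D (distr M borel g) - D (distr M borel f) - L2_inner M (\<lambda>x. \<xi> (f x)) (\<lambda>x. g x - f x)\<bar> \<le> \<epsilon> * L2_norm M (\<lambda>x. g x - f x)"
    proof (intro exI[of _ \<delta>] conjI ballI impI \<delta>(1))
      fix g assume g: "g \<in> L2 M" and small: "L2_norm M (\<lambda>x. g x - f x) < \<delta>"
      show "\<bar>D (distr M borel g) - D (distr M borel f) - L2_inner M (\<lambda>x. \<xi> (f x)) (\<lambda>x. g x - f x)\<bar> \<le> \<epsilon> * L2_norm M (\<lambda>x. g x - f x)"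
        using \<delta>(2)[OF map_coupling(1)[OF M g g] mc(2)[OF g, folded \<rho>_def]] small
        unfolding mc(3)[OF g] i[OF g] \<rho>_def by simp
    qed
  qed
  then show "has_L2_frechet_derivative (\<lambda>f. D (distr M borel f))
      (L2_inner M (\<lambda>x. wasserstein_gradient D (distr M borel f) (f x))) M f"
    by (simp add: \<xi>_def \<rho>_def)
qed

section \<open>Submanifolds and differentiation along the parametrisation\<close>

text \<open>Curves in S cannot be added, so linearity is read off in a chart: Tan S p is the image
  of the linear model E under the derivative of \<Psi> at \<Phi> p.\<close>

lemma Tan_subspace:
  fixes S :: "'p::euclidean_space set"
  assumes S: "submanifold k S" and p: "p \<in> S"
  shows "subspace (Tan S p)"
proof -
  obtain U V \<Phi> \<Psi> E where U: "open U" "p \<in> U" and V: "open V" and hom: "homeomorphism U V \<Phi> \<Psi>"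
    and C1: "C1_on U \<Phi>" "C1_on V \<Psi>" and E: "subspace E" and EV: "\<Phi> ` (S \<inter> U) = E \<inter> V"
    using bspec[OF S[unfolded submanifold_def] p] by (elim exE conjE) (rule that; assumption)
  have \<Psi>\<Phi>: "\<Psi> (\<Phi> x) = x" if "x \<in> U" for x using hom that by (auto simp: homeomorphism_def)
  have \<Phi>V: "\<Phi> x \<in> V" if "x \<in> U" for x using hom that by (auto simp: homeomorphism_def)
  obtain A where A: "(\<Phi> has_derivative blinfun_apply A) (at p)"
    using C1(1) U(2) by (auto simp: C1_on_def)
  obtain B where B: "(\<Psi> has_derivative blinfun_apply B) (at (\<Phi> p))"
    using C1(2) \<Phi>V[OF U(2)] by (auto simp: C1_on_def)
  have "((\<Psi> \<circ> \<Phi>) has_derivative (blinfun_apply B \<circ> blinfun_apply A)) (at p)"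
    by (rule diff_chain_at[OF A B])
  then have "((\<lambda>x. x) has_derivative (blinfun_apply B \<circ> blinfun_apply A)) (at p)"
    by (rule has_derivative_transform_within_open[OF _ U]) (simp add: \<Psi>\<Phi>)
  then have BA: "B (A v) = v" for v
    using has_derivative_unique[OF _ has_derivative_ident] by (metis comp_apply)
  have pE: "\<Phi> p \<in> E" using EV p U(2) by blast
  have "Tan S p = blinfun_apply B ` E"
  proof
    show "Tan S p \<subseteq> blinfun_apply B ` E"
    proof
      fix v assume "v \<in> Tan S p"
      then obtain c where c0: "c 0 = p" and cS: "\<forall>\<^sub>F t in nhds 0. c t \<in> S"
        and cv: "(c has_vector_derivative v) (at (0::real))"
        unfolding Tan_def by blast
      have "isCont c 0" by (rule has_vector_derivative_continuous[OF cv])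
      then have "(c \<longlongrightarrow> c 0) (nhds 0)"
        by (simp add: isCont_def tendsto_at_iff_tendsto_nhds)
      then have "\<forall>\<^sub>F t in nhds 0. c t \<in> U"
        using U c0 by (intro topological_tendstoD) simp_all
      with cS have ev: "\<forall>\<^sub>F t in nhds 0. \<Phi> (c t) \<in> E"
      proof eventually_elim
        case (elim t)
        then have "\<Phi> (c t) \<in> \<Phi> ` (S \<inter> U)" by blast
        then show ?case using EV by blast
      qed
      let ?d = "\<Phi> \<circ> c"
      have "(?d has_derivative (blinfun_apply A \<circ> (\<lambda>t. t *\<^sub>R v))) (at 0)"
        using cv A by (intro diff_chain_at) (simp_all add: has_vector_derivative_def c0)
      then have "((\<lambda>t. norm (?d t - ?d 0 - t *\<^sub>R A v) / norm t) \<longlongrightarrow> 0) (at 0)"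
        unfolding has_derivative_at by (simp add: comp_def blinfun.scaleR_right)
      moreover have "norm (?d t - ?d 0 - t *\<^sub>R A v) / norm t
          = norm ((?d t - ?d 0) /\<^sub>R t - A v)" if "t \<noteq> 0" for t
      proof -
        have "(?d t - ?d 0) /\<^sub>R t - A v = (1 / t) *\<^sub>R (?d t - ?d 0 - t *\<^sub>R A v)"
          using that by (simp add: algebra_simps divide_inverse)
        then show ?thesis by (simp only: norm_scaleR) simp
      qed
      then have "\<forall>\<^sub>F t in at 0. norm (?d t - ?d 0 - t *\<^sub>R A v) / norm t
          = norm ((?d t - ?d 0) /\<^sub>R t - A v)"
        by (intro eventually_at_filter[THEN iffD2] always_eventually allI impI)
      ultimately have "((\<lambda>t. norm ((?d t - ?d 0) /\<^sub>R t - A v)) \<longlongrightarrow> 0) (at 0)"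
        by (rule Lim_transform_eventually)
      then have lim: "((\<lambda>t. (?d t - ?d 0) /\<^sub>R t) \<longlongrightarrow> A v) (at 0)"
        by (rule LIM_zero_cancel[OF tendsto_norm_zero_cancel])
      \<comment> \<open>The difference quotients of \<Phi> along c lie in E for small t, and E is
        closed.\<close>
      have "A v \<in> E"
      proof (rule Lim_in_closed_set[OF closed_subspace[OF E] _ _ lim])
        have "\<forall>\<^sub>F t in at 0. \<Phi> (c t) \<in> E"
          using ev by (simp add: eventually_nhds_conv_at)
        then show "\<forall>\<^sub>F t in at 0. (?d t - ?d 0) /\<^sub>R t \<in> E"
        proof eventually_elim
          case (elim t)
          then show ?case
            using pE by (auto simp: c0 intro!: subspace_scale[OF E] subspace_diff[OF E])
        qed
      qed simp
      then show "v \<in> blinfun_apply B ` E" using BA[of v] by (metis imageI)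
    qed
    show "blinfun_apply B ` E \<subseteq> Tan S p"
    proof
      fix v assume "v \<in> blinfun_apply B ` E"
      then obtain e where e: "e \<in> E" and v: "v = B e" by blast
      define c where "c t = \<Psi> (\<Phi> p + t *\<^sub>R e)" for t :: real
      have "((\<lambda>t. \<Phi> p + t *\<^sub>R e) \<longlongrightarrow> \<Phi> p + 0 *\<^sub>R e) (nhds 0)"
        by (intro tendsto_intros) (simp add: filterlim_ident)
      then have "\<forall>\<^sub>F t in nhds 0. \<Phi> p + t *\<^sub>R e \<in> V"
        using topological_tendstoD[OF _ V] \<Phi>V[OF U(2)] by fastforce
      then have "\<forall>\<^sub>F t in nhds 0. c t \<in> S"
      proof eventually_elim
        case (elim t)
        have "\<Phi> p + t *\<^sub>R e \<in> E" by (intro subspace_add[OF E] subspace_scale[OF E] pE e)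
        with elim obtain x where "x \<in> S \<inter> U" "\<Phi> p + t *\<^sub>R e = \<Phi> x" using EV by blast
        then show ?case by (simp add: c_def \<Psi>\<Phi>)
      qed
      moreover have "(c has_vector_derivative v) (at 0)"
      proof -
        have "((\<lambda>t. \<Phi> p + t *\<^sub>R e) has_derivative (\<lambda>t. t *\<^sub>R e)) (at 0)"
          by (auto intro!: derivative_eq_intros)
        then have "((\<Psi> \<circ> (\<lambda>t. \<Phi> p + t *\<^sub>R e)) has_derivative (blinfun_apply B \<circ> (\<lambda>t. t *\<^sub>R e))) (at 0)"
          using B by (intro diff_chain_at) simp_all
        then show ?thesis
          by (simp add: has_vector_derivative_def comp_def c_def[abs_def] blinfun.scaleR_right v)
      qed
      moreover have "c 0 = p" by (simp add: c_def \<Psi>\<Phi> U(2))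
      ultimately show "v \<in> Tan S p" unfolding Tan_def by blast
    qed
  qed
  then show ?thesis
    by (simp add: linear_subspace_image[OF bounded_linear.linear[OF blinfun.bounded_linear_right] E])
qed

text \<open>Along a curve in S with velocity v, both values are the derivative of L (c t) at 0. A
  derivative within S is in general not determined in other directions.\<close>

lemma derivative_unique_on_Tan:
  fixes L :: "'p::euclidean_space \<Rightarrow> real"
  assumes 1: "(L has_derivative M) (at p within S)" and 2: "(L has_derivative N) (at p within S)"
    and v: "v \<in> Tan S p"
  shows "M v = N v"
proof -
  obtain c where c0: "c 0 = p" and cS: "\<forall>\<^sub>F t in nhds 0. c t \<in> S"
    and cv: "(c has_vector_derivative v) (at (0::real))"
    using v unfolding Tan_def by blast
  obtain W where W: "open W" "0 \<in> W" "\<And>t. t \<in> W \<Longrightarrow> c t \<in> S"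
    using cS unfolding eventually_nhds by blast
  have "((\<lambda>t. L (c t)) has_vector_derivative L' v) (at 0)" if L': "(L has_derivative L') (at p within S)" for L'
  proof -
    have "(c has_derivative (\<lambda>t. t *\<^sub>R v)) (at 0 within W)"
      using cv by (simp add: has_vector_derivative_def has_derivative_at_withinI)
    moreover have "(L has_derivative L') (at (c 0) within c ` W)"
      unfolding c0 by (rule has_derivative_subset[OF L']) (use W in auto)
    ultimately have "((\<lambda>t. L (c t)) has_derivative (\<lambda>t. L' (t *\<^sub>R v))) (at 0 within W)"
      by (rule has_derivative_in_compose)
    moreover have "L' (t *\<^sub>R v) = t *\<^sub>R L' v" for t
      using L' by (simp add: linear_cmul has_derivative_linear)
    ultimately show ?thesis
      using at_within_open[OF W(2,1)] by (simp add: has_vector_derivative_def)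
  qed
  from vector_derivative_unique_at[OF this[OF 1] this[OF 2]] show ?thesis .
qed

text \<open>Definiteness is available only on V, so the problem is moved to coordinates there: f v
  represents h v on V in the Euclidean inner product; it is injective on V by definiteness, hence
  onto V by dimension.\<close>

lemma riesz_on_subspace:
  fixes h :: "'p::euclidean_space \<Rightarrow> 'p \<Rightarrow> real"
  assumes V: "subspace V" and h: "bilinear h" and pos: "\<And>v. v \<in> V \<Longrightarrow> h v v = 0 \<Longrightarrow> v = 0"
    and l: "linear l"
  obtains g where "g \<in> V" "\<And>v. v \<in> V \<Longrightarrow> h g v = l v"
proof -
  obtain B where B: "B \<subseteq> V" "pairwise orthogonal B" "\<And>x. x \<in> B \<Longrightarrow> norm x = 1" "independent B" "span B = V"
    using orthonormal_basis_subspace[OF V] by metis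
  have finB: "finite B" using B(4) by (rule independent_imp_finite)
  have hl: "linear (\<lambda>v. h v w)" "linear (h w)" for w using h by (simp_all add: bilinear_def)
  have coord: "(\<Sum>b\<in>B. f b *\<^sub>R b) \<bullet> b' = f b'" if "b' \<in> B" for f b'
  proof -
    have "(\<Sum>b\<in>B. f b *\<^sub>R b) \<bullet> b' = (\<Sum>b\<in>B. if b = b' then f b else 0)"
      unfolding inner_sum_left
    proof (rule sum.cong)
      fix b assume "b \<in> B"
      then show "f b *\<^sub>R b \<bullet> b' = (if b = b' then f b else 0)"
        using B(2,3) that by (auto simp: pairwise_def orthogonal_def norm_eq_1)
    qed simp
    then show ?thesis using finB that by simp
  qed
  define f where "f v = (\<Sum>b\<in>B. h v b *\<^sub>R b)" for v
  have f: "linear f"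
    unfolding f_def by (rule linearI) (simp_all add: linear_add[OF hl(1)] linear_cmul[OF hl(1)]
        scaleR_left_distrib sum.distrib scaleR_sum_right)
  have ext: "h v u = k u" if "\<And>b. b \<in> B \<Longrightarrow> h v b = k b" "linear k" "u \<in> V" for v u k
    using linear_eq_on_span[OF hl(2) that(2), of B] that(1,3) B(5) by blast
  have "inj_on f V"
  proof (subst linear_inj_on_iff_eq_0[OF f V], intro ballI impI)
    fix v assume v: "v \<in> V" "f v = 0"
    have "h v b = 0" if "b \<in> B" for b
      using coord[OF that, of "h v"] v(2) by (simp add: f_def)
    then have "h v v = 0" using ext[of v "\<lambda>_. 0" v] v(1) by (simp add: linear_zero)
    then show "v = 0" using pos v(1) by blast
  qed
  then have "dim (f ` V) = dim V"
    by (intro dim_image_eq[OF f]) (simp add: B(5)[symmetric] span_span)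
  moreover have "f ` V \<subseteq> V"
    unfolding f_def using B(1) by (auto intro!: subspace_sum[OF V] subspace_scale[OF V])
  ultimately have "f ` V = V"
    using subspace_dim_equal[OF linear_subspace_image[OF f V] V] by simp
  moreover have "(\<Sum>b\<in>B. l b *\<^sub>R b) \<in> V"
    using B(1) by (auto intro!: subspace_sum[OF V] subspace_scale[OF V])
  ultimately obtain g where g: "g \<in> V" "f g = (\<Sum>b\<in>B. l b *\<^sub>R b)" by (metis imageE)
  have "h g b = l b" if "b \<in> B" for b
    using coord[OF that, of "h g"] coord[OF that, of l] g(2) by (simp add: f_def)
  then show ?thesis using that[OF g(1)] ext[of g l] l by blast
qed

section \<open>Differentials of maps into L2 and the chain rule\<close>

context
  fixes T A :: "'p::euclidean_space \<Rightarrow> 'a \<Rightarrow> 'b::euclidean_space" and M :: "'a measure"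
    and \<theta> :: 'p and S :: "'p set"
  assumes der: "L2_has_derivative_within T A M \<theta> S"
begin

lemma L2_derivative_L2: "A v \<in> L2 M"
  using der by (simp add: L2_has_derivative_within_def)

lemma L2_derivative_combination: "AE x in M. A (a *\<^sub>R v + b *\<^sub>R w) x = a *\<^sub>R A v x + b *\<^sub>R A w x"
  using der by (simp add: L2_has_derivative_within_def)

lemma L2_derivative_zero: "AE x in M. A 0 x = 0"
  using L2_derivative_combination[of 0 0 0 0] by simp

text \<open>A is linear only up to null sets, whereas l acts on functions. The bound on l closes the
  gap: it makes l vanish on functions that are zero almost everywhere.\<close>

lemma L2_derivative_linear_functional:
  assumes comb: "\<And>g h a b. g \<in> L2 M \<Longrightarrow> h \<in> L2 M \<Longrightarrow> l (\<lambda>x. a *\<^sub>R g x + b *\<^sub>R h x) = a * l g + b * l h"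
    and bd: "\<And>g. g \<in> L2 M \<Longrightarrow> \<bar>l g\<bar> \<le> C * L2_norm M g"
  shows "linear (\<lambda>v. l (A v))"
proof -
  have "l (A (a *\<^sub>R v + b *\<^sub>R w)) = a * l (A v) + b * l (A w)" for a b v w
  proof -
    define u where "u x = a *\<^sub>R A v x + b *\<^sub>R A w x" for x
    have u: "u \<in> L2 M" unfolding u_def by (intro L2_add L2_scaleR L2_derivative_L2)
    define d where "d x = 1 *\<^sub>R A (a *\<^sub>R v + b *\<^sub>R w) x + (-1) *\<^sub>R u x" for x
    have d: "d \<in> L2 M" unfolding d_def by (intro L2_add L2_scaleR L2_derivative_L2 u)
    have "AE x in M. d x = 0"
      using L2_derivative_combination[of a v b w] by eventually_elim (simp add: d_def u_def)
    then have "L2_norm M d = 0" using L2_norm_eq_0_iff[OF d] by simp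
    then have "l d = 0" using bd[OF d] by simp
    moreover have "l d = l (A (a *\<^sub>R v + b *\<^sub>R w)) - l u"
      using comb[OF L2_derivative_L2 u, of 1 _ "-1"] by (simp add: d_def[abs_def])
    moreover have "l u = a * l (A v) + b * l (A w)"
      using comb[OF L2_derivative_L2 L2_derivative_L2] by (simp add: u_def[abs_def])
    ultimately show ?thesis by simp
  qed
  from this[of 1 _ 1] this[of _ _ 0] show ?thesis
    by (intro linearI) simp_all
qed

lemma L2_derivative_inner_linear:
  assumes "f \<in> L2 M"
  shows "linear (\<lambda>v. L2_inner M f (A v))"
proof (rule L2_derivative_linear_functional)
  show "L2_inner M f (\<lambda>x. a *\<^sub>R g x + b *\<^sub>R h x) = a * L2_inner M f g + b * L2_inner M f h"
    if "g \<in> L2 M" "h \<in> L2 M" for g h a b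
    using that assms by (simp add: L2_inner_add_right L2_scaleR L2_inner_scaleR_right)
  show "\<bar>L2_inner M f g\<bar> \<le> L2_norm M f * L2_norm M g" if "g \<in> L2 M" for g
    by (rule L2_Cauchy_Schwarz[OF assms that])
qed

lemma L2_derivative_bilinear: "bilinear (\<lambda>v w. L2_inner M (A v) (A w))"
  unfolding bilinear_def
  using L2_derivative_inner_linear[OF L2_derivative_L2] by (simp add: L2_inner_commute)

text \<open>The squared norm is the diagonal of a bilinear form on a Euclidean space, and such forms
  are bounded.\<close>

lemma L2_derivative_bounded:
  obtains K where "0 \<le> K" "\<And>v. L2_norm M (A v) \<le> K * norm v"
proof -
  obtain B where B: "\<And>v w. norm (L2_inner M (A v) (A w)) \<le> B * norm v * norm w"
    using bilinear_bounded[OF L2_derivative_bilinear] by blast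
  have "L2_norm M (A v) \<le> sqrt \<bar>B\<bar> * norm v" for v
  proof (rule power2_le_imp_le)
    have "(L2_norm M (A v))\<^sup>2 \<le> B * norm v * norm v"
      using B[of v v] by (simp add: L2_norm_square)
    also have "\<dots> \<le> \<bar>B\<bar> * norm v * norm v" by (intro mult_right_mono) auto
    finally show "(L2_norm M (A v))\<^sup>2 \<le> (sqrt \<bar>B\<bar> * norm v)\<^sup>2"
      by (simp add: power_mult_distrib power2_eq_square[of "norm v"] mult.assoc)
  qed simp
  then show ?thesis using that[of "sqrt \<bar>B\<bar>"] by simp
qed

lemma frechet_chain_rule:
  assumes fr: "has_L2_frechet_derivative F l M (T \<theta>)" and \<theta>: "\<theta> \<in> S"
    and T: "\<And>\<theta>'. \<theta>' \<in> S \<Longrightarrow> T \<theta>' \<in> L2 M"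
  shows "((\<lambda>\<theta>. F (T \<theta>)) has_derivative (\<lambda>v. l (A v))) (at \<theta> within S)"
proof -
  obtain C0 where comb: "\<And>g h a b. g \<in> L2 M \<Longrightarrow> h \<in> L2 M \<Longrightarrow> l (\<lambda>x. a *\<^sub>R g x + b *\<^sub>R h x) = a * l g + b * l h"
    and bd0: "\<And>g. g \<in> L2 M \<Longrightarrow> \<bar>l g\<bar> \<le> C0 * L2_norm M g"
    and eps: "\<And>\<epsilon>. \<epsilon> > 0 \<Longrightarrow> \<exists>\<delta>>0. \<forall>g\<in>L2 M. L2_norm M (\<lambda>x. g x - T \<theta> x) < \<delta> \<longrightarrow>
        \<bar>F g - F (T \<theta>) - l (\<lambda>x. g x - T \<theta> x)\<bar> \<le> \<epsilon> * L2_norm M (\<lambda>x. g x - T \<theta> x)"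
    using fr unfolding has_L2_frechet_derivative_def by blast
  define C where "C = max C0 0"
  have C: "0 \<le> C" by (simp add: C_def)
  have bd: "\<bar>l g\<bar> \<le> C * L2_norm M g" if "g \<in> L2 M" for g
    using bd0[OF that] mult_right_mono[of C0 C "L2_norm M g"] by (simp add: C_def)
  have ldiff: "l (\<lambda>x. g x - h x) = l g - l h" if "g \<in> L2 M" "h \<in> L2 M" for g h
    using comb[OF that, of 1 "-1"] by simp
  have lin: "linear (\<lambda>v. l (A v))" by (rule L2_derivative_linear_functional[OF comb bd0])
  obtain K where K: "0 \<le> K" "\<And>v. L2_norm M (A v) \<le> K * norm v" by (rule L2_derivative_bounded) blast
  show ?thesis
    unfolding has_derivative_within_alt
  proof (intro conjI allI impI)
    show "bounded_linear (\<lambda>v. l (A v))" using lin by (simp add: linear_conv_bounded_linear)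
    fix e :: real assume e: "0 < e"
    \<comment> \<open>e1 pays for the remainder of F, since increments of T have norm at most (K +
      1) n; e2 pays for the remainder of T after applying l. Each accounts for e / 2, and e2 \<le> 1
      gives the summand 1 in K + 1.\<close>
    define e1 where "e1 = e / 2 / (K + 1)"
    define e2 where "e2 = min 1 (e / 2 / (C + 1))"
    have e1: "0 < e1" using e K by (simp add: e1_def add_nonneg_pos)
    have e2: "0 < e2" "e2 \<le> 1" using e C by (simp_all add: e2_def add_nonneg_pos)
    have e2C: "C * e2 \<le> e / 2"
    proof -
      have "C * e2 \<le> (C + 1) * (e / 2 / (C + 1))" using C e2 by (intro mult_mono) (auto simp: e2_def)
      moreover have "c * (e / 2 / c) = e / 2" if "0 < c" for c :: real using that by simp
      ultimately show ?thesis using C by (simp only: add_nonneg_pos zero_less_one)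
    qed
    obtain \<delta> where \<delta>: "0 < \<delta>" "\<And>g. g \<in> L2 M \<Longrightarrow> L2_norm M (\<lambda>x. g x - T \<theta> x) < \<delta> \<Longrightarrow>
        \<bar>F g - F (T \<theta>) - l (\<lambda>x. g x - T \<theta> x)\<bar> \<le> e1 * L2_norm M (\<lambda>x. g x - T \<theta> x)"
      using eps[OF e1] by blast
    have "((\<lambda>\<theta>'. L2_norm M (\<lambda>x. T \<theta>' x - T \<theta> x - A (\<theta>' - \<theta>) x) / norm (\<theta>' - \<theta>)) \<longlongrightarrow> 0) (at \<theta> within S)"
      using der by (simp add: L2_has_derivative_within_def)
    from tendstoD[OF this e2(1)] obtain d where d: "0 < d"
      and dr: "\<And>\<theta>'. \<theta>' \<in> S \<Longrightarrow> \<theta>' \<noteq> \<theta> \<Longrightarrow> dist \<theta>' \<theta> < d \<Longrightarrow>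
        L2_norm M (\<lambda>x. T \<theta>' x - T \<theta> x - A (\<theta>' - \<theta>) x) / norm (\<theta>' - \<theta>) < e2"
      unfolding eventually_at by (auto simp: dist_norm)
    show "\<exists>d>0. \<forall>y\<in>S. norm (y - \<theta>) < d \<longrightarrow> norm (F (T y) - F (T \<theta>) - l (A (y - \<theta>))) \<le> e * norm (y - \<theta>)"
    proof (intro exI[of _ "min d (\<delta> / (K + 1))"] conjI ballI impI)
      show "0 < min d (\<delta> / (K + 1))" using d \<delta>(1) K(1) by (simp add: add_nonneg_pos)
      fix y assume y: "y \<in> S" and near: "norm (y - \<theta>) < min d (\<delta> / (K + 1))"
      show "norm (F (T y) - F (T \<theta>) - l (A (y - \<theta>))) \<le> e * norm (y - \<theta>)"
      proof (cases "y = \<theta>")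
        case True
        then show ?thesis using linear_0[OF lin] by simp
      next
        case False
        define n where "n = norm (y - \<theta>)"
        have n: "0 < n" using False by (simp add: n_def)
        define r where "r x = T y x - T \<theta> x - A (y - \<theta>) x" for x
        have TL: "(\<lambda>x. T y x - T \<theta> x) \<in> L2 M" by (intro L2_diff T y \<theta>)
        have r: "r \<in> L2 M" unfolding r_def by (intro L2_diff TL[THEN L2_diff] L2_derivative_L2 T y \<theta>)
        have "L2_norm M r / n < e2"
          using dr[OF y False] near by (simp add: dist_norm n_def r_def[abs_def])
        then have rn: "L2_norm M r \<le> e2 * n" using n by (simp add: pos_divide_less_eq)
        have "L2_norm M (\<lambda>x. T y x - T \<theta> x) \<le> L2_norm M (A (y - \<theta>)) + L2_norm M r"
          using L2_norm_triangle[OF L2_derivative_L2[of "y - \<theta>"] r] by (simp add: r_def)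
        also have "\<dots> \<le> K * n + 1 * n"
        proof (rule add_mono)
          show "L2_norm M (A (y - \<theta>)) \<le> K * n" using K(2) by (simp add: n_def)
          show "L2_norm M r \<le> 1 * n"
            using rn by (rule order_trans) (intro mult_right_mono e2(2) less_imp_le n)
        qed
        finally have Tn: "L2_norm M (\<lambda>x. T y x - T \<theta> x) \<le> (K + 1) * n" by (simp add: distrib_right)
        have "n < \<delta> / (K + 1)" using near by (simp add: n_def)
        then have "(K + 1) * n < \<delta>" using K(1) by (simp add: pos_less_divide_eq mult.commute)
        with Tn have "L2_norm M (\<lambda>x. T y x - T \<theta> x) < \<delta>" by linarith
        from \<delta>(2)[OF T[OF y] this]
        have "\<bar>F (T y) - F (T \<theta>) - l (\<lambda>x. T y x - T \<theta> x)\<bar> \<le> e1 * ((K + 1) * n)"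
          using mult_left_mono[OF Tn, of e1] e1 by linarith
        also have "\<dots> = e / 2 * n"
        proof -
          have "e / 2 / c * (c * n) = e / 2 * n" if "0 < c" for c using that by simp
          from this[of "K + 1"] show ?thesis using K(1) unfolding e1_def by (simp only: add_nonneg_pos zero_less_one)
        qed
        finally have 1: "\<bar>F (T y) - F (T \<theta>) - l (\<lambda>x. T y x - T \<theta> x)\<bar> \<le> e / 2 * n" .
        have "\<bar>l (\<lambda>x. T y x - T \<theta> x) - l (A (y - \<theta>))\<bar> = \<bar>l r\<bar>"
          using ldiff[OF TL L2_derivative_L2[of "y - \<theta>"]] by (simp add: r_def[abs_def])
        also have "\<dots> \<le> C * (e2 * n)"
          using bd[OF r] mult_left_mono[OF rn C] by linarith
        also have "\<dots> \<le> e / 2 * n"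
          using mult_right_mono[OF e2C, of n] n by (simp add: mult.assoc)
        finally show ?thesis using 1 unfolding n_def real_norm_def by linarith
      qed
    qed
  qed
qed

end

section \<open>Natural gradient flows\<close>

text \<open>With g the Riesz representative of the differential, the cross term of the square is 2
  h(g, v), so the functional equals a constant plus h(v + g, v + g). Definiteness of h on the
  tangent space makes -g the only minimiser and g the only gradient.\<close>

lemma projected_velocities_natural_gradient:
  fixes D :: "'a::euclidean_space measure \<Rightarrow> real" and S :: "'p::euclidean_space set"
  assumes D: "wasserstein_differentiable D" and M: "prob_space M"
    and S: "submanifold k S" and \<theta>: "\<theta> \<in> S"
    and T: "\<And>\<theta>. \<theta> \<in> S \<Longrightarrow> T \<theta> \<in> L2 M"
    and der: "L2_has_derivative_within T (dT \<theta>) M \<theta> S"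
    and inj: "\<And>v w. v \<in> Tan S \<theta> \<Longrightarrow> w \<in> Tan S \<theta> \<Longrightarrow> (AE x in M. dT \<theta> v x = dT \<theta> w x) \<Longrightarrow> v = w"
  shows "\<exists>g. (\<forall>g'. is_natural_gradient M S T dT (\<lambda>f. D (distr M borel f)) \<theta> g' \<longleftrightarrow> g' = g) \<and>
    projected_velocities D M S T dT \<theta> = {- g}"
proof -
  define V where "V = Tan S \<theta>"
  define h where "h v w = L2_inner M (dT \<theta> v) (dT \<theta> w)" for v w
  define \<xi> where "\<xi> x = wasserstein_gradient D (distr M borel (T \<theta>)) (T \<theta> x)" for x
  define L where "L \<theta> = D (distr M borel (T \<theta>))" for \<theta>
  note dTL = L2_derivative_L2[OF der]
  have V: "subspace V" unfolding V_def by (rule Tan_subspace[OF S \<theta>])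
  have bil: "bilinear h"
    unfolding h_def[abs_def] by (rule L2_derivative_bilinear[OF der])
  have hsym: "h v w = h w v" for v w by (simp add: h_def L2_inner_commute)
  have hnn: "0 \<le> h v v" for v by (simp add: h_def L2_norm_square[symmetric])
  have hpos: "v = 0" if v: "v \<in> V" "h v v = 0" for v
  proof -
    have "L2_norm M (dT \<theta> v) = 0" using v(2) by (simp add: h_def L2_norm_square[symmetric])
    then have "AE x in M. dT \<theta> v x = 0" using L2_norm_eq_0_iff[OF dTL] by simp
    then have "AE x in M. dT \<theta> v x = dT \<theta> 0 x"
      using L2_derivative_zero[OF der] by eventually_elim simp
    then show ?thesis
      using inj[of v 0] v(1) subspace_0[OF V] by (simp add: V_def)
  qed
  have \<xi>: "\<xi> \<in> L2 M" and fr: "has_L2_frechet_derivative (\<lambda>f. D (distr M borel f)) (L2_inner M \<xi>) M (T \<theta>)"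
    using wasserstein_gradient_frechet[OF D M T[OF \<theta>]] unfolding \<xi>_def[abs_def] by simp_all
  have L': "(L has_derivative (\<lambda>v. L2_inner M \<xi> (dT \<theta> v))) (at \<theta> within S)"
    unfolding L_def[abs_def] by (rule frechet_chain_rule[OF der fr \<theta> T])
  obtain g where g: "g \<in> V" and hg: "\<And>v. v \<in> V \<Longrightarrow> h g v = L2_inner M \<xi> (dT \<theta> v)"
    by (rule riesz_on_subspace[OF V bil hpos L2_derivative_inner_linear[OF der \<xi>]]) blast+
  have "is_natural_gradient M S T dT (\<lambda>f. D (distr M borel f)) \<theta> g' \<longleftrightarrow> g' = g" for g'
  proof
    assume "g' = g"
    then show "is_natural_gradient M S T dT (\<lambda>f. D (distr M borel f)) \<theta> g'"
      using g hg L' unfolding is_natural_gradient_def is_riemannian_gradient_def pullback_metric_def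
        h_def V_def L_def by blast
  next
    assume "is_natural_gradient M S T dT (\<lambda>f. D (distr M borel f)) \<theta> g'"
    then obtain N where g': "g' \<in> V" and N: "(L has_derivative N) (at \<theta> within S)"
      and hN: "\<And>v. v \<in> V \<Longrightarrow> h g' v = N v"
      unfolding is_natural_gradient_def is_riemannian_gradient_def pullback_metric_def h_def V_def L_def by blast
    \<comment> \<open>The derivative attached to g' and the one from the chain rule may differ off
      the tangent space; on it they agree.\<close>
    have "h (g' - g) v = 0" if "v \<in> V" for v
      using hN[OF that] hg[OF that] derivative_unique_on_Tan[OF N L', of v] that
      by (simp add: bilinear_lsub[OF bil] V_def)
    then show "g' = g" using hpos[of "g' - g"] subspace_diff[OF V g' g] by simp
  qed
  moreover have "projected_velocities D M S T dT \<theta> = {- g}"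
  proof -
    define J where "J v = (LINT x|M. (norm (- \<xi> x - dT \<theta> v x))\<^sup>2)" for v
    have J: "J v = ((L2_norm M \<xi>)\<^sup>2 - h g g) + h (v + g) (v + g)" if v: "v \<in> V" for v
    proof -
      have "J v = (L2_norm M (\<lambda>x. \<xi> x + dT \<theta> v x))\<^sup>2"
        using norm_minus_cancel[of "\<xi> _ + dT \<theta> v _"] by (simp add: J_def L2_norm_def)
      also have "\<dots> = (L2_norm M \<xi>)\<^sup>2 + 2 * h g v + h v v"
        unfolding L2_norm_add_square[OF \<xi> dTL]
        using hg[OF v] by (simp add: L2_norm_square h_def)
      also have "\<dots> = ((L2_norm M \<xi>)\<^sup>2 - h g g) + h (v + g) (v + g)"
        by (simp add: bilinear_ladd[OF bil] bilinear_radd[OF bil] hsym[of v g])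
      finally show ?thesis .
    qed
    have mg: "- g \<in> V" using subspace_neg[OF V g] .
    have J0: "J (- g) = (L2_norm M \<xi>)\<^sup>2 - h g g"
      using J[OF mg] by (simp add: bilinear_lzero[OF bil])
    have "is_arg_min J (\<lambda>v. v \<in> V) v \<longleftrightarrow> v = - g" for v
    proof
      assume am: "is_arg_min J (\<lambda>v. v \<in> V) v"
      then have v: "v \<in> V" "J v \<le> J (- g)" using mg by (auto simp: is_arg_min_def not_less)
      then have "h (v + g) (v + g) = 0" using J[OF v(1)] J0 hnn[of "v + g"] by simp
      then have "v + g = 0" using hpos subspace_add[OF V v(1) g] by blast
      then show "v = - g" by (simp add: eq_neg_iff_add_eq_0)
    next
      assume "v = - g"
      then show "is_arg_min J (\<lambda>v. v \<in> V) v"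
        using mg J J0 hnn by (auto simp: is_arg_min_def not_less)
    qed
    then show ?thesis
      unfolding projected_velocities_def \<xi>_def[symmetric] J_def[symmetric] V_def[symmetric]
      by (auto simp: J_def[abs_def])
  qed
  ultimately show ?thesis by blast
qed

text \<open>The natural gradient flow presupposes that F is differentiable on L2, so this is part of
  the conclusion. The flows are compared as sets of curves; on an interval with nonempty interior
  the velocity of a curve is determined.\<close>

theorem corollary3p8:
  fixes \<rho>\<^sub>0 :: "(real ^ 'd) measure"
    and k :: nat
    and \<Theta> :: "(real ^ 'm) set"
    and T :: "real ^ 'm \<Rightarrow> real ^ 'd \<Rightarrow> real ^ 'd"
    and dT :: "real ^ 'm \<Rightarrow> real ^ 'm \<Rightarrow> real ^ 'd \<Rightarrow> real ^ 'd"
    and D :: "(real ^ 'd) measure \<Rightarrow> real"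
  defines "F \<equiv> (\<lambda>f. D (distr \<rho>\<^sub>0 borel f))"
  assumes "\<rho>\<^sub>0 \<in> P2_ac"
    and "submanifold k \<Theta>"
    and "\<And>\<theta>. \<theta> \<in> \<Theta> \<Longrightarrow> T \<theta> \<in> convex_gradients \<rho>\<^sub>0"
    and "\<And>\<theta>. \<theta> \<in> \<Theta> \<Longrightarrow> L2_has_derivative_within T (dT \<theta>) \<rho>\<^sub>0 \<theta> \<Theta>"
    and "\<And>\<theta> v w. \<theta> \<in> \<Theta> \<Longrightarrow> v \<in> Tan \<Theta> \<theta> \<Longrightarrow> w \<in> Tan \<Theta> \<theta> \<Longrightarrow>
           (AE x in \<rho>\<^sub>0. dT \<theta> v x = dT \<theta> w x) \<Longrightarrow> v = w"
    and "wasserstein_differentiable D"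
  shows "L2_differentiable \<rho>\<^sub>0 F \<and>
    (\<forall>\<theta>\<in>\<Theta>. \<exists>g. is_natural_gradient \<rho>\<^sub>0 \<Theta> T dT F \<theta> g \<and> projected_velocities D \<rho>\<^sub>0 \<Theta> T dT \<theta> = {- g}) \<and>
    (\<forall>I \<theta>. is_interval I \<longrightarrow> interior I \<noteq> {} \<longrightarrow>
       solves_inclusion (projected_velocities D \<rho>\<^sub>0 \<Theta> T dT) \<Theta> I \<theta> \<longleftrightarrow>
       natural_gradient_flow \<rho>\<^sub>0 \<Theta> T dT F I \<theta>)"
proof -
  have prob: "prob_space \<rho>\<^sub>0" using assms(2) by (simp add: P2_ac_def P2_def)
  have T: "T \<theta> \<in> L2 \<rho>\<^sub>0" if "\<theta> \<in> \<Theta>" for \<theta>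
    using assms(4)[OF that] by (simp add: convex_gradients_def)
  have diff: "L2_differentiable \<rho>\<^sub>0 F"
    unfolding L2_differentiable_def F_def
    using wasserstein_gradient_frechet(2)[OF assms(7) prob] by blast
  have "\<exists>g. (\<forall>g'. is_natural_gradient \<rho>\<^sub>0 \<Theta> T dT F \<theta> g' \<longleftrightarrow> g' = g) \<and>
      projected_velocities D \<rho>\<^sub>0 \<Theta> T dT \<theta> = {- g}" if \<theta>: "\<theta> \<in> \<Theta>" for \<theta>
    unfolding F_def
  proof (rule projected_velocities_natural_gradient[where T = T and dT = dT, OF assms(7) prob assms(3) \<theta> T])
    show "L2_has_derivative_within T (dT \<theta>) \<rho>\<^sub>0 \<theta> \<Theta>" by (rule assms(5)[OF \<theta>])
    show "v = w" if "v \<in> Tan \<Theta> \<theta>" "w \<in> Tan \<Theta> \<theta>" "AE x in \<rho>\<^sub>0. dT \<theta> v x = dT \<theta> w x" for v w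
      by (rule assms(6)[OF \<theta> that])
  qed
  then obtain g where g: "\<And>\<theta> g'. \<theta> \<in> \<Theta> \<Longrightarrow> is_natural_gradient \<rho>\<^sub>0 \<Theta> T dT F \<theta> g' \<longleftrightarrow> g' = g \<theta>"
    and pv: "\<And>\<theta>. \<theta> \<in> \<Theta> \<Longrightarrow> projected_velocities D \<rho>\<^sub>0 \<Theta> T dT \<theta> = {- g \<theta>}"
    by metis
  \<comment> \<open>Equality of the velocity sets at points of \<Theta> suffices, since a solution
    stays in \<Theta> by definition.\<close>
  have "{- g' |g'. is_natural_gradient \<rho>\<^sub>0 \<Theta> T dT F \<theta> g'} = projected_velocities D \<rho>\<^sub>0 \<Theta> T dT \<theta>" if "\<theta> \<in> \<Theta>" for \<theta>
    using g[OF that] pv[OF that] by auto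
  then have "solves_inclusion (projected_velocities D \<rho>\<^sub>0 \<Theta> T dT) \<Theta> I \<theta> \<longleftrightarrow>
      natural_gradient_flow \<rho>\<^sub>0 \<Theta> T dT F I \<theta>" for I \<theta>
    unfolding natural_gradient_flow_def solves_inclusion_def
    by (intro ball_cong conj_cong refl) simp
  with diff g pv show ?thesis by blast
qed

end
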